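(* Let $k$ be a field of characteristic zero, let $\mathcal{W}_n$ be $S_n$, $B_n$ or $D_n$, let $r\in\mathbb{Z}_{>0}$ and let $J\in\mathbb{Z}_{\ge0}^r$. For all $n$ sufficiently large (depending on $J$), the characters of the $\mathcal{W}_n$-representations $\mathcal{C}^{(r)}_J(n)$ are given by a character polynomial $F_J$ (independent of $n$) of degree $\le|J|$. In particular, for all $n$ in this stable range, the dimension of $\mathcal{C}^{(r)}_J(n)$ is given by the polynomial $\dim_k\mathcal{C}^{(r)}_J(n)=F_J(n,0,0,0,\dots)$.
   Context: **Coinvariant algebras.** $V_n=\mathrm{Span}_k\langle x_1,\dots,x_n\rangle\cong k^n$, on which $S_n$ acts by permutation matrices, the hyperoctahedral group $B_n$ by signed permutation matrices, and $D_n\subset B_n$ by signed permutation matrices with an even number of entries equal to $-1$. $\mathcal{W}_n$ acts diagonally on $V_n^{\oplus r}$ and hence on $\mathrm{Sym}(V_n^{\oplus r})\cong k[x_1^{(1)},\dots,x_n^{(1)},\dots,x_1^{(r)},\dots,x_n^{(r)}]$. $\mathcal{I}_n$ is the ideal generated by the $\mathcal{W}_n$-invariant polynomials with zero constant term, and $\mathcal{C}^{(r)}(n)$, the $r$-diagonal coinvariant algebra, is the quotient by $\mathcal{I}_n$. It is multigraded by $J=(j_1,\dots,j_r)$, $j_i$ being the total degree in $x_1^{(i)},\dots,x_n^{(i)}$; $|J|=j_1+\cdots+j_r$; $\mathcal{C}^{(r)}_J(n)$ is the component of multidegree $J$. **Character polynomials.** For $S_n$: polynomials in $k[X_1,X_2,\dots]$,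 where $X_i(\sigma)$ is the number of $i$-cycles of $\sigma$. For $B_n$ and $D_n$: polynomials in $k[X_1,Y_1,X_2,Y_2,\dots]$, where $X_i(\omega)$, $Y_i(\omega)$ are the numbers of positive, resp. negative, $i$-cycles of $\omega\in B_n$ (viewing $\omega$ as a permutation of $\{\pm1,\dots,\pm n\}$, a positive $i$-cycle is a factor $(a_1\cdots a_i)(-a_1\cdots-a_i)$ with distinct $|a_j|$, and a negative $i$-cycle is a factor $(a_1\cdots a_i\,-a_1\cdots-a_i)$). Degree is taken with $\deg X_i=\deg Y_i=i$. $F_J(n,0,0,\dots)$ is the value with $X_1=n$ and all other variables $0$, i.e. the value at the identity. *)

theory Defs
  imports
    "Jordan_Normal_Form.VS_Connect"
    "HOL-Algebra.QuotRing"
    "HOL-Combinatorics.Orbits"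
    "HOL-Library.Poly_Mapping"
begin

text \<open>Vector spaces over a field type are modules over
  \<^const>\<open>class_ring\<close> in the sense of the locale \<^locale>\<open>vectorspace\<close>.\<close>

definition coord :: "('k::field, 'v) module \<Rightarrow> 'v set \<Rightarrow> 'v \<Rightarrow> 'v \<Rightarrow> 'k" where
  "coord V B v = (THE a. a \<in> B \<rightarrow>\<^sub>E UNIV \<and> LinearCombinations.module.lincomb V a B = v)"

text \<open>The trace is computed in an arbitrarily chosen basis; it is meant for finite-dimensional
  spaces only.\<close>
definition lin_trace :: "('k::field, 'v) module \<Rightarrow> ('v \<Rightarrow> 'v) \<Rightarrow> 'k" where
  "lin_trace V T =
    (let B = (SOME B. finite B \<and> vectorspace.basis class_ring V B)
     in (\<Sum>b\<in>B. coord V B (T b) b))"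

text \<open>Multivariate polynomials with variables in \<open>'v\<close> are finitely supported maps from monomials
  (finitely supported exponent maps) to coefficients.\<close>

type_synonym ('v, 'k) mpol = "('v \<Rightarrow>\<^sub>0 nat) \<Rightarrow>\<^sub>0 'k"

text \<open>The ring homomorphism that is \<open>h\<close> on coefficients and sends each variable \<open>v\<close> to \<open>f v\<close>.\<close>
definition mpol_eval :: "('k \<Rightarrow> 'b) \<Rightarrow> ('v \<Rightarrow> 'b) \<Rightarrow> ('v, 'k::zero) mpol \<Rightarrow> 'b::comm_semiring_1" where
  "mpol_eval h f p =
    (\<Sum>m\<in>Poly_Mapping.keys p. h (Poly_Mapping.lookup p m) *
      (\<Prod>v\<in>Poly_Mapping.keys m. f v ^ Poly_Mapping.lookup m v))"

definition mpol_const :: "'k \<Rightarrow> ('v, 'k::zero) mpol" where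
  "mpol_const c = Poly_Mapping.single 0 c"

text \<open>Signed permutations are permutations \<open>w\<close> of \<open>{\<plusminus>1, \<dots>, \<plusminus>n}\<close> with \<open>w (- a) = - w a\<close>; the matrix
  of \<open>w\<close> sends the basis vector \<open>x\<^sub>i\<close> to \<open>sgn (w i) x\<^bsub>|w i|\<^esub>\<close>. The symmetric group is the subgroup
  of those \<open>w\<close> that permute \<open>{1, \<dots>, n}\<close>.\<close>

datatype weyl_type = TypeS | TypeB | TypeD

definition signed_perms :: "nat \<Rightarrow> (int \<Rightarrow> int) set" where
  "signed_perms n = {w. w permutes ({- int n..int n} - {0}) \<and> (\<forall>a. w (- a) = - w a)}"

fun weyl_group :: "weyl_type \<Rightarrow> nat \<Rightarrow> (int \<Rightarrow> int) set" where
  "weyl_group TypeS n = {w \<in> signed_perms n. w ` {1..int n} = {1..int n}}"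
| "weyl_group TypeB n = signed_perms n"
| "weyl_group TypeD n = {w \<in> signed_perms n. even (card {a \<in> {1..int n}. w a < 0})}"

text \<open>The pair \<open>(i, j)\<close> stands for the variable \<open>x\<^sub>i\<close> of the \<open>j\<close>-th copy of \<open>V\<^sub>n\<close>.\<close>

definition diag_polys :: "nat \<Rightarrow> nat \<Rightarrow> (nat \<times> nat, 'k::zero) mpol set" where
  "diag_polys n r = {p. \<forall>m\<in>Poly_Mapping.keys p. Poly_Mapping.keys m \<subseteq> {1..n} \<times> {1..r}}"

definition diag_ring :: "nat \<Rightarrow> nat \<Rightarrow> (nat \<times> nat, 'k::field) mpol ring" where
  "diag_ring n r = class_ring\<lparr>carrier := diag_polys n r\<rparr>"

definition diag_act ::
    "(int \<Rightarrow> int) \<Rightarrow> (nat \<times> nat, 'k::field) mpol \<Rightarrow> (nat \<times> nat, 'k) mpol" where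
  "diag_act w = mpol_eval mpol_const
    (\<lambda>(i, j). Poly_Mapping.single (Poly_Mapping.single (nat \<bar>w (int i)\<bar>, j) 1)
                (of_int (sgn (w (int i)))))"

definition invariants_no_const ::
    "weyl_type \<Rightarrow> nat \<Rightarrow> nat \<Rightarrow> (nat \<times> nat, 'k::field) mpol set" where
  "invariants_no_const W n r =
    {p \<in> diag_polys n r. (\<forall>w\<in>weyl_group W n. diag_act w p = p) \<and> Poly_Mapping.lookup p 0 = 0}"

definition coinv_ideal :: "weyl_type \<Rightarrow> nat \<Rightarrow> nat \<Rightarrow> (nat \<times> nat, 'k::field) mpol set" where
  "coinv_ideal W n r = genideal (diag_ring n r) (invariants_no_const W n r)"

definition coinv_class ::
    "weyl_type \<Rightarrow> nat \<Rightarrow> nat \<Rightarrow> (nat \<times> nat, 'k::field) mpol \<Rightarrow> (nat \<times> nat, 'k) mpol set" where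
  "coinv_class W n r p = coinv_ideal W n r +>\<^bsub>diag_ring n r\<^esub> p"

definition coinv_algebra ::
    "weyl_type \<Rightarrow> nat \<Rightarrow> nat \<Rightarrow> ('k::field, (nat \<times> nat, 'k) mpol set) module" where
  "coinv_algebra W n r =
    (let Q = diag_ring n r Quot coinv_ideal W n r
     in ring.extend Q (module.fields (\<lambda>c A. coinv_class W n r (mpol_const c) \<otimes>\<^bsub>Q\<^esub> A)))"

definition multihomogeneous ::
    "nat \<Rightarrow> nat \<Rightarrow> (nat \<Rightarrow> nat) \<Rightarrow> (nat \<times> nat, 'k::zero) mpol set" where
  "multihomogeneous n r J =
    {p \<in> diag_polys n r. \<forall>m\<in>Poly_Mapping.keys p.
       \<forall>j\<in>{1..r}. (\<Sum>i = 1..n. Poly_Mapping.lookup m (i, j)) = J j}"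

definition coinv_component ::
    "weyl_type \<Rightarrow> nat \<Rightarrow> nat \<Rightarrow> (nat \<Rightarrow> nat) \<Rightarrow> ('k::field, (nat \<times> nat, 'k) mpol set) module" where
  "coinv_component W n r J =
    (coinv_algebra W n r)\<lparr>carrier := coinv_class W n r ` multihomogeneous n r J\<rparr>"

text \<open>A group element acts on cosets by taking images; on \<open>I + p\<close> this is \<open>I + w p\<close>, as the ideal
  \<open>I\<close> is stable under the group.\<close>
definition coinv_character :: "weyl_type \<Rightarrow> nat \<Rightarrow> nat \<Rightarrow> (nat \<Rightarrow> nat) \<Rightarrow> (int \<Rightarrow> int) \<Rightarrow> 'k::field" where
  "coinv_character W n r J w =
    lin_trace (coinv_component W n r J :: ('k, (nat \<times> nat, 'k) mpol set) module)
      (\<lambda>A. diag_act w ` A)"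

definition coinv_dim :: "'k::field itself \<Rightarrow> weyl_type \<Rightarrow> nat \<Rightarrow> nat \<Rightarrow> (nat \<Rightarrow> nat) \<Rightarrow> nat" where
  "coinv_dim _ W n r J =
    vectorspace.dim class_ring (coinv_component W n r J :: ('k, (nat \<times> nat, 'k) mpol set) module)"

text \<open>Character polynomials: \<open>PosCyc i\<close> is the variable \<open>X\<^sub>i\<close> and \<open>NegCyc i\<close> the variable \<open>Y\<^sub>i\<close>,
  for \<open>i \<ge> 1\<close>.\<close>

datatype cycle_var = PosCyc nat | NegCyc nat

fun var_degree :: "cycle_var \<Rightarrow> nat" where
  "var_degree (PosCyc i) = i"
| "var_degree (NegCyc i) = i"

fun cycle_vars :: "weyl_type \<Rightarrow> cycle_var set" where
  "cycle_vars TypeS = {PosCyc i | i. i \<ge> 1}"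
| "cycle_vars TypeB = {PosCyc i | i. i \<ge> 1} \<union> {NegCyc i | i. i \<ge> 1}"
| "cycle_vars TypeD = {PosCyc i | i. i \<ge> 1} \<union> {NegCyc i | i. i \<ge> 1}"

definition char_polys :: "weyl_type \<Rightarrow> (cycle_var, 'k::zero) mpol set" where
  "char_polys W = {F. \<forall>m\<in>Poly_Mapping.keys F. Poly_Mapping.keys m \<subseteq> cycle_vars W}"

definition char_poly_degree :: "(cycle_var, 'k::zero) mpol \<Rightarrow> nat" where
  "char_poly_degree F =
    Max (insert 0 ((\<lambda>m. \<Sum>v\<in>Poly_Mapping.keys m. var_degree v * Poly_Mapping.lookup m v)
      ` Poly_Mapping.keys F))"

definition char_poly_value :: "(cycle_var \<Rightarrow> nat) \<Rightarrow> (cycle_var, 'k::field) mpol \<Rightarrow> 'k" where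
  "char_poly_value \<xi> F = mpol_eval id (\<lambda>v. of_nat (\<xi> v)) F"

text \<open>A positive \<open>i\<close>-cycle is a pair of distinct orbits \<open>{a\<^sub>1, \<dots>, a\<^sub>i}\<close>, \<open>{- a\<^sub>1, \<dots>, - a\<^sub>i}\<close>, counted
  once. A negative \<open>i\<close>-cycle is a single orbit \<open>{a\<^sub>1, \<dots>, a\<^sub>i, - a\<^sub>1, \<dots>, - a\<^sub>i}\<close> with \<open>2 i\<close>
  elements.\<close>

definition pos_cycles :: "nat \<Rightarrow> (int \<Rightarrow> int) \<Rightarrow> nat \<Rightarrow> int set set set" where
  "pos_cycles n w i =
    {{orbit w a, uminus ` orbit w a} | a.
       a \<in> {- int n..int n} - {0} \<and> card (orbit w a) = i \<and> inj_on abs (orbit w a)}"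

definition neg_cycles :: "nat \<Rightarrow> (int \<Rightarrow> int) \<Rightarrow> nat \<Rightarrow> int set set" where
  "neg_cycles n w i =
    {orbit w a | a.
       a \<in> {- int n..int n} - {0} \<and> card (orbit w a) = 2 * i \<and> uminus ` orbit w a = orbit w a}"

definition perm_cycles :: "nat \<Rightarrow> (int \<Rightarrow> int) \<Rightarrow> nat \<Rightarrow> int set set" where
  "perm_cycles n w i = {orbit w a | a. a \<in> {1..int n} \<and> card (orbit w a) = i}"

fun signed_cycle_count :: "nat \<Rightarrow> (int \<Rightarrow> int) \<Rightarrow> cycle_var \<Rightarrow> nat" where
  "signed_cycle_count n w (PosCyc i) = card (pos_cycles n w i)"
| "signed_cycle_count n w (NegCyc i) = card (neg_cycles n w i)"

text \<open>For the symmetric group there are no variables \<open>Y\<^sub>i\<close>; their value is irrelevant.\<close>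
fun perm_cycle_count :: "nat \<Rightarrow> (int \<Rightarrow> int) \<Rightarrow> cycle_var \<Rightarrow> nat" where
  "perm_cycle_count n w (PosCyc i) = card (perm_cycles n w i)"
| "perm_cycle_count n w (NegCyc i) = 0"

fun cycle_count :: "weyl_type \<Rightarrow> nat \<Rightarrow> (int \<Rightarrow> int) \<Rightarrow> cycle_var \<Rightarrow> nat" where
  "cycle_count TypeS n w = perm_cycle_count n w"
| "cycle_count TypeB n w = signed_cycle_count n w"
| "cycle_count TypeD n w = signed_cycle_count n w"

end

theory Submission
  imports Defs "HOL-Library.Function_Algebras"
begin

text \<open>Let \<open>p\<^sub>A = \<Sum>\<^sub>i x\<^sub>i\<^bsup>A\<^esup>\<close> for \<open>A \<in> \<nat>\<^sup>r\<close> be the polarized power sums, with \<open>|A|\<close> even in types \<open>B\<close> and \<open>D\<close>.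
  In degrees small against \<open>n\<close> they generate the invariant ideal, and the polynomial ring is free over the
  ring that they generate. For the freeness, each \<open>A\<close> gets its own index \<open>s(A)\<close>, and
  weights on the variables are chosen for which the ideal contains an element with leading monomial
  \<open>x\<^bsub>s(A)\<^esub>\<^bsup>A\<^esup>\<close>. These monomials are pairwise coprime, so a dimension count shows that the products
  of power sums with the monomials that none of them divides form a basis.
  Reading off the trace of a group element in this basis gives
  \<open>tr(Sym\<^sub>J) = \<Sum>\<^sub>\<kappa> tr(C\<^bsub>J - |\<kappa>|\<^esub>)\<close>, where \<open>\<kappa>\<close> runs over the multisets of exponents with sum \<open>|\<kappa>| \<le> J\<close>,
  a set that does not depend on \<open>n\<close>. The left-hand side is a character polynomial by Newton's identities,
  and the characters of the \<open>C\<^sub>J\<close> follow by recursion.\<close>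

section \<open>Multivariate polynomials\<close>

text \<open>There are infinitely many power sums but only nr variables, so freeness can hold only in
  degrees bounded in terms of n. It is proved one multidegree at a time, and no monomial order is
  required: a real-valued weight is enough, because a multidegree has finitely many monomials and a
  reduction only has to lower the weight. Up to a small correction, an index that is the slot of A
  weighs an exponent B by the length of the projection of B to the direction of A. For fixed B this
  is largest in the direction of B itself, so \<open>x_i^A\<close> weighs most at i = s(A), except
  for ties between exponents on a common ray A', 2A', 3A', ... These ties are the obstacle. They are
  resolved by the complete symmetric polynomial \<open>h_c\<close> in the \<open>x_i^(A')\<close>,
  for A = cA': it stays in the ideal when up to c - 1 of its variables are removed, and the slots of
  A', ..., (c-1)A' are exactly that many. Two conditions on n carry each step of the recursion:
  there must be enough indices for the slots of all exponents below J, and n > |J| excludes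
  invariants of \<open>D_n\<close> such as \<open>x_1 ... x_n\<close>.\<close>

type_synonym 'k diag_poly = "(nat \<times> nat, 'k) mpol"

abbreviation lookup :: "('a \<Rightarrow>\<^sub>0 'b::zero) \<Rightarrow> 'a \<Rightarrow> 'b" where "lookup \<equiv> Poly_Mapping.lookup"
abbreviation keys :: "('a \<Rightarrow>\<^sub>0 'b::zero) \<Rightarrow> 'a set" where "keys \<equiv> Poly_Mapping.keys"
abbreviation single :: "'a \<Rightarrow> 'b \<Rightarrow> 'a \<Rightarrow>\<^sub>0 'b::zero" where "single \<equiv> Poly_Mapping.single"

abbreviation mon :: "('v \<Rightarrow>\<^sub>0 nat) \<Rightarrow> ('v, 'k::zero_neq_one) mpol" where
  "mon m \<equiv> single m 1"

lemma mpol_const_simps: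
  "mpol_const (a + b) = mpol_const a + mpol_const b"
  "mpol_const (a * b) = mpol_const a * (mpol_const b :: ('v, 'k::comm_ring_1) mpol)"
  "mpol_const (0::'k) = 0" "mpol_const (1::'k) = 1"
  by (simp_all add: mpol_const_def single_add mult_single)

lemma lookup_mpol_const_mult [simp]:
  "lookup (mpol_const (c::'k::comm_ring_1) * p) m = c * lookup p m"
  unfolding mpol_const_def mult_map_scale_conv_mult[symmetric]
  by (transfer, auto simp: when_def)

lemma mpol_const_mult_single [simp]:
  "mpol_const (c::'k::comm_ring_1) * single m d = single m (c * d)"
  by (simp add: mpol_const_def mult_single)

global_interpretation mpv: Vector_Spaces.vector_space "\<lambda>(c::'k::field) (p :: ('v, 'k) mpol). mpol_const c * p"
  by unfold_locales (simp_all add: mpol_const_simps algebra_simps)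

lemma mpol_as_sum:
  fixes p :: "('v, 'k::comm_ring_1) mpol"
  assumes "finite S" "keys p \<subseteq> S"
  shows "p = (\<Sum>m\<in>S. single m (lookup p m))"
proof (rule poly_mapping_eqI)
  fix k
  show "lookup p k = lookup (\<Sum>m\<in>S. single m (lookup p m)) k"
    using assms by (auto simp: lookup_sum lookup_single when_def in_keys_iff sum.delta subset_iff)
qed

lemma mpol_as_comb:
  fixes p :: "('v, 'k::comm_ring_1) mpol"
  assumes "finite S" "keys p \<subseteq> S"
  shows "p = (\<Sum>m\<in>S. mpol_const (lookup p m) * mon m)"
  using mpol_as_sum[OF assms] by simp

lemma mpol_eval_superset:
  assumes "finite S" "keys p \<subseteq> S" "h 0 = 0"
  shows "mpol_eval h f p = (\<Sum>m\<in>S. h (lookup p m) *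
      (\<Prod>v\<in>keys m. f v ^ lookup m v))"
  unfolding mpol_eval_def
  by (rule sum.mono_neutral_left) (use assms in \<open>auto simp: in_keys_iff\<close>)

lemma mon_eval_superset:
  fixes f :: "'v \<Rightarrow> 'b::comm_semiring_1"
  assumes "finite S" "keys m \<subseteq> S"
  shows "(\<Prod>v\<in>keys m. f v ^ lookup m v) = (\<Prod>v\<in>S. f v ^ lookup m v)"
  by (rule prod.mono_neutral_left) (use assms in \<open>auto simp: in_keys_iff\<close>)

lemma mon_eval_add:
  fixes f :: "'v \<Rightarrow> 'b::comm_semiring_1"
  shows "(\<Prod>v\<in>keys (m + m'). f v ^ lookup (m + m') v) =
    (\<Prod>v\<in>keys m. f v ^ lookup m v) *
    (\<Prod>v\<in>keys m'. f v ^ lookup m' v)"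
proof -
  let ?S = "keys m \<union> keys m'"
  have "keys (m + m') \<subseteq> ?S" by (rule Poly_Mapping.keys_add)
  then show ?thesis
    using mon_eval_superset[of ?S m f] mon_eval_superset[of ?S m' f] mon_eval_superset[of ?S "m + m'" f]
    by (simp add: lookup_add power_add prod.distrib)
qed

locale mpol_hom =
  fixes h :: "'k::comm_ring_1 \<Rightarrow> 'b::comm_ring_1"
  assumes h_add: "h (a + b) = h a + h b" and h_mult: "h (a * b) = h a * h b"
    and h_zero: "h 0 = 0" and h_one: "h 1 = 1"
begin

lemma eval_add: "mpol_eval h f (p + q) = mpol_eval h f p + mpol_eval h f q"
proof -
  let ?S = "keys p \<union> keys q"
  have "keys (p + q) \<subseteq> ?S" by (rule Poly_Mapping.keys_add)
  then show ?thesis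
    by (simp add: mpol_eval_superset[of ?S] h_zero h_add lookup_add algebra_simps sum.distrib)
qed

lemma eval_0 [simp]: "mpol_eval h f 0 = 0"
  by (simp add: mpol_eval_def)

lemma eval_sum: "mpol_eval h f (\<Sum>x\<in>S. g x) = (\<Sum>x\<in>S. mpol_eval h f (g x))"
  by (induction S rule: infinite_finite_induct) (simp_all add: eval_add)

lemma eval_single: "mpol_eval h f (single m c) =
    h c * (\<Prod>v\<in>keys m. f v ^ lookup m v)"
  by (subst mpol_eval_superset[of "{m}"]) (auto simp: h_zero)

lemma eval_mult: "mpol_eval h f (p * q) = mpol_eval h f p * mpol_eval h f q"
proof -
  let ?P = "keys p" and ?Q = "keys q"
  let ?s = "\<lambda>p m. single m (lookup p m)"
  have p: "p = (\<Sum>m\<in>?P. ?s p m)" and q: "q = (\<Sum>m\<in>?Q. ?s q m)"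
    by (rule mpol_as_sum; simp)+
  have "p * q = (\<Sum>m\<in>?P. \<Sum>m'\<in>?Q. ?s p m * ?s q m')"
    by (subst p, subst q) (simp only: sum_product)
  then have "mpol_eval h f (p * q) = (\<Sum>m\<in>?P. \<Sum>m'\<in>?Q. mpol_eval h f (?s p m * ?s q m'))"
    by (simp only: eval_sum)
  also have "\<dots> = (\<Sum>m\<in>?P. \<Sum>m'\<in>?Q. mpol_eval h f (?s p m) * mpol_eval h f (?s q m'))"
    by (intro sum.cong refl) (simp add: mult_single eval_single h_mult mon_eval_add algebra_simps)
  also have "\<dots> = mpol_eval h f (\<Sum>m\<in>?P. ?s p m) * mpol_eval h f (\<Sum>m\<in>?Q. ?s q m)"
    by (simp only: eval_sum sum_product)
  finally show ?thesis using p q by simp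
qed

lemma eval_1 [simp]: "mpol_eval h f 1 = 1"
  using eval_single[of f 0 1] by (simp add: h_one)

lemma eval_const [simp]: "mpol_eval h f (mpol_const c) = h c"
  by (simp add: mpol_const_def eval_single)

end

interpretation mpol_const: mpol_hom "mpol_const :: 'k::comm_ring_1 \<Rightarrow> ('v, 'k) mpol"
  by unfold_locales (simp_all add: mpol_const_simps)

section \<open>The action on monomials: a monomial goes to a monomial times a sign\<close>

definition act_mon :: "(int \<Rightarrow> int) \<Rightarrow> (nat \<times> nat \<Rightarrow>\<^sub>0 nat) \<Rightarrow> (nat \<times> nat \<Rightarrow>\<^sub>0 nat)" where
  "act_mon w m = (\<Sum>v\<in>keys m.
     single (nat \<bar>w (int (fst v))\<bar>, snd v) (lookup m v))"

definition act_sgn :: "(int \<Rightarrow> int) \<Rightarrow> (nat \<times> nat \<Rightarrow>\<^sub>0 nat) \<Rightarrow> 'k::comm_ring_1" where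
  "act_sgn w m = (\<Prod>v\<in>keys m. of_int (sgn (w (int (fst v)))) ^ lookup m v)"

lemma act_sgn_add: "act_sgn w (m + m') = act_sgn w m * act_sgn w m'"
  unfolding act_sgn_def by (rule mon_eval_add)

lemma act_sgn_0 [simp]: "act_sgn w 0 = 1"
  by (simp add: act_sgn_def)

lemma act_mon_0 [simp]: "act_mon w 0 = 0"
  by (simp add: act_mon_def)

lemma act_mon_superset:
  assumes "finite S" "keys m \<subseteq> S"
  shows "act_mon w m = (\<Sum>v\<in>S. single (nat \<bar>w (int (fst v))\<bar>, snd v) (lookup m v))"
  unfolding act_mon_def
  by (rule sum.mono_neutral_left) (use assms in \<open>auto simp: in_keys_iff\<close>)

lemma act_mon_add: "act_mon w (m + m') = act_mon w m + act_mon w m'"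
proof -
  let ?S = "keys m \<union> keys m'"
  have "keys (m + m') \<subseteq> ?S" by (rule Poly_Mapping.keys_add)
  then show ?thesis
    by (simp add: act_mon_superset[of ?S] lookup_add single_add sum.distrib)
qed

lemma act_mon_single: "act_mon w (single (i, j) a) = single (nat \<bar>w (int i)\<bar>, j) a"
  by (subst act_mon_superset[of "{(i,j)}"]) auto

lemma act_mon_sum: "act_mon w (\<Sum>x\<in>S. f x) = (\<Sum>x\<in>S. act_mon w (f x))"
  by (induction S rule: infinite_finite_induct) (simp_all add: act_mon_add)

lemma act_sgn_single: "act_sgn w (single (i, j) a) = of_int (sgn (w (int i))) ^ a"
  unfolding act_sgn_def by (subst mon_eval_superset[of "{(i,j)}"]) auto

lemma act_sgn_sum: "act_sgn w (\<Sum>x\<in>S. f x) = (\<Prod>x\<in>S. act_sgn w (f x))"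
  by (induction S rule: infinite_finite_induct) (simp_all add: act_sgn_add)

text \<open>The sum of a constant over \<open>{..<a}\<close> stands for the a-fold multiple of the
  exponent m.\<close>

lemma single_power: "single (m :: 'a::comm_monoid_add) c ^ a =
    single (\<Sum>_\<in>{..<a}. m) (c ^ a :: 'k::comm_ring_1)"
  by (induction a) (simp_all add: mult_single add.commute)

lemma prod_single: "(\<Prod>x\<in>S. single (m x) (c x)) =
    single (\<Sum>x\<in>S. m x) (\<Prod>x\<in>S. c x :: 'k::comm_ring_1)"
  by (induction S rule: infinite_finite_induct) (simp_all add: mult_single)

lemma sum_const_single: "(\<Sum>_\<in>{..<a}. single v (1::nat)) = single v a"
  by (induction a) (simp_all add: single_add[symmetric])

lemma diag_act_single:
  fixes c :: "'k::field"
  shows "diag_act w (single m c) = single (act_mon w m) (c * act_sgn w m)"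
proof -
  have "(\<Prod>v\<in>keys m. (case v of (i, j) \<Rightarrow> single (single (nat \<bar>w (int i)\<bar>, j) 1)
                (of_int (sgn (w (int i))))) ^ lookup m v) =
     (single (act_mon w m) (act_sgn w m) :: 'k diag_poly)"
    by (simp add: case_prod_unfold single_power sum_const_single[simplified] prod_single act_mon_def act_sgn_def)
  then show ?thesis
    by (simp add: diag_act_def mpol_const.eval_single)
qed

lemma diag_act_add: "diag_act w (p + q) = diag_act w p + diag_act w q"
  and diag_act_mult: "diag_act w (p * q) = diag_act w p * diag_act w q"
  and diag_act_sum: "diag_act w (\<Sum>x\<in>S. g x) = (\<Sum>x\<in>S. diag_act w (g x))"
  and diag_act_const [simp]: "diag_act w (mpol_const c) = mpol_const c"
  and diag_act_0 [simp]: "diag_act w 0 = 0"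
  and diag_act_1 [simp]: "diag_act w 1 = 1"
  by (simp_all add: diag_act_def mpol_const.eval_add mpol_const.eval_mult mpol_const.eval_sum)

lemma diag_act_scale: "diag_act w (mpol_const c * p) = mpol_const c * diag_act w p"
  by (simp add: diag_act_mult)

section \<open>Signed permutations and monomials\<close>

text \<open>The image of w under the projection from \<open>B_n\<close> to
  \<open>S_n\<close>.\<close>

definition perm_of :: "(int \<Rightarrow> int) \<Rightarrow> nat \<Rightarrow> nat" where
  "perm_of w i = nat \<bar>w (int i)\<bar>"

lemma signed_perms_uminus: "w \<in> signed_perms n \<Longrightarrow> w (- a) = - w a"
  by (simp add: signed_perms_def)

lemma signed_perms_permutes: "w \<in> signed_perms n \<Longrightarrow> w permutes ({- int n..int n} - {0})"
  by (simp add: signed_perms_def)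

lemma signed_perms_abs: "w \<in> signed_perms n \<Longrightarrow> \<bar>w \<bar>a\<bar>\<bar> = \<bar>w a\<bar>"
  by (cases "a \<ge> 0") (simp_all add: signed_perms_uminus)

lemma perm_of_permutes:
  assumes "w \<in> signed_perms n"
  shows "perm_of w permutes {1..n}"
proof -
  note p = signed_perms_permutes[OF assms]
  have inj: "inj (perm_of w)"
  proof (rule injI)
    fix i j assume "perm_of w i = perm_of w j"
    then have "w (int i) = w (int j) \<or> w (int i) = w (- int j)"
      unfolding perm_of_def by (auto simp: signed_perms_uminus[OF assms])
    then have "int i = int j \<or> int i = - int j"
      using permutes_inj[OF p] by (auto dest: injD)
    then show "i = j" by auto
  qed
  have "perm_of w i \<in> {1..n}" if "i \<in> {1..n}" for i
  proof -
    have "w (int i) \<in> {- int n..int n} - {0}" using p that by (subst permutes_in_image) auto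
    then show ?thesis by (auto simp: perm_of_def)
  qed
  then have "perm_of w ` {1..n} \<subseteq> {1..n}" by blast
  then have "perm_of w ` {1..n} = {1..n}"
    using inj by (simp add: endo_inj_surj inj_on_subset)
  then have bij: "bij_betw (perm_of w) {1..n} {1..n}" using inj_on_subset[OF inj subset_UNIV] by (simp add: bij_betw_def)
  show ?thesis
  proof (rule bij_imp_permutes[OF bij])
    fix i assume "i \<notin> {1..n}"
    then have "int i \<notin> {- int n..int n} - {0}" by auto
    then show "perm_of w i = i" using permutes_not_in[OF p] by (simp add: perm_of_def)
  qed
qed

lemma perm_of_neq_0:
  assumes "w \<in> signed_perms n" "i \<in> {1..n}"
  shows "w (int i) \<noteq> 0" "sgn (w (int i)) \<in> {1, -1}"
proof -
  have "perm_of w i \<in> {1..n}"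
    using permutes_in_image[OF perm_of_permutes[OF assms(1)]] assms(2) by blast
  then show "w (int i) \<noteq> 0" by (auto simp: perm_of_def)
  then show "sgn (w (int i)) \<in> {1, -1}" by (auto simp: sgn_if)
qed

lemma signed_perm_decomp:
  "w (int i) = sgn (w (int i)) * int (perm_of w i)"
  by (simp add: perm_of_def sgn_mult_abs)

lemma weyl_group_signed: "w \<in> weyl_group W n \<Longrightarrow> w \<in> signed_perms n"
  by (cases W) auto

lemma weyl_group_TypeS_sgn:
  assumes "w \<in> weyl_group TypeS n" "i \<in> {1..n}"
  shows "sgn (w (int i)) = 1"
proof -
  have "w (int i) \<in> {1..int n}" using assms by auto
  then show ?thesis by simp
qed

lemma id_weyl_group: "id \<in> weyl_group W n"
proof -
  have *: "{a. 1 \<le> a \<and> a \<le> int n \<and> a < 0} = {}" by auto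
  show ?thesis
    by (cases W) (auto simp: signed_perms_def permutes_id *)
qed

section \<open>Unsigned permutations and sign changes, the elements on which invariance is
  tested\<close>

definition sperm :: "(nat \<Rightarrow> nat) \<Rightarrow> int \<Rightarrow> int" where
  "sperm \<sigma> a = sgn a * int (\<sigma> (nat \<bar>a\<bar>))"

definition flip :: "nat set \<Rightarrow> int \<Rightarrow> int" where
  "flip S a = (if nat \<bar>a\<bar> \<in> S then - a else a)"

lemma flip_signed:
  assumes "S \<subseteq> {1..n}"
  shows "flip S \<in> signed_perms n"
proof -
  have inv: "flip S (flip S a) = a" for a by (simp add: flip_def)
  have "flip S permutes ({- int n..int n} - {0})"
  proof (rule bij_imp_permutes)
    show "bij_betw (flip S) ({- int n..int n} - {0}) ({- int n..int n} - {0})"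
      by (rule bij_betwI[where g = "flip S"]) (auto simp: inv, auto simp: flip_def split: if_splits)
  next
    fix x assume "x \<notin> {- int n..int n} - {0}"
    then have "nat \<bar>x\<bar> \<notin> {1..n}" by auto
    then show "flip S x = x" using assms by (auto simp: flip_def)
  qed
  then show ?thesis by (auto simp: signed_perms_def flip_def)
qed

lemma perm_of_flip [simp]: "perm_of (flip S) i = i"
  by (simp add: perm_of_def flip_def)

lemma flip_TypeD:
  assumes "S \<subseteq> {1..n}" "even (card S)"
  shows "flip S \<in> weyl_group TypeD n"
proof -
  have "{a \<in> {1..int n}. flip S a < 0} = int ` S"
  proof (intro equalityI subsetI)
    fix a assume "a \<in> {a \<in> {1..int n}. flip S a < 0}"
    then have "nat \<bar>a\<bar> \<in> S" "a = int (nat \<bar>a\<bar>)" by (auto simp: flip_def split: if_splits)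
    then show "a \<in> int ` S" by blast
  next
    fix a assume "a \<in> int ` S"
    then show "a \<in> {a \<in> {1..int n}. flip S a < 0}" using assms(1) by (auto simp: flip_def)
  qed
  moreover have "card (int ` S) = card S" by (simp add: card_image)
  ultimately show ?thesis using assms flip_signed[OF assms(1)] by simp
qed

lemma sperm_pos:
  assumes "\<sigma> permutes {1..n}" "a \<in> {1..int n}"
  shows "sperm \<sigma> a \<in> {1..int n}" "sgn (sperm \<sigma> a) = 1"
proof -
  have "\<sigma> (nat \<bar>a\<bar>) \<in> {1..n}" using assms by (subst permutes_in_image) auto
  then show "sperm \<sigma> a \<in> {1..int n}" using assms by (auto simp: sperm_def)
  then show "sgn (sperm \<sigma> a) = 1" by simp
qed

lemma sperm_inverse:
  assumes "\<sigma> permutes {1..n}" "\<tau> permutes {1..n}" "\<And>i. \<sigma> (\<tau> i) = i"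
  shows "sperm \<sigma> (sperm \<tau> a) = a"
proof (cases "a = 0")
  case False
  have "\<tau> (nat \<bar>a\<bar>) \<noteq> 0"
  proof
    assume "\<tau> (nat \<bar>a\<bar>) = 0"
    moreover have "\<tau> 0 = 0" using assms(2) by (simp add: permutes_def)
    ultimately have "nat \<bar>a\<bar> = 0" using permutes_inj[OF assms(2)] by (metis injD)
    then show False using False by simp
  qed
  then have "nat \<bar>sperm \<tau> a\<bar> = \<tau> (nat \<bar>a\<bar>)" "sgn (sperm \<tau> a) = sgn a"
    using False by (auto simp: sperm_def abs_mult sgn_mult)
  then show ?thesis by (simp add: sperm_def[of \<sigma>] assms(3) sgn_mult_abs)
qed (simp add: sperm_def)

lemma sperm_weyl_group:
  assumes "\<sigma> permutes {1..n}"
  shows "sperm \<sigma> \<in> weyl_group W n"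
proof -
  let ?\<tau> = "inv_into UNIV \<sigma>"
  have \<tau>: "?\<tau> permutes {1..n}" using assms by (rule permutes_inv)
  have inv: "sperm \<sigma> (sperm ?\<tau> a) = a" "sperm ?\<tau> (sperm \<sigma> a) = a" for a
    using assms \<tau> by (auto intro!: sperm_inverse simp: permutes_inverses)
  have im: "sperm \<rho> x \<in> {- int n..int n} - {0}" if "\<rho> permutes {1..n}" "x \<in> {- int n..int n} - {0}" for \<rho> x
  proof -
    have "\<rho> (nat \<bar>x\<bar>) \<in> {1..n}" using that by (subst permutes_in_image) auto
    then show ?thesis using that(2) by (cases "x > 0") (auto simp: sperm_def)
  qed
  have "sperm \<sigma> permutes ({- int n..int n} - {0})"
  proof (rule bij_imp_permutes)
    show "bij_betw (sperm \<sigma>) ({- int n..int n} - {0}) ({- int n..int n} - {0})"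
      by (rule bij_betwI[where g = "sperm ?\<tau>"]) (use im assms \<tau> inv in auto)
  next
    fix x assume x: "x \<notin> {- int n..int n} - {0}"
    then have "nat \<bar>x\<bar> \<notin> {1..n}" by auto
    then show "sperm \<sigma> x = x" using permutes_not_in[OF assms] by (simp add: sperm_def sgn_mult_abs)
  qed
  then have sg: "sperm \<sigma> \<in> signed_perms n" by (simp add: signed_perms_def sperm_def)
  moreover have "sperm \<sigma> ` {1..int n} = {1..int n}"
  proof
    show "sperm \<sigma> ` {1..int n} \<subseteq> {1..int n}" using sperm_pos(1)[OF assms] by blast
    show "{1..int n} \<subseteq> sperm \<sigma> ` {1..int n}"
      using sperm_pos(1)[OF \<tau>] inv(1) by (metis image_eqI subsetI)
  qed
  moreover have "{a \<in> {1..int n}. sperm \<sigma> a < 0} = {}" using sperm_pos(1)[OF assms] by force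
  ultimately show ?thesis by (cases W) (simp_all del: Collect_empty_eq)
qed

lemma perm_of_sperm: "\<sigma> permutes {1..n} \<Longrightarrow> perm_of (sperm \<sigma>) = \<sigma>"
proof
  fix i assume *: "\<sigma> permutes {1..n}"
  show "perm_of (sperm \<sigma>) i = \<sigma> i"
  proof (cases "i = 0")
    case True then show ?thesis using * by (simp add: perm_of_def sperm_def permutes_def)
  qed (simp add: perm_of_def sperm_def)
qed

section \<open>Monomials, their rows and their multidegrees\<close>

locale diag =
  fixes n r :: nat
begin

definition mons :: "(nat \<times> nat \<Rightarrow>\<^sub>0 nat) set" where
  "mons = {m. keys m \<subseteq> {1..n} \<times> {1..r}}"

text \<open>Set to 0 outside \<open>{1..r}\<close>, so that equal multidegrees are equal functions
  and the pointwise order compares them.\<close>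

definition mdeg :: "(nat \<times> nat \<Rightarrow>\<^sub>0 nat) \<Rightarrow> nat \<Rightarrow> nat" where
  "mdeg m = (\<lambda>j. if j \<in> {1..r} then \<Sum>i = 1..n. lookup m (i, j) else 0)"

definition row :: "(nat \<times> nat \<Rightarrow>\<^sub>0 nat) \<Rightarrow> nat \<Rightarrow> nat \<Rightarrow> nat" where
  "row m i = (\<lambda>j. if j \<in> {1..r} then lookup m (i, j) else 0)"

text \<open>The exponent of \<open>x_i^A\<close>, the product over the copies j of the A j-th powers
  of the variables (i, j).\<close>

definition blk :: "nat \<Rightarrow> (nat \<Rightarrow> nat) \<Rightarrow> (nat \<times> nat \<Rightarrow>\<^sub>0 nat)" where
  "blk i A = (\<Sum>j = 1..r. single (i, j) (A j))"

definition vecs :: "(nat \<Rightarrow> nat) set" where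
  "vecs = {A. \<forall>j. j \<notin> {1..r} \<longrightarrow> A j = 0}"

definition tot :: "(nat \<Rightarrow> nat) \<Rightarrow> nat" where
  "tot A = (\<Sum>j = 1..r. A j)"

definition mono_of :: "(nat \<Rightarrow> nat) \<Rightarrow> (nat \<times> nat \<Rightarrow>\<^sub>0 nat) set" where
  "mono_of J = {m \<in> mons. mdeg m = J}"

lemma lookup_blk: "lookup (blk i A) (i', j) = (if i' = i \<and> j \<in> {1..r} then A j else 0)"
  unfolding blk_def lookup_sum lookup_single when_def by auto

lemma blk_add: "blk i (A + B) = blk i A + blk i B"
  by (simp add: blk_def single_add sum.distrib)

lemma blk_0 [simp]: "blk i 0 = 0"
  by (simp add: blk_def)

lemma blk_in_mons [simp]: "i \<in> {1..n} \<Longrightarrow> blk i A \<in> mons"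
  by (auto simp: mons_def in_keys_iff lookup_blk split: if_splits)

lemma mons_lookup: "m \<in> mons \<Longrightarrow> v \<notin> {1..n} \<times> {1..r} \<Longrightarrow> lookup m v = 0"
  by (auto simp: mons_def in_keys_iff)

lemma mons_add_iff [simp]: "m + m' \<in> mons \<longleftrightarrow> m \<in> mons \<and> m' \<in> mons"
  by (auto simp: mons_def in_keys_iff lookup_add subset_iff)

lemma mons_0 [simp]: "0 \<in> mons"
  by (simp add: mons_def)

lemma mdeg_add: "mdeg (m + m') = mdeg m + mdeg m'"
  by (auto simp: mdeg_def lookup_add sum.distrib fun_eq_iff)

lemma mdeg_0 [simp]: "mdeg 0 = 0"
  by (auto simp: mdeg_def fun_eq_iff)

lemma row_vecs [simp]: "row m i \<in> vecs"
  by (simp add: row_def vecs_def)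

lemma vecs_add [simp]: "A \<in> vecs \<Longrightarrow> B \<in> vecs \<Longrightarrow> A + B \<in> vecs"
  by (simp add: vecs_def)

lemma tot_add: "tot (A + B) = tot A + tot B"
  by (simp add: tot_def sum.distrib)

lemma tot_0 [simp]: "tot 0 = 0"
  by (simp add: tot_def)

lemma tot_eq_0_iff: "A \<in> vecs \<Longrightarrow> tot A = 0 \<longleftrightarrow> A = 0"
  by (auto simp: tot_def vecs_def fun_eq_iff)

lemma mdeg_blk: "i \<in> {1..n} \<Longrightarrow> A \<in> vecs \<Longrightarrow> mdeg (blk i A) = A"
  by (auto simp: mdeg_def lookup_blk vecs_def fun_eq_iff)

lemma row_add: "row (m + m') i = row m i + row m' i"
  by (auto simp: row_def lookup_add fun_eq_iff)

lemma row_0 [simp]: "row 0 i = 0"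
  by (auto simp: row_def fun_eq_iff)

lemma row_blk: "A \<in> vecs \<Longrightarrow> row (blk i A) i' = (if i' = i then A else 0)"
  by (auto simp: row_def lookup_blk vecs_def fun_eq_iff)

lemma mons_eqI:
  assumes "m \<in> mons" "m' \<in> mons" "\<And>i. i \<in> {1..n} \<Longrightarrow> row m i = row m' i"
  shows "m = m'"
proof (rule poly_mapping_eqI)
  fix v :: "nat \<times> nat"
  show "lookup m v = lookup m' v"
  proof (cases "v \<in> {1..n} \<times> {1..r}")
    case True
    then have "row m (fst v) (snd v) = row m' (fst v) (snd v)" using assms(3)[of "fst v"] by auto
    then show ?thesis using True by (auto simp: row_def)
  qed (simp add: mons_lookup assms(1,2))
qed

lemma mons_sum: "(\<And>x. x \<in> S \<Longrightarrow> f x \<in> mons) \<Longrightarrow> sum f S \<in> mons"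
  by (induction S rule: infinite_finite_induct) auto

lemma row_sum: "row (sum f S) i = (\<Sum>x\<in>S. row (f x) i)"
  by (induction S rule: infinite_finite_induct) (auto simp: row_add)

lemma mdeg_sum: "mdeg (sum f S) = (\<Sum>x\<in>S. mdeg (f x))"
  by (induction S rule: infinite_finite_induct) (auto simp: mdeg_add)

lemma mons_as_blks: "m \<in> mons \<Longrightarrow> m = (\<Sum>i = 1..n. blk i (row m i))"
proof (rule mons_eqI)
  fix i assume "i \<in> {1..n}"
  then show "row m i = row (\<Sum>i = 1..n. blk i (row m i)) i"
    by (simp add: row_sum row_blk)
qed (auto intro!: mons_sum)

lemma mdeg_as_rows: "mdeg m = (\<Sum>i = 1..n. row m i)"
proof
  fix j
  have "sum f S j = (\<Sum>i\<in>S. f i j)" for f :: "nat \<Rightarrow> nat \<Rightarrow> nat" and S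
    by (induction S rule: infinite_finite_induct) auto
  then show "mdeg m j = (\<Sum>i = 1..n. row m i) j"
    by (cases "j \<in> {1..r}") (auto simp: mdeg_def row_def)
qed

lemma row_le_mdeg: "i \<in> {1..n} \<Longrightarrow> row m i j \<le> mdeg m j"
  by (auto simp: row_def mdeg_def intro: member_le_sum)

lemma finite_mono_of [simp]: "finite (mono_of J)"
proof -
  have "mono_of J \<subseteq> (\<lambda>f. \<Sum>v\<in>{1..n} \<times> {1..r}. single v (f v)) `
      (({1..n} \<times> {1..r}) \<rightarrow>\<^sub>E {..Max (J ` {1..r})})"
  proof
    fix m assume m: "m \<in> mono_of J"
    let ?f = "restrict (lookup m) ({1..n} \<times> {1..r})"
    have "lookup m v \<le> Max (J ` {1..r})" if "v \<in> {1..n} \<times> {1..r}" for v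
    proof -
      have "lookup m v \<le> J (snd v)"
        using row_le_mdeg[of "fst v" m "snd v"] m that by (auto simp: mono_of_def row_def)
      also have "\<dots> \<le> Max (J ` {1..r})" using that by (auto intro!: Max_ge)
      finally show ?thesis .
    qed
    then have "?f \<in> ({1..n} \<times> {1..r}) \<rightarrow>\<^sub>E {..Max (J ` {1..r})}" by auto
    moreover have "m = (\<Sum>v\<in>{1..n} \<times> {1..r}. single v (?f v))"
    proof (rule poly_mapping_eqI)
      fix k
      show "lookup m k = lookup (\<Sum>v\<in>{1..n} \<times> {1..r}. single v (?f v)) k"
        using m by (auto simp: lookup_sum lookup_single when_def mono_of_def mons_lookup sum.delta)
    qed
    ultimately show "m \<in> (\<lambda>f. \<Sum>v\<in>{1..n} \<times> {1..r}. single v (f v)) `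
      (({1..n} \<times> {1..r}) \<rightarrow>\<^sub>E {..Max (J ` {1..r})})" by blast
  qed
  then show ?thesis by (rule finite_subset) (intro finite_imageI finite_PiE; simp)
qed

lemma diag_polys_iff: "p \<in> diag_polys n r \<longleftrightarrow> keys p \<subseteq> mons"
  by (auto simp: diag_polys_def mons_def)

definition hom :: "(nat \<Rightarrow> nat) \<Rightarrow> ('k::field) diag_poly set" where
  "hom J = {p. keys p \<subseteq> mono_of J}"

lemma multihomogeneous_eq:
  "multihomogeneous n r J = hom (\<lambda>j. if j \<in> {1..r} then J j else 0)"
  unfolding multihomogeneous_def hom_def mono_of_def diag_polys_iff
  by (auto simp: mdeg_def fun_eq_iff subset_iff)

lemma hom_subspace: "mpv.subspace (hom J)"
proof (rule mpv.subspaceI)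
  show "x + y \<in> hom J" if "x \<in> hom J" "y \<in> hom J" for x y :: "('k::field) diag_poly"
    using that Poly_Mapping.keys_add[of x y] by (auto simp: hom_def)
qed (auto simp: hom_def in_keys_iff subset_iff)

lemma hom_eq_span: "hom J = mpv.span (mon ` mono_of J)"
proof
  show "hom J \<subseteq> mpv.span (mon ` mono_of J)"
  proof
    fix p :: "('k::field) diag_poly" assume "p \<in> hom J"
    then have "p = (\<Sum>m\<in>mono_of J. mpol_const (lookup p m) * mon m)"
      by (intro mpol_as_comb) (auto simp: hom_def)
    also have "\<dots> \<in> mpv.span (mon ` mono_of J)"
      by (intro mpv.span_sum mpv.span_scale mpv.span_base) auto
    finally show "p \<in> mpv.span (mon ` mono_of J)" .
  qed
  show "mpv.span (mon ` mono_of J) \<subseteq> hom J"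
    by (rule mpv.span_minimal) (auto simp: hom_subspace, auto simp: hom_def)
qed

lemma hom_as_comb:
  assumes "p \<in> hom J"
  shows "p = (\<Sum>m\<in>mono_of J. mpol_const (lookup p m) * mon m)"
  using assms by (intro mpol_as_comb) (auto simp: hom_def)

lemma mono_of_add: "m \<in> mono_of J \<Longrightarrow> m' \<in> mono_of K \<Longrightarrow> m + m' \<in> mono_of (J + K)"
  by (auto simp: mono_of_def mdeg_add)

lemma hom_mult: "p \<in> hom J \<Longrightarrow> q \<in> hom K \<Longrightarrow> p * q \<in> hom (J + K)"
  using Poly_Mapping.keys_mult[of p q] mono_of_add unfolding hom_def by blast

lemma hom_subset_diag_polys: "hom J \<subseteq> diag_polys n r"
  by (auto simp: hom_def mono_of_def diag_polys_iff)

lemma act_mon_blk: "act_mon w (blk i A) = blk (perm_of w i) A"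
  by (simp add: blk_def act_mon_sum act_mon_single perm_of_def)

lemma act_sgn_blk: "act_sgn w (blk i A) = of_int (sgn (w (int i))) ^ tot A"
  by (simp add: blk_def act_sgn_sum act_sgn_single tot_def power_sum)

lemma act_mon_mons:
  assumes "w \<in> signed_perms n" "m \<in> mons"
  shows "act_mon w m = (\<Sum>i = 1..n. blk (perm_of w i) (row m i))"
  by (subst mons_as_blks[OF assms(2)]) (simp add: act_mon_sum act_mon_blk)

lemma act_sgn_mons:
  assumes "m \<in> mons"
  shows "act_sgn w m = (\<Prod>i = 1..n. of_int (sgn (w (int i))) ^ tot (row m i))"
  by (subst mons_as_blks[OF assms]) (simp add: act_sgn_sum act_sgn_blk)

lemma act_mon_in_mons:
  assumes "w \<in> signed_perms n" "m \<in> mons"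
  shows "act_mon w m \<in> mons"
  unfolding act_mon_mons[OF assms]
  using permutes_in_image[OF perm_of_permutes[OF assms(1)]] by (intro mons_sum blk_in_mons) auto

lemma row_act_mon:
  assumes w: "w \<in> signed_perms n" and m: "m \<in> mons" and i: "i \<in> {1..n}"
  shows "row (act_mon w m) (perm_of w i) = row m i"
proof -
  have "row (act_mon w m) (perm_of w i) = (\<Sum>l = 1..n. if l = i then row m l else 0)"
    unfolding act_mon_mons[OF w m] row_sum
    by (intro sum.cong refl)
       (use permutes_inj[OF perm_of_permutes[OF w]] in \<open>auto simp: row_blk dest: injD\<close>)
  then show ?thesis using i by simp
qed

lemma act_mon_in_mono_of:
  assumes w: "w \<in> signed_perms n" and m: "m \<in> mono_of J"
  shows "act_mon w m \<in> mono_of J"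
proof -
  have m': "m \<in> mons" using m by (simp add: mono_of_def)
  note p = perm_of_permutes[OF w]
  have "mdeg (act_mon w m) = (\<Sum>i = 1..n. row (act_mon w m) (perm_of w i))"
    unfolding mdeg_as_rows by (rule sum.permute[OF p, unfolded o_def])
  also have "\<dots> = (\<Sum>i = 1..n. row m i)" by (intro sum.cong refl row_act_mon w m')
  also have "\<dots> = mdeg m" by (simp add: mdeg_as_rows)
  finally show ?thesis using m act_mon_in_mons[OF w m'] by (simp add: mono_of_def)
qed

lemma diag_act_hom:
  assumes w: "w \<in> signed_perms n" and "p \<in> hom J"
  shows "diag_act w p \<in> hom J"
proof -
  have "diag_act w p = (\<Sum>m\<in>mono_of J. mpol_const (lookup p m) * diag_act w (mon m))"
    by (subst hom_as_comb[OF assms(2)]) (simp add: diag_act_sum diag_act_scale del: mpol_const_mult_single)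
  also have "\<dots> \<in> hom J"
    by (intro mpv.subspace_sum[OF hom_subspace] mpv.subspace_scale[OF hom_subspace])
       (use act_mon_in_mono_of[OF w] in \<open>auto simp: diag_act_single hom_def\<close>)
  finally show ?thesis .
qed

end

section \<open>Invariants and power sums\<close>

text \<open>A sign change at i multiplies \<open>x_i^A\<close> by (-1)^|A|, so |A| has to be even in
  types B and D. In type S there is no condition, and divisibility by 1 says so.\<close>

definition block_parity :: "weyl_type \<Rightarrow> nat" where
  "block_parity W = (if W = TypeS then 1 else 2)"

lemma of_nat_mpol: "(of_nat k :: ('v, 'k::field) mpol) = mpol_const (of_nat k)"
  by (simp add: mpol_const_def single_of_nat)

text \<open>Characteristic zero enters here: the proofs below divide by n - card T and by
  n!.\<close>

lemma subspace_of_nat_cancel: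
  fixes x :: "('v, 'k::field_char_0) mpol"
  assumes "mpv.subspace S" "of_nat k * x \<in> S" "k > 0"
  shows "x \<in> S"
proof -
  have "mpol_const (1 / of_nat k) * (of_nat k * x) \<in> S"
    by (rule mpv.subspace_scale[OF assms(1,2)])
  also have "mpol_const (1 / of_nat k) * (of_nat k * x) = mpol_const (1 / of_nat k * of_nat k) * x"
    unfolding mpol_const_simps(2) of_nat_mpol by (simp add: mult.assoc)
  finally show ?thesis using assms(3) by (simp add: mpol_const_simps)
qed

locale diag_weyl = diag +
  fixes W :: weyl_type
begin

text \<open>The exponents \<open>A\<close> for which the power sum \<open>\<Sum>\<^sub>i x\<^sub>i\<^bsup>A\<^esup>\<close> is invariant.\<close>
definition inv_exps :: "(nat \<Rightarrow> nat) set" where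
  "inv_exps = {A \<in> vecs. A \<noteq> 0 \<and> block_parity W dvd tot A}"

definition psum :: "(nat \<Rightarrow> nat) \<Rightarrow> ('k::field) diag_poly" where
  "psum A = (\<Sum>i = 1..n. mon (blk i A))"

text \<open>The ideal generated by the power sums, written as a linear span so that inclusions can
  be checked on generators. \<open>psum_hom J\<close> is its part of multidegree J.\<close>

definition psum_span :: "('k::field) diag_poly set" where
  "psum_span = mpv.span {mon m * psum A | m A. m \<in> mons \<and> A \<in> inv_exps}"

definition psum_hom :: "(nat \<Rightarrow> nat) \<Rightarrow> ('k::field) diag_poly set" where
  "psum_hom J = mpv.span {mon m * psum A | m A. m \<in> mons \<and> A \<in> inv_exps \<and> mdeg m + A = J}"

text \<open>The monomials of degree at least \<open>n\<close> absorb the invariants of \<open>D\<^sub>n\<close> that are not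
  invariant under \<open>B\<^sub>n\<close>, such as \<open>x\<^sub>1 \<cdots> x\<^sub>n\<close>.\<close>
definition trunc_span :: "('k::field) diag_poly set" where
  "trunc_span = mpv.span ({mon m * psum A | m A. m \<in> mons \<and> A \<in> inv_exps} \<union>
     mon ` {m \<in> mons. tot (mdeg m) \<ge> n})"

text \<open>An orbit sum in which each monomial is counted as often as its stabilizer has elements;
  summing over permutations avoids describing the stabilizer.\<close>

definition sym_sum :: "nat set \<Rightarrow> (nat \<Rightarrow> nat \<Rightarrow> nat) \<Rightarrow> ('k::field) diag_poly" where
  "sym_sum T A = (\<Sum>\<sigma> | \<sigma> permutes {1..n}. mon (\<Sum>i\<in>T. blk (\<sigma> i) (A i)))"

lemma inv_exps_add: "A \<in> inv_exps \<Longrightarrow> B \<in> inv_exps \<Longrightarrow> A + B \<in> inv_exps"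
  by (auto simp: inv_exps_def tot_add fun_eq_iff)

lemma blks_in_mons:
  assumes "\<sigma> permutes {1..n}" "T \<subseteq> {1..n}"
  shows "(\<Sum>i\<in>T. blk (\<sigma> i) (A i)) \<in> mons"
  using permutes_in_image[OF assms(1)] assms(2) by (intro mons_sum blk_in_mons) auto

text \<open>For each \<sigma>, the terms of the power sum are indexed by \<sigma> l. If l lies in T,
  the new factor merges with the row of l. If not, it becomes a new row, and all n - card T such l
  contribute the same sum.\<close>

lemma psum_times_sym_sum:
  fixes A :: "nat \<Rightarrow> nat \<Rightarrow> nat"
  assumes "finite T" "T \<subseteq> {1..n}" "i \<in> {1..n}" "i \<notin> T"
  shows "(psum (A i) * sym_sum T A :: ('k::field) diag_poly) =
    (\<Sum>l\<in>T. sym_sum T (A(l := A l + A i))) + of_nat (n - card T) * sym_sum (insert i T) A"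
proof -
  let ?P = "{\<sigma>. \<sigma> permutes {1..n}}"
  let ?m = "\<lambda>\<sigma>. \<Sum>t\<in>T. blk (\<sigma> t) (A t)"
  let ?q = "\<lambda>l. \<Sum>\<sigma>\<in>?P. mon (?m \<sigma> + blk (\<sigma> l) (A i)) :: 'k diag_poly"
  have "psum (A i) * sym_sum T A = (\<Sum>\<sigma>\<in>?P. psum (A i) * mon (?m \<sigma>) :: 'k diag_poly)"
    by (simp add: sym_sum_def sum_distrib_left)
  also have "\<dots> = (\<Sum>\<sigma>\<in>?P. \<Sum>l = 1..n. mon (?m \<sigma> + blk (\<sigma> l) (A i)))"
  proof (rule sum.cong[OF refl])
    fix \<sigma> assume "\<sigma> \<in> ?P"
    then have "psum (A i) = (\<Sum>l = 1..n. mon (blk (\<sigma> l) (A i)) :: 'k diag_poly)"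
      unfolding psum_def by (subst sum.permute[of \<sigma>]) (simp_all add: o_def)
    then show "psum (A i) * mon (?m \<sigma>) = (\<Sum>l = 1..n. mon (?m \<sigma> + blk (\<sigma> l) (A i)) :: 'k diag_poly)"
      by (simp add: sum_distrib_right mult_single add.commute)
  qed
  also have "\<dots> = (\<Sum>l = 1..n. ?q l)" by (rule sum.swap)
  also have "\<dots> = (\<Sum>l\<in>T. ?q l) + (\<Sum>l\<in>{1..n} - T. ?q l)"
    using sum.subset_diff[OF assms(2), of ?q] by (simp add: add.commute)
  also have "(\<Sum>l\<in>T. ?q l) = (\<Sum>l\<in>T. sym_sum T (A(l := A l + A i)))"
  proof (rule sum.cong[OF refl])
    fix l assume l: "l \<in> T"
    have "?m \<sigma> + blk (\<sigma> l) (A i) = (\<Sum>t\<in>T. blk (\<sigma> t) ((A(l := A l + A i)) t))" for \<sigma>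
      using l assms(1) by (simp add: sum.remove[of T l] blk_add algebra_simps)
    then show "?q l = sym_sum T (A(l := A l + A i))" by (simp add: sym_sum_def)
  qed
  \<comment> \<open>Composing \<sigma> with the transposition of i and l leaves the rows of T alone
    and moves the new row from l to i.\<close>
  also have "(\<Sum>l\<in>{1..n} - T. ?q l) = (\<Sum>l\<in>{1..n} - T. sym_sum (insert i T) A)"
  proof (rule sum.cong[OF refl])
    fix l assume l: "l \<in> {1..n} - T"
    have \<tau>: "Transposition.transpose i l permutes {1..n}"
      using l assms by (intro permutes_swap_id) auto
    have "sym_sum (insert i T) A = (\<Sum>\<sigma>\<in>?P. mon (?m \<sigma> + blk (\<sigma> i) (A i)) :: 'k diag_poly)"
      using assms by (simp add: sym_sum_def add.commute)
    also have "\<dots> = (\<Sum>\<sigma>\<in>?P. mon (?m (\<sigma> \<circ> Transposition.transpose i l) + blk ((\<sigma> \<circ> Transposition.transpose i l) i) (A i)))"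
      by (rule sum_permutations_compose_right[OF \<tau>])
    also have "\<dots> = ?q l"
    proof (rule sum.cong[OF refl])
      fix \<sigma>
      have "?m (\<sigma> \<circ> Transposition.transpose i l) = ?m \<sigma>"
        using l assms by (intro sum.cong refl) (auto simp: Transposition.transpose_def)
      then show "mon (?m (\<sigma> \<circ> Transposition.transpose i l) + blk ((\<sigma> \<circ> Transposition.transpose i l) i) (A i))
          = (mon (?m \<sigma> + blk (\<sigma> l) (A i)) :: 'k diag_poly)" by simp
    qed
    finally show "?q l = sym_sum (insert i T) A" by simp
  qed
  also have "\<dots> = of_nat (n - card T) * sym_sum (insert i T) A"
    using assms by (simp add: card_Diff_subset)
  finally show ?thesis .
qed

text \<open>Multiplying the orbit sum of a monomial by a power sum produces the orbit sum with one more row,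
  up to orbit sums in which two rows are merged.\<close>
lemma sym_sum_in_psum_span:
  assumes "T \<subseteq> {1..n}" "T \<noteq> {}" "\<And>i. i \<in> T \<Longrightarrow> A i \<in> inv_exps"
  shows "(sym_sum T A :: ('k::field_char_0) diag_poly) \<in> psum_span"
  using assms
proof (induction "card T" arbitrary: T A)
  case 0
  then show ?case using finite_subset[OF 0(2)] by auto
next
  case (Suc c)
  let ?S = "psum_span :: 'k diag_poly set"
  have sub: "mpv.subspace ?S" by (simp add: psum_span_def)
  from Suc(4) obtain i where i: "i \<in> T" by blast
  define T' where "T' = T - {i}"
  have fin: "finite T'" using Suc(3) finite_subset unfolding T'_def by blast
  have T: "T = insert i T'" "i \<notin> T'" "T' \<subseteq> {1..n}" "i \<in> {1..n}" "card T' = c" "finite T"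
    using i Suc(2,3) fin by (auto simp: T'_def intro: finite_subset)
  have "(psum (A i) * sym_sum T' A :: 'k diag_poly) \<in> ?S"
  proof -
    have "psum (A i) * sym_sum T' A =
        (\<Sum>\<sigma> | \<sigma> permutes {1..n}. mon (\<Sum>i\<in>T'. blk (\<sigma> i) (A i)) * psum (A i) :: 'k diag_poly)"
      by (simp add: sym_sum_def sum_distrib_left mult.commute)
    also have "\<dots> \<in> ?S" unfolding psum_span_def
      using blks_in_mons T(3) Suc.prems(3)[OF i] by (intro mpv.span_sum mpv.span_base) blast
    finally show ?thesis .
  qed
  moreover have "(\<Sum>l\<in>T'. sym_sum T' (A(l := A l + A i))) \<in> ?S"
  proof (rule mpv.subspace_sum[OF sub])
    fix l assume l: "l \<in> T'"
    show "sym_sum T' (A(l := A l + A i)) \<in> ?S"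
      using l T Suc.prems by (intro Suc.hyps(1)) (auto intro: inv_exps_add)
  qed
  ultimately have "psum (A i) * sym_sum T' A - (\<Sum>l\<in>T'. sym_sum T' (A(l := A l + A i))) \<in> ?S"
    by (intro mpv.subspace_diff[OF sub])
  then have "of_nat (n - card T') * sym_sum T A \<in> ?S"
    using psum_times_sym_sum[OF fin T(3,4,2), of A, where 'k = 'k] T(1) by simp
  \<comment> \<open>As i is outside T', the factor n - card T' is not zero and can be divided
    out.\<close>
  moreover have "card T' < n"
  proof -
    have "T' \<subset> {1..n}" using T by blast
    then show ?thesis using psubset_card_mono[of "{1..n}" T'] by simp
  qed
  ultimately show ?case
    using subspace_of_nat_cancel[OF sub, of "n - card T'" "sym_sum T A"] by simp
qed

lemma psum_span_le_trunc_span: "psum_span \<subseteq> trunc_span"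
  unfolding psum_span_def trunc_span_def by (rule mpv.span_mono) blast

lemma tot_mdeg: "tot (mdeg m) = (\<Sum>i = 1..n. tot (row m i))"
proof -
  have "sum f S j = (\<Sum>i\<in>S. f i j)" for f :: "nat \<Rightarrow> nat \<Rightarrow> nat" and S j
    by (induction S rule: infinite_finite_induct) auto
  then have "tot (mdeg m) = (\<Sum>j = 1..r. \<Sum>i = 1..n. row m i j)" by (simp add: mdeg_as_rows tot_def)
  then show ?thesis unfolding tot_def by (subst sum.swap) simp
qed

lemma lookup_diag_act_flip:
  assumes "p \<in> diag_polys n r" "S \<subseteq> {1..n}" "m \<in> mons"
  shows "lookup (diag_act (flip S) p) m = (lookup p m * act_sgn (flip S) m :: 'k::field)"
proof -
  have mon: "act_mon (flip S) m' = m'" if "m' \<in> mons" for m'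
    using act_mon_mons[OF flip_signed[OF assms(2)] that] mons_as_blks[OF that] by simp
  let ?K = "keys p"
  have K: "?K \<subseteq> mons" using assms(1) by (simp add: diag_polys_iff)
  have "diag_act (flip S) p = (\<Sum>m'\<in>?K. diag_act (flip S) (single m' (lookup p m')))"
    by (subst mpol_as_sum[of ?K p]) (simp_all add: diag_act_sum)
  also have "\<dots> = (\<Sum>m'\<in>?K. single m' (lookup p m' * act_sgn (flip S) m'))"
    using K by (intro sum.cong refl) (auto simp: diag_act_single mon)
  finally show ?thesis
    by (auto simp: lookup_sum lookup_single when_def sum.delta in_keys_iff)
qed

text \<open>\<open>D_n\<close> contains the simultaneous sign change at two indices. If one of the
  two rows is odd and the other even, it negates the coefficient of m, which must then vanish. So
  the rows are all even or all odd, and in the second case every index occurs, which forces degree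
  at least n.\<close>

lemma invariant_block_parity:
  fixes p :: "('k::field_char_0) diag_poly"
  assumes p: "p \<in> invariants_no_const W n r" and m: "m \<in> keys p"
  shows "(\<forall>i\<in>{1..n}. block_parity W dvd tot (row m i)) \<or> n \<le> tot (mdeg m)"
proof (cases "W = TypeS")
  case True then show ?thesis by (simp add: block_parity_def)
next
  case False
  then have sub: "weyl_group TypeD n \<subseteq> weyl_group W n" by (cases W) auto
  have pd: "p \<in> diag_polys n r" using p by (simp add: invariants_no_const_def)
  have mm: "m \<in> mons" using pd m by (auto simp: diag_polys_iff)
  have e: "block_parity W = 2" using False by (simp add: block_parity_def)
  show ?thesis
  proof (cases "\<forall>i\<in>{1..n}. odd (tot (row m i))")
    case True
    then have "1 \<le> tot (row m i)" if "i \<in> {1..n}" for i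
      using that by (metis odd_pos One_nat_def Suc_leI)
    then have "(\<Sum>i = 1..n. 1) \<le> tot (mdeg m)" unfolding tot_mdeg by (intro sum_mono) auto
    then show ?thesis by simp
  next
    case l: False
    then obtain l where l: "l \<in> {1..n}" "even (tot (row m l))" by blast
    have "even (tot (row m i))" if i: "i \<in> {1..n}" for i
    proof (rule ccontr)
      assume odd: "odd (tot (row m i))"
      then have il: "i \<noteq> l" using l by auto
      let ?S = "{i, l}"
      have S: "?S \<subseteq> {1..n}" using i l by auto
      have "diag_act (flip ?S) p = p"
        using flip_TypeD[OF S] il sub p by (auto simp: invariants_no_const_def)
      then have *: "lookup p m = lookup p m * act_sgn (flip ?S) m"
        using lookup_diag_act_flip[OF pd S mm] by simp
      have sg: "(of_int (sgn (flip ?S (int a))) :: 'k) = (if a \<in> ?S then -1 else 1)" if "a \<in> {1..n}" for a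
        using that by (auto simp: flip_def)
      have "(act_sgn (flip ?S) m :: 'k) = (\<Prod>a = 1..n. (if a = i then -1 else 1))"
        unfolding act_sgn_mons[OF mm] using odd l by (intro prod.cong refl) (auto simp: sg)
      also have "\<dots> = -1" using i by simp
      finally have "lookup p m = 0" using * by simp
      then show False using m by (simp add: in_keys_iff)
    qed
    then show ?thesis using e by simp
  qed
qed

text \<open>Averaging over \<open>S_n\<close>, n! p is a combination of symmetrized monomials of p.
  Each of them is an orbit sum with rows in \<open>inv_exps\<close>, or consists of monomials of
  degree at least n.\<close>

lemma invariant_in_trunc_span:
  fixes p :: "('k::field_char_0) diag_poly"
  assumes p: "p \<in> invariants_no_const W n r"
  shows "p \<in> trunc_span"
proof -
  let ?P = "{\<sigma>. \<sigma> permutes {1..n}}" and ?K = "keys p"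
  have pd: "p \<in> diag_polys n r" using p by (simp add: invariants_no_const_def)
  have sub: "mpv.subspace (trunc_span :: 'k diag_poly set)" by (simp add: trunc_span_def)
  have "of_nat (fact n) * p = (\<Sum>\<sigma>\<in>?P. p)" by (simp add: card_permutations)
  also have "\<dots> = (\<Sum>\<sigma>\<in>?P. diag_act (sperm \<sigma>) p)"
    by (intro sum.cong refl) (use p sperm_weyl_group in \<open>auto simp: invariants_no_const_def\<close>)
  also have "\<dots> = (\<Sum>\<sigma>\<in>?P. \<Sum>m\<in>?K. mpol_const (lookup p m) * diag_act (sperm \<sigma>) (mon m))"
    by (intro sum.cong refl, subst mpol_as_comb[of ?K p])
       (simp_all add: diag_act_sum diag_act_scale del: mpol_const_mult_single)
  also have "\<dots> = (\<Sum>m\<in>?K. mpol_const (lookup p m) * (\<Sum>\<sigma>\<in>?P. diag_act (sperm \<sigma>) (mon m)))"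
    by (subst sum.swap) (simp only: sum_distrib_left)
  also have "\<dots> \<in> trunc_span"
  proof (rule mpv.subspace_sum[OF sub], rule mpv.subspace_scale[OF sub])
    fix m assume m: "m \<in> ?K"
    then have mm: "m \<in> mons" using pd by (auto simp: diag_polys_iff)
    have act: "diag_act (sperm \<sigma>) (mon m) = (mon (\<Sum>i = 1..n. blk (\<sigma> i) (row m i)) :: 'k diag_poly)"
      if \<sigma>: "\<sigma> \<in> ?P" for \<sigma>
    proof -
      have sg: "sperm \<sigma> \<in> signed_perms n" using \<sigma> sperm_weyl_group weyl_group_signed by blast
      have "(act_sgn (sperm \<sigma>) m :: 'k) = 1"
        unfolding act_sgn_mons[OF mm] using sperm_pos(2) \<sigma> by (intro prod.neutral) auto
      then show ?thesis using perm_of_sperm \<sigma>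
        by (simp add: diag_act_single act_mon_mons[OF sg mm])
    qed
    show "(\<Sum>\<sigma>\<in>?P. diag_act (sperm \<sigma>) (mon m) :: 'k diag_poly) \<in> trunc_span"
    proof (cases "n \<le> tot (mdeg m)")
      case True
      show ?thesis
      proof (rule mpv.subspace_sum[OF sub])
        fix \<sigma> assume \<sigma>: "\<sigma> \<in> ?P"
        then have sg: "sperm \<sigma> \<in> signed_perms n" using sperm_weyl_group weyl_group_signed by blast
        have "act_mon (sperm \<sigma>) m \<in> mono_of (mdeg m)"
          using mm by (intro act_mon_in_mono_of[OF sg]) (simp add: mono_of_def)
        then have *: "(\<Sum>i = 1..n. blk (\<sigma> i) (row m i)) \<in> mono_of (mdeg m)"
          using act_mon_mons[OF sg mm] perm_of_sperm \<sigma> by simp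
        show "diag_act (sperm \<sigma>) (mon m) \<in> (trunc_span :: 'k diag_poly set)"
          unfolding act[OF \<sigma>] trunc_span_def
          by (rule mpv.span_base) (use * True in \<open>auto simp: mono_of_def\<close>)
      qed
    next
      case False
      \<comment> \<open>Empty rows are dropped, as \<open>inv_exps\<close> excludes 0. Some row
        remains because p has no constant term.\<close>
      let ?T = "{i \<in> {1..n}. row m i \<noteq> 0}"
      have "(\<Sum>\<sigma>\<in>?P. diag_act (sperm \<sigma>) (mon m) :: 'k diag_poly) = sym_sum ?T (row m)"
        unfolding sym_sum_def
      proof (rule sum.cong[OF refl])
        fix \<sigma> assume \<sigma>: "\<sigma> \<in> ?P"
        have "(\<Sum>i = 1..n. blk (\<sigma> i) (row m i)) = (\<Sum>i\<in>?T. blk (\<sigma> i) (row m i))"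
          by (rule sum.mono_neutral_right) auto
        then show "diag_act (sperm \<sigma>) (mon m) = (mon (\<Sum>i\<in>?T. blk (\<sigma> i) (row m i)) :: 'k diag_poly)"
          using act[OF \<sigma>] by simp
      qed
      also have "\<dots> \<in> psum_span"
      proof (rule sym_sum_in_psum_span)
        show "?T \<noteq> {}"
        proof
          assume "?T = {}"
          then have "row m i = row 0 i" if "i \<in> {1..n}" for i using that by auto
          then have "m = 0" using mm by (intro mons_eqI) auto
          then show False using m p by (simp add: invariants_no_const_def in_keys_iff)
        qed
        show "row m i \<in> inv_exps" if "i \<in> ?T" for i
          using that invariant_block_parity[OF p m] False by (auto simp: inv_exps_def)
      qed auto
      finally show ?thesis using psum_span_le_trunc_span by blast
    qed
  qed
  finally show ?thesis by (rule subspace_of_nat_cancel[OF sub]) simp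
qed

end

section \<open>The polynomial ring as a ring with carrier, and its ideals\<close>

context diag
begin

lemma diag_polys_zero [simp]: "0 \<in> diag_polys n r"
  by (simp add: diag_polys_iff)

lemma mon_in_diag_polys [simp]: "m \<in> mons \<Longrightarrow> single m c \<in> diag_polys n r"
  by (simp add: diag_polys_iff)

lemma diag_polys_add: "p \<in> diag_polys n r \<Longrightarrow> q \<in> diag_polys n r \<Longrightarrow> p + q \<in> diag_polys n r"
  using Poly_Mapping.keys_add[of p q] by (auto simp: diag_polys_iff)

lemma diag_polys_mult:
  "p \<in> diag_polys n r \<Longrightarrow> q \<in> diag_polys n r \<Longrightarrow> p * q \<in> diag_polys n r"
  using Poly_Mapping.keys_mult[of p q] by (fastforce simp: diag_polys_iff)

lemma diag_polys_uminus: "p \<in> diag_polys n r \<Longrightarrow> - (p :: ('k::comm_ring_1) diag_poly) \<in> diag_polys n r"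
  by (auto simp: diag_polys_iff in_keys_iff)

lemma diag_polys_const [simp]: "mpol_const c \<in> diag_polys n r"
  by (simp add: mpol_const_def)

lemma diag_polys_subspace: "mpv.subspace (diag_polys n r)"
  by (rule mpv.subspaceI) (auto intro: diag_polys_add diag_polys_mult)

lemma diag_polys_as_comb:
  assumes "p \<in> diag_polys n r"
  obtains "finite (keys p)" "keys p \<subseteq> mons"
    "p = (\<Sum>m\<in>keys p. mpol_const (lookup p m) * mon m :: ('k::field) diag_poly)"
  using assms mpol_as_comb[of "keys p" p] by (simp add: diag_polys_iff)

lemma diag_ring_simps [simp]:
  "carrier (diag_ring n r) = diag_polys n r"
  "\<zero>\<^bsub>diag_ring n r\<^esub> = 0" "\<one>\<^bsub>diag_ring n r\<^esub> = 1"
  "x \<oplus>\<^bsub>diag_ring n r\<^esub> y = x + y" "x \<otimes>\<^bsub>diag_ring n r\<^esub> y = x * y"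
  by (simp_all add: diag_ring_def)

lemma diag_ring_cring: "cring (diag_ring n r :: ('k::field) diag_poly ring)"
proof (rule cringI)
  show "abelian_group (diag_ring n r :: 'k diag_poly ring)"
  proof (rule abelian_groupI)
    fix x :: "'k diag_poly" assume "x \<in> carrier (diag_ring n r)"
    then show "\<exists>y\<in>carrier (diag_ring n r). y \<oplus>\<^bsub>diag_ring n r\<^esub> x = \<zero>\<^bsub>diag_ring n r\<^esub>"
      by (intro bexI[of _ "- x"]) (auto simp: diag_polys_uminus)
  qed (auto simp: diag_polys_add algebra_simps)
  have "mpol_const 1 \<in> (diag_polys n r :: 'k diag_poly set)" by (rule diag_polys_const)
  then have "1 \<in> (diag_polys n r :: 'k diag_poly set)" by (simp add: mpol_const_simps)
  then show "Group.comm_monoid (diag_ring n r :: 'k diag_poly ring)"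
    by (intro comm_monoidI) (auto simp: diag_polys_mult algebra_simps)
qed (auto simp: algebra_simps)

lemma diag_ring_a_inv: "x \<in> diag_polys n r \<Longrightarrow> \<ominus>\<^bsub>diag_ring n r\<^esub> x = (- x :: ('k::field) diag_poly)"
proof -
  assume x: "x \<in> diag_polys n r"
  interpret cring "diag_ring n r :: 'k diag_poly ring" by (rule diag_ring_cring)
  show ?thesis using x by (intro minus_equality) (auto simp: diag_polys_uminus)
qed

text \<open>The ring contains the constants, so its ideals are subspaces and can be compared with
  linear spans.\<close>

lemma ideal_iff:
  "ideal S (diag_ring n r) \<longleftrightarrow> S \<subseteq> diag_polys n r \<and> mpv.subspace S \<and>
     (\<forall>q\<in>diag_polys n r. \<forall>p\<in>S. q * p \<in> (S :: ('k::field) diag_poly set))"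
proof
  assume S: "ideal S (diag_ring n r)"
  then interpret ideal S "diag_ring n r" .
  have sub: "S \<subseteq> diag_polys n r" using Icarr by auto
  have m: "q * p \<in> S" if "q \<in> diag_polys n r" "p \<in> S" for q p using I_l_closed that by simp
  have "mpv.subspace S"
    by (rule mpv.subspaceI)
       (use additive_subgroup.zero_closed[OF additive_subgroup_axioms]
          additive_subgroup.a_closed[OF additive_subgroup_axioms] m in auto)
  then show "S \<subseteq> diag_polys n r \<and> mpv.subspace S \<and> (\<forall>q\<in>diag_polys n r. \<forall>p\<in>S. q * p \<in> S)"
    using sub m by blast
next
  assume S: "S \<subseteq> diag_polys n r \<and> mpv.subspace S \<and> (\<forall>q\<in>diag_polys n r. \<forall>p\<in>S. q * p \<in> S)"
  interpret R: cring "diag_ring n r :: 'k diag_poly ring" by (rule diag_ring_cring)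
  show "ideal S (diag_ring n r)"
  proof (rule idealI)
    show "subgroup S (add_monoid (diag_ring n r))"
    proof (rule R.add.subgroupI)
      show "S \<noteq> {}" using S mpv.subspace_0 by blast
      show "\<ominus>\<^bsub>diag_ring n r\<^esub> a \<in> S" if "a \<in> S" for a
        using that S mpv.subspace_neg[of S a] diag_ring_a_inv[of a] by auto
    qed (use S mpv.subspace_add in auto)
    show "x \<otimes>\<^bsub>diag_ring n r\<^esub> a \<in> S" if "a \<in> S" "x \<in> carrier (diag_ring n r)" for a x
      using S that by simp
    then show "a \<otimes>\<^bsub>diag_ring n r\<^esub> x \<in> S" if "a \<in> S" "x \<in> carrier (diag_ring n r)" for a x
      using that by (metis diag_ring_simps(5) mult.commute)
  qed (rule R.ring_axioms)
qed

end

section \<open>The invariant ideal in degrees below n\<close>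

context diag_weyl
begin

lemma psum_in_hom: "A \<in> vecs \<Longrightarrow> psum A \<in> hom A"
  unfolding psum_def
  by (rule mpv.subspace_sum[OF hom_subspace]) (auto simp: hom_def mono_of_def mdeg_blk)

lemma mon_times_psum_hom:
  "m \<in> mons \<Longrightarrow> A \<in> vecs \<Longrightarrow> mon m * psum A \<in> hom (mdeg m + A)"
  by (intro hom_mult psum_in_hom) (auto simp: hom_def mono_of_def)

lemma inv_exps_vecs: "A \<in> inv_exps \<Longrightarrow> A \<in> vecs"
  by (simp add: inv_exps_def)

text \<open>The generators are closed under multiplication by monomials; linearity in each factor
  does the rest.\<close>

lemma trunc_span_ideal: "ideal trunc_span (diag_ring n r :: ('k::field) diag_poly ring)"
  unfolding ideal_iff
proof (intro conjI ballI)
  let ?G = "{mon m * psum A | m A. m \<in> mons \<and> A \<in> inv_exps} \<union> mon ` {m \<in> mons. tot (mdeg m) \<ge> n}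
    :: 'k diag_poly set"
  have L: "trunc_span = mpv.span ?G" by (simp add: trunc_span_def)
  have "?G \<subseteq> diag_polys n r"
    using mon_times_psum_hom hom_subset_diag_polys inv_exps_vecs by fastforce
  then show "trunc_span \<subseteq> (diag_polys n r :: 'k diag_poly set)"
    unfolding L by (intro mpv.span_minimal diag_polys_subspace)
  show sub: "mpv.subspace (trunc_span :: 'k diag_poly set)" by (simp add: trunc_span_def)
  have gen: "mon m * g \<in> trunc_span" if "m \<in> mons" "g \<in> ?G" for m g
  proof -
    have "mon m * g \<in> ?G"
      using that(2)
    proof
      assume "g \<in> {mon m * psum A | m A. m \<in> mons \<and> A \<in> inv_exps}"
      then obtain m' A where "g = mon m' * psum A" "m' \<in> mons" "A \<in> inv_exps" by blast
      then have "mon m * g = mon (m + m') * psum A \<and> m + m' \<in> mons \<and> A \<in> inv_exps"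
        using that(1) by (simp add: mult_single mult.assoc[symmetric])
      then show ?thesis by blast
    next
      assume "g \<in> mon ` {m \<in> mons. tot (mdeg m) \<ge> n}"
      then obtain m' where "g = mon m'" "m' \<in> mons" "tot (mdeg m') \<ge> n" by blast
      then have "mon m * g = mon (m + m') \<and> m + m' \<in> {m \<in> mons. tot (mdeg m) \<ge> n}"
        using that(1) by (simp add: mult_single mdeg_add tot_add)
      then show ?thesis by blast
    qed
    then show ?thesis unfolding L by (rule mpv.span_base)
  qed
  fix q p :: "'k diag_poly" assume q: "q \<in> diag_polys n r" and p: "p \<in> trunc_span"
  have one: "mon m * p \<in> trunc_span" if m: "m \<in> mons" for m
  proof -
    have "mpv.subspace {p. mon m * p \<in> (trunc_span :: 'k diag_poly set)}"
      by (rule mpv.subspaceI)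
         (use sub in \<open>auto simp: distrib_left mult.left_commute[of "mon m"] simp del: mpol_const_mult_single
            intro: mpv.subspace_0 mpv.subspace_add mpv.subspace_scale\<close>)
    moreover have "?G \<subseteq> {p. mon m * p \<in> trunc_span}" using gen[OF m] by blast
    ultimately have "trunc_span \<subseteq> {p. mon m * p \<in> (trunc_span :: 'k diag_poly set)}"
      unfolding L by (intro mpv.span_minimal)
    then show ?thesis using p by blast
  qed
  show "q * p \<in> trunc_span"
  proof (rule diag_polys_as_comb[OF q])
    assume k: "keys q \<subseteq> mons"
      and qq: "q = (\<Sum>m\<in>keys q. mpol_const (lookup q m) * mon m)"
    have "q * p = (\<Sum>m\<in>keys q. mpol_const (lookup q m) * (mon m * p))"
      by (subst qq) (simp only: sum_distrib_right mult.assoc)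
    also have "\<dots> \<in> trunc_span"
      by (rule mpv.subspace_sum[OF sub], rule mpv.subspace_scale[OF sub], rule one) (use k in blast)
    finally show ?thesis .
  qed
qed

abbreviation coinv :: "('k::field) diag_poly set" where
  "coinv \<equiv> coinv_ideal W n r"

lemma coinv_is_ideal: "ideal coinv (diag_ring n r :: ('k::field) diag_poly ring)"
proof -
  interpret cring "diag_ring n r :: 'k diag_poly ring" by (rule diag_ring_cring)
  show ?thesis unfolding coinv_ideal_def
    by (rule genideal_ideal) (auto simp: invariants_no_const_def)
qed

lemma coinv_subspace: "mpv.subspace coinv"
  and coinv_mult: "q \<in> diag_polys n r \<Longrightarrow> p \<in> coinv \<Longrightarrow> q * p \<in> coinv"
  and coinv_subset: "coinv \<subseteq> diag_polys n r"
  using coinv_is_ideal unfolding ideal_iff by blast+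

lemma invariant_in_coinv: "p \<in> invariants_no_const W n r \<Longrightarrow> p \<in> coinv"
proof -
  interpret cring "diag_ring n r :: 'a diag_poly ring" by (rule diag_ring_cring)
  assume "p \<in> invariants_no_const W n r"
  then show ?thesis unfolding coinv_ideal_def
    using genideal_self[of "invariants_no_const W n r"] by (auto simp: invariants_no_const_def)
qed

lemma coinv_subset_trunc_span:
  "(coinv :: ('k::field_char_0) diag_poly set) \<subseteq> trunc_span"
proof -
  interpret cring "diag_ring n r :: 'k diag_poly ring" by (rule diag_ring_cring)
  show ?thesis unfolding coinv_ideal_def
    by (rule genideal_minimal[OF trunc_span_ideal]) (use invariant_in_trunc_span in blast)
qed

definition proj :: "(nat \<Rightarrow> nat) \<Rightarrow> ('k::field) diag_poly \<Rightarrow> 'k diag_poly" where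
  "proj J p = (\<Sum>m\<in>mono_of J. mpol_const (lookup p m) * mon m)"

lemma proj_linear:
  "proj J (p + q) = proj J p + proj J q" "proj J (mpol_const c * p) = mpol_const c * proj J p" "proj J 0 = 0"
  by (simp_all only: proj_def lookup_add lookup_mpol_const_mult lookup_zero mpol_const_simps distrib_right
      mult.assoc sum.distrib sum_distrib_left mult_zero_left sum.neutral_const)

lemma proj_hom: "p \<in> hom J \<Longrightarrow> proj J p = p"
  unfolding proj_def by (rule hom_as_comb[symmetric])

lemma proj_hom_other: "p \<in> hom K \<Longrightarrow> K \<noteq> J \<Longrightarrow> proj J p = 0"
proof -
  assume *: "p \<in> hom K" "K \<noteq> J"
  have "lookup p m = 0" if "m \<in> mono_of J" for m
  proof -
    have "m \<notin> mono_of K" using that *(2) by (auto simp: mono_of_def)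
    then show ?thesis using *(1) by (auto simp: hom_def in_keys_iff)
  qed
  then show ?thesis by (auto simp: proj_def mpol_const_simps intro: sum.neutral)
qed

lemma psum_hom_subset_hom: "psum_hom J \<subseteq> hom J"
  unfolding psum_hom_def
  by (rule mpv.span_minimal[OF _ hom_subspace]) (use mon_times_psum_hom inv_exps_vecs in blast)

text \<open>The generators of \<open>trunc_span\<close> are multihomogeneous, so the projection to
  multidegree J keeps or kills each of them. It kills the monomials of degree at least n because |J|
  < n.\<close>

lemma coinv_hom_subset_psum_hom:
  assumes "tot J < n"
  shows "(coinv \<inter> hom J :: ('k::field_char_0) diag_poly set) \<subseteq> psum_hom J"
proof
  fix p :: "'k diag_poly" assume p: "p \<in> coinv \<inter> hom J"
  let ?S = "{p. proj J p \<in> (psum_hom J :: 'k diag_poly set)}"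
  have sub: "mpv.subspace (psum_hom J :: 'k diag_poly set)" by (simp add: psum_hom_def)
  have "mpv.subspace ?S"
    by (rule mpv.subspaceI)
      (use sub in \<open>auto simp: proj_linear intro: mpv.subspace_0 mpv.subspace_add mpv.subspace_scale\<close>)
  moreover have "proj J (mon m * psum A :: 'k diag_poly) \<in> psum_hom J" if "m \<in> mons" "A \<in> inv_exps" for m A
  proof (cases "mdeg m + A = J")
    case True
    then have "proj J (mon m * psum A :: 'k diag_poly) = mon m * psum A"
      using mon_times_psum_hom that inv_exps_vecs by (intro proj_hom) blast
    then show ?thesis using that True unfolding psum_hom_def by (auto intro: mpv.span_base)
  next
    case False
    then have "proj J (mon m * psum A :: 'k diag_poly) = 0"
      using mon_times_psum_hom that inv_exps_vecs by (intro proj_hom_other) blast+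
    then show ?thesis using mpv.subspace_0[OF sub] by simp
  qed
  moreover have "proj J (mon m :: 'k diag_poly) \<in> psum_hom J" if "m \<in> mons" "tot (mdeg m) \<ge> n" for m
  proof -
    have "proj J (mon m :: 'k diag_poly) = 0"
      using assms that by (intro proj_hom_other[of _ "mdeg m"]) (auto simp: hom_def mono_of_def)
    then show ?thesis using mpv.subspace_0[OF sub] by simp
  qed
  ultimately have "trunc_span \<subseteq> ?S"
    unfolding trunc_span_def by (intro mpv.span_minimal) auto
  then have "proj J p \<in> psum_hom J" using p coinv_subset_trunc_span by blast
  then show "p \<in> psum_hom J" using p proj_hom[of p J] by simp
qed

lemma weyl_sgn_power:
  assumes "w \<in> weyl_group W n" "i \<in> {1..n}" "block_parity W dvd a"
  shows "(of_int (sgn (w (int i))) ^ a :: 'k::field) = 1"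
proof (cases "W = TypeS")
  case True then show ?thesis using weyl_group_TypeS_sgn[of w n i] assms by simp
next
  case False
  then have "even a" using assms by (simp add: block_parity_def)
  then show ?thesis using perm_of_neq_0(2)[OF weyl_group_signed[OF assms(1)] assms(2)]
    by (auto simp: uminus_power_if)
qed

lemma diag_act_blk:
  assumes "w \<in> weyl_group W n" "i \<in> {1..n}" "block_parity W dvd tot A"
  shows "diag_act w (mon (blk i A)) = (mon (blk (perm_of w i) A) :: ('k::field) diag_poly)"
  using weyl_sgn_power[OF assms, where 'k = 'k]
  by (simp add: diag_act_single act_mon_blk act_sgn_blk)

lemma diag_act_psum:
  assumes w: "w \<in> weyl_group W n" and "A \<in> inv_exps"
  shows "diag_act w (psum A) = (psum A :: ('k::field) diag_poly)"
proof -
  have "diag_act w (psum A) = (\<Sum>i = 1..n. mon (blk (perm_of w i) A) :: 'k diag_poly)"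
    unfolding psum_def diag_act_sum
    by (intro sum.cong refl diag_act_blk w) (use assms in \<open>auto simp: inv_exps_def\<close>)
  also have "\<dots> = psum A"
    unfolding psum_def using sum.permute[OF perm_of_permutes[OF weyl_group_signed[OF w]]]
    by (metis (no_types, lifting) comp_apply sum.cong)
  finally show ?thesis .
qed

lemma hom_lookup_0: "p \<in> hom J \<Longrightarrow> J \<noteq> 0 \<Longrightarrow> lookup p 0 = 0"
  by (auto simp: hom_def mono_of_def in_keys_iff)

lemma psum_in_coinv: "A \<in> inv_exps \<Longrightarrow> psum A \<in> coinv"
  using psum_in_hom[OF inv_exps_vecs] hom_lookup_0 hom_subset_diag_polys diag_act_psum
  by (intro invariant_in_coinv) (fastforce simp: invariants_no_const_def inv_exps_def)

lemma psum_hom_subset_coinv: "psum_hom J \<subseteq> coinv"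
  unfolding psum_hom_def
  by (rule mpv.span_minimal[OF _ coinv_subspace]) (auto intro: coinv_mult psum_in_coinv)

lemma coinv_hom_eq:
  assumes "tot J < n"
  shows "(coinv \<inter> hom J :: ('k::field_char_0) diag_poly set) = psum_hom J"
  using coinv_hom_subset_psum_hom[OF assms] psum_hom_subset_coinv psum_hom_subset_hom by blast

end

section \<open>Leading monomials of elements of the invariant ideal\<close>

context diag
begin

definition dot :: "(nat \<Rightarrow> nat) \<Rightarrow> (nat \<Rightarrow> nat) \<Rightarrow> real" where
  "dot A B = (\<Sum>j = 1..r. real (A j) * real (B j))"

text \<open>Equality of A / tot A and B / tot B with the denominators cleared.\<close>

definition parallel :: "(nat \<Rightarrow> nat) \<Rightarrow> (nat \<Rightarrow> nat) \<Rightarrow> bool" where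
  "parallel A B \<longleftrightarrow> (\<forall>j. A j * tot B = B j * tot A)"

text \<open>The weight of the exponent B at the slot of A. The second factor is the length of the
  projection of B to the line spanned by A.\<close>

definition slot_weight :: "real \<Rightarrow> (nat \<Rightarrow> nat) \<Rightarrow> (nat \<Rightarrow> nat) \<Rightarrow> real" where
  "slot_weight \<epsilon> A B = (1 - \<epsilon> * real (tot A)) * (dot A B / sqrt (dot A A))"

lemma dot_commute: "dot A B = dot B A"
  by (simp add: dot_def mult.commute)

lemma dot_add: "dot A (B + C) = dot A B + dot A C"
  by (simp add: dot_def sum.distrib algebra_simps)

lemma dot_smult: "dot A (\<lambda>j. c * B j) = real c * dot A B"
  by (simp add: dot_def sum_distrib_left mult_ac)

lemma dot_nonneg: "dot A B \<ge> 0"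
  by (simp add: dot_def sum_nonneg)

lemma dot_self_pos: "A \<in> vecs \<Longrightarrow> A \<noteq> 0 \<Longrightarrow> dot A A > 0"
proof -
  assume A: "A \<in> vecs" "A \<noteq> 0"
  then obtain j where j: "A j \<noteq> 0" by (auto simp: fun_eq_iff)
  then have "j \<in> {1..r}" using A by (auto simp: vecs_def)
  then show ?thesis unfolding dot_def
    using j by (intro sum_pos2[of _ j]) auto
qed

lemma tot_pos: "A \<in> vecs \<Longrightarrow> A \<noteq> 0 \<Longrightarrow> tot A > 0"
  using tot_eq_0_iff by blast

lemma dot_parallel:
  assumes "parallel A B"
  shows "real (tot A) * dot C B = real (tot B) * dot C A"
proof -
  have key: "real (tot A) * (real (C j) * real (B j)) = real (tot B) * (real (C j) * real (A j))" for j
  proof -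
    have "A j * tot B = B j * tot A" using assms by (simp add: parallel_def)
    then have "real (A j) * real (tot B) = real (B j) * real (tot A)"
      by (metis of_nat_mult)
    then show ?thesis by (simp add: mult_ac)
  qed
  then show ?thesis by (simp only: dot_def sum_distrib_left key)
qed

lemma dot_strict_Cauchy_Schwarz:
  assumes A: "A \<in> vecs" "A \<noteq> 0" and B: "B \<in> vecs" "B \<noteq> 0" and "\<not> parallel A B"
  shows "dot B A / sqrt (dot B B) < sqrt (dot A A)"
proof -
  let ?a = "dot A A" and ?b = "dot B B" and ?c = "dot B A"
  have pos: "?a > 0" "?b > 0" using A B dot_self_pos by auto
  \<comment> \<open>z is \<open>dot B B\<close> times the component of A orthogonal to B. Its
    squared length is positive unless A and B are proportional.\<close>
  define z where "z j = ?b * real (A j) - ?c * real (B j)" for j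
  have "(\<Sum>j = 1..r. (z j)^2) =
      (\<Sum>j = 1..r. ?b^2 * (real (A j) * real (A j)) - 2 * ?b * ?c * (real (B j) * real (A j)) + ?c^2 * (real (B j) * real (B j)))"
    by (intro sum.cong refl) (simp add: z_def power2_eq_square algebra_simps)
  also have "\<dots> = ?b^2 * ?a - 2 * ?b * ?c * ?c + ?c^2 * ?b"
    by (simp add: sum.distrib sum_subtractf sum_distrib_left[symmetric] dot_def)
  finally have eq: "(\<Sum>j = 1..r. (z j)^2) = ?b * (?a * ?b - ?c^2)"
    by (simp add: power2_eq_square algebra_simps)
  have "(\<Sum>j = 1..r. (z j)^2) \<noteq> 0"
  proof
    assume "(\<Sum>j = 1..r. (z j)^2) = 0"
    then have "z j = 0" if "j \<in> {1..r}" for j using that by (auto simp: sum_nonneg_eq_0_iff)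
    then have z: "?b * real (A j) = ?c * real (B j)" for j
      using A B by (cases "j \<in> {1..r}") (auto simp: z_def vecs_def)
    then have "(\<Sum>j = 1..r. ?b * real (A j)) = (\<Sum>j = 1..r. ?c * real (B j))" by simp
    then have t: "?b * real (tot A) = ?c * real (tot B)"
      by (simp add: tot_def sum_distrib_left)
    have "A j * tot B = B j * tot A" for j
    proof -
      have "?b * (real (A j) * real (tot B)) = (?b * real (A j)) * real (tot B)" by (simp only: mult.assoc)
      also have "\<dots> = real (B j) * (?c * real (tot B))" by (simp only: z mult.assoc mult.left_commute)
      also have "\<dots> = ?b * (real (B j) * real (tot A))" by (simp only: t[symmetric] mult.left_commute)
      finally have "real (A j * tot B) = real (B j * tot A)" using pos by simp
      then show ?thesis by (simp only: of_nat_eq_iff)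
    qed
    then show False using assms(5) by (simp add: parallel_def)
  qed
  moreover have "(\<Sum>j = 1..r. (z j)^2) \<ge> 0" by (simp add: sum_nonneg)
  ultimately have "?b * (?a * ?b - ?c^2) > 0" using eq by linarith
  then have "?c^2 < ?a * ?b" using pos by (simp add: zero_less_mult_iff)
  then have "?c < sqrt (?a * ?b)" by (rule real_less_rsqrt)
  then show ?thesis using pos by (simp add: real_sqrt_mult divide_simps)
qed

text \<open>Distinct directions are separated by the strict Cauchy-Schwarz inequality; the factor
  \<open>1 - \<epsilon> * tot A\<close> orders the exponents on a common ray.\<close>
lemma slot_weights_exist:
  assumes "finite H" "H \<subseteq> vecs - {0}"
  obtains \<epsilon> where "\<And>A. A \<in> H \<Longrightarrow> slot_weight \<epsilon> A A > 0"
    "\<And>A B. A \<in> H \<Longrightarrow> B \<in> H \<Longrightarrow> \<not> (parallel A B \<and> tot B \<le> tot A) \<Longrightarrow>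
       slot_weight \<epsilon> B A < slot_weight \<epsilon> A A"
proof -
  have nz: "A \<in> vecs" "A \<noteq> 0" if "A \<in> H" for A using assms that by auto
  have lim: "((\<lambda>\<epsilon>. slot_weight \<epsilon> A B) \<longlongrightarrow> dot A B / sqrt (dot A A)) (at_right 0)" for A B
  proof -
    have "((\<lambda>\<epsilon>. (1 - \<epsilon> * real (tot A)) * (dot A B / sqrt (dot A A))) \<longlongrightarrow> (1 - 0 * real (tot A)) * (dot A B / sqrt (dot A A))) (at_right 0)"
      by (intro tendsto_intros)
    then show ?thesis by (simp add: slot_weight_def)
  qed
  have self: "dot A A / sqrt (dot A A) = sqrt (dot A A)" for A
    by (simp add: dot_nonneg real_div_sqrt)
  \<comment> \<open>There are finitely many conditions, and each holds for all sufficiently small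
    positive \<epsilon>.\<close>
  have 1: "\<forall>\<^sub>F \<epsilon> in at_right 0. slot_weight \<epsilon> A A > 0" if "A \<in> H" for A
    by (rule order_tendstoD(1)[OF lim]) (use nz[OF that] dot_self_pos in simp)
  have 2: "\<forall>\<^sub>F \<epsilon> in at_right 0. slot_weight \<epsilon> B A < slot_weight \<epsilon> A A"
    if A: "A \<in> H" and B: "B \<in> H" and np: "\<not> (parallel A B \<and> tot B \<le> tot A)" for A B
  proof (cases "parallel A B")
    case False
    have "((\<lambda>\<epsilon>. slot_weight \<epsilon> A A - slot_weight \<epsilon> B A) \<longlongrightarrow> dot A A / sqrt (dot A A) - dot B A / sqrt (dot B B)) (at_right 0)"
      by (intro tendsto_diff lim)
    moreover have "dot A A / sqrt (dot A A) - dot B A / sqrt (dot B B) > 0"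
      using dot_strict_Cauchy_Schwarz[OF nz[OF A] nz[OF B] False] by (simp add: self)
    ultimately have "\<forall>\<^sub>F \<epsilon> in at_right 0. 0 < slot_weight \<epsilon> A A - slot_weight \<epsilon> B A"
      by (rule order_tendstoD(1))
    then show ?thesis by (rule eventually_mono) simp
  next
    case True
    \<comment> \<open>On a common ray the two projections have the same length, so the order is
      decided by the first factor, for every positive \<epsilon>.\<close>
    let ?a = "real (tot A)" and ?b = "real (tot B)"
    have lt: "tot A < tot B" using np True by simp
    have ab: "?a > 0" "?b > 0" using tot_pos[OF nz[OF A]] tot_pos[OF nz[OF B]] by auto
    have BA: "?a * dot B B = ?b * dot B A" using dot_parallel[OF True, of B] .
    have AB: "?a * dot A B = ?b * dot A A" using dot_parallel[OF True, of A] .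
    have "?a * ?a * dot B B = ?b * ?b * dot A A"
      using BA AB by (simp add: dot_commute[of B A] mult.assoc mult.left_commute[of ?a ?b])
    then have "sqrt (?a * ?a * dot B B) = sqrt (?b * ?b * dot A A)" by simp
    then have sq: "?a * sqrt (dot B B) = ?b * sqrt (dot A A)"
      by (simp add: real_sqrt_mult)
    have sB: "sqrt (dot B B) > 0" and sA: "sqrt (dot A A) > 0"
      using dot_self_pos nz[OF B] nz[OF A] by auto
    have "?b * (dot B A / sqrt (dot B B)) = ?a * dot B B / sqrt (dot B B)" by (simp add: BA)
    also have "\<dots> = ?a * sqrt (dot B B)" using self[of B] by (metis times_divide_eq_right)
    also have "\<dots> = ?b * sqrt (dot A A)" by (rule sq)
    finally have "?b * (dot B A / sqrt (dot B B)) = ?b * sqrt (dot A A)" .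
    then have eq: "dot B A / sqrt (dot B B) = sqrt (dot A A)"
      using ab by (subst (asm) mult_cancel_left) auto
    have "\<forall>\<^sub>F \<epsilon>::real in at_right 0. 0 < \<epsilon>" by (rule eventually_at_right_less)
    then show ?thesis
    proof (rule eventually_mono)
      fix \<epsilon> :: real assume e: "0 < \<epsilon>"
      then have "1 - \<epsilon> * ?b < 1 - \<epsilon> * ?a" using lt by simp
      then show "slot_weight \<epsilon> B A < slot_weight \<epsilon> A A"
        unfolding slot_weight_def eq self using sA by (simp add: mult_strict_right_mono)
    qed
  qed
  have "\<forall>\<^sub>F \<epsilon> in at_right 0. (\<forall>A\<in>H. slot_weight \<epsilon> A A > 0) \<and>
      (\<forall>A\<in>H. \<forall>B\<in>H. \<not> (parallel A B \<and> tot B \<le> tot A) \<longrightarrow> slot_weight \<epsilon> B A < slot_weight \<epsilon> A A)"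
    by (intro eventually_conj eventually_ball_finite assms(1) ballI) (use 1 2 in \<open>auto simp: eventually_const_iff\<close>)
  then obtain \<epsilon> where "(\<forall>A\<in>H. slot_weight \<epsilon> A A > 0) \<and>
      (\<forall>A\<in>H. \<forall>B\<in>H. \<not> (parallel A B \<and> tot B \<le> tot A) \<longrightarrow> slot_weight \<epsilon> B A < slot_weight \<epsilon> A A)"
    using eventually_happens' trivial_limit_at_right_real by blast
  then show ?thesis using that by blast
qed

lemma tot_smult: "tot (\<lambda>j. k * B j) = k * tot B"
  by (simp add: tot_def sum_distrib_left)

lemma slot_weight_add: "slot_weight \<epsilon> A (B + C) = slot_weight \<epsilon> A B + slot_weight \<epsilon> A C"
  by (simp add: slot_weight_def dot_add add_divide_distrib algebra_simps)

lemma slot_weight_smult: "slot_weight \<epsilon> A (\<lambda>j. c * B j) = real c * slot_weight \<epsilon> A B"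
  by (simp add: slot_weight_def dot_smult mult_ac)

end

section \<open>Multisets of fixed size, the monomials of a complete symmetric polynomial\<close>

definition msets :: "'b set \<Rightarrow> nat \<Rightarrow> 'b multiset set" where
  "msets S c = {\<mu>. set_mset \<mu> \<subseteq> S \<and> size \<mu> = c}"

text \<open>The cases are whether j occurs or not; this is the recursion
  \<open>h_c(S + j) = h_c(S) + j h_(c-1)(S + j)\<close> on the level of index sets.\<close>

lemma msets_insert:
  assumes "j \<notin> S"
  shows "msets (insert j S) (Suc c) = msets S (Suc c) \<union> add_mset j ` msets (insert j S) c"
    "msets S (Suc c) \<inter> add_mset j ` msets (insert j S) c = {}"
proof -
  show "msets (insert j S) (Suc c) = msets S (Suc c) \<union> add_mset j ` msets (insert j S) c"
  proof (intro equalityI subsetI)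
    fix \<mu> assume \<mu>: "\<mu> \<in> msets (insert j S) (Suc c)"
    show "\<mu> \<in> msets S (Suc c) \<union> add_mset j ` msets (insert j S) c"
    proof (cases "j \<in># \<mu>")
      case True
      then have "\<mu> = add_mset j (\<mu> - {#j#})" by simp
      moreover have "\<mu> - {#j#} \<in> msets (insert j S) c"
        using \<mu> True by (auto simp: msets_def size_Diff_singleton dest: in_diffD)
      ultimately show ?thesis by blast
    qed (use \<mu> in \<open>auto simp: msets_def\<close>)
  qed (auto simp: msets_def)
  show "msets S (Suc c) \<inter> add_mset j ` msets (insert j S) c = {}"
    using assms by (auto simp: msets_def)
qed

lemma finite_msets: "finite S \<Longrightarrow> finite (msets S c)"
proof (induction S arbitrary: c rule: finite_induct)
  case empty
  have "msets {} c \<subseteq> {{#}}" by (auto simp: msets_def)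
  then show ?case by (rule finite_subset) simp
next
  case (insert j S)
  show ?case
  proof (induction c)
    case 0
    have "msets (insert j S) 0 \<subseteq> {{#}}" by (auto simp: msets_def)
    then show ?case by (rule finite_subset) simp
  qed (simp add: msets_insert insert)
qed

context diag_weyl
begin

text \<open>The exponents on a ray that satisfy the parity condition are the positive multiples of
  the shortest one: subtracting it keeps the direction, the nonnegativity and the parity, and lowers
  the total. Hence A = cA' has exactly c - 1 smaller exponents on its ray, which is the number of
  variables that \<open>h_c\<close> can lose.\<close>

lemma ray_generator:
  assumes A: "A \<in> inv_exps"
  obtains A' c where "A' \<in> inv_exps" "c \<ge> 1" "A = (\<lambda>j. c * A' j)"
    "\<And>B. B \<in> inv_exps \<Longrightarrow> parallel A B \<Longrightarrow> \<exists>k\<ge>1. B = (\<lambda>j. k * A' j)"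
proof -
  define P where "P = {B \<in> inv_exps. parallel A B}"
  have AP: "A \<in> P" using A by (simp add: P_def parallel_def)
  define A' where "A' = arg_min tot (\<lambda>B. B \<in> P)"
  have A': "A' \<in> P" and le: "\<And>B. B \<in> P \<Longrightarrow> tot A' \<le> tot B"
    unfolding A'_def using arg_min_natI[of "\<lambda>B. B \<in> P", OF AP] arg_min_nat_le[of "\<lambda>B. B \<in> P"] by auto
  have totA: "tot A > 0" using A by (auto simp: inv_exps_def intro: tot_pos)
  have totA': "tot A' > 0" using A' by (auto simp: P_def inv_exps_def intro: tot_pos)
  have mult: "\<exists>k\<ge>1. B = (\<lambda>j. k * A' j)" if "B \<in> P" for B
    using that
  proof (induction "tot B" arbitrary: B rule: less_induct)
    case less
    have par: "B j * tot A' = A' j * tot B" for j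
    proof -
      have 1: "A j * tot B = B j * tot A" and 2: "A j * tot A' = A' j * tot A"
        using less.prems A' by (auto simp: P_def parallel_def)
      have "tot A * (B j * tot A') = A j * tot B * tot A'" by (simp add: 1 mult_ac)
      also have "\<dots> = tot A * (A' j * tot B)" by (simp add: 2 mult.commute mult.left_commute)
      finally show ?thesis using totA by simp
    qed
    have ge: "A' j \<le> B j" for j
    proof -
      have "A' j * tot A' \<le> B j * tot A'" unfolding par using le[OF less.prems] by simp
      then show ?thesis using totA' by simp
    qed
    define C where "C = (\<lambda>j. B j - A' j)"
    have B: "B = C + A'" using ge by (auto simp: C_def fun_eq_iff)
    show ?case
    proof (cases "C = 0")
      case True
      then show ?thesis using B by (intro exI[of _ 1]) auto
    next
      case False
      have Cv: "C \<in> vecs" using less.prems by (auto simp: P_def inv_exps_def vecs_def C_def)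
      have tB: "tot B = tot C + tot A'" by (simp add: B tot_add)
      have "block_parity W dvd tot C"
        using less.prems A' tB by (auto simp: P_def inv_exps_def dvd_add_left_iff)
      moreover have "parallel A C"
        unfolding parallel_def
      proof
        fix j
        have 1: "A j * (tot C + tot A') = B j * tot A" and "A j * tot A' = A' j * tot A"
          using less.prems A' by (auto simp: P_def parallel_def tB)
        moreover have "A j * tot C + A j * tot A' = B j * tot A" using 1 by (simp only: distrib_left)
        ultimately have "A j * tot C + A' j * tot A = B j * tot A" by simp
        then show "A j * tot C = C j * tot A"
          by (simp add: C_def[THEN fun_cong] diff_mult_distrib)
      qed
      ultimately have "C \<in> P" using Cv False by (simp add: P_def inv_exps_def)
      moreover have "tot C < tot B" using tB totA' by simp
      ultimately obtain k where "C = (\<lambda>j. k * A' j)" using less.hyps by blast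
      then have "B = (\<lambda>j. Suc k * A' j)" unfolding B by (auto simp: fun_eq_iff)
      then show ?thesis by (intro exI[of _ "Suc k"]) simp
    qed
  qed
  obtain c where "c \<ge> 1" "A = (\<lambda>j. c * A' j)" using mult[OF AP] by blast
  then show ?thesis using that[of A' c] A' mult by (auto simp: P_def)
qed

section \<open>Complete symmetric polynomials in the \<open>x_i^A\<close> for a fixed exponent
  A\<close>

definition ray_mon :: "(nat \<Rightarrow> nat) \<Rightarrow> nat multiset \<Rightarrow> (nat \<times> nat \<Rightarrow>\<^sub>0 nat)" where
  "ray_mon A \<mu> = (\<Sum>i\<in>#\<mu>. blk i A)"

text \<open>The polynomial \<open>h_c\<close> in the quantities \<open>x_i^A\<close> with i in
  S.\<close>

definition complete_sym :: "(nat \<Rightarrow> nat) \<Rightarrow> nat set \<Rightarrow> nat \<Rightarrow> ('k::field) diag_poly" where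
  "complete_sym A S c = (\<Sum>\<mu>\<in>msets S c. mon (ray_mon A \<mu>))"

lemma complete_sym_insert:
  assumes "finite S" "j \<notin> S"
  shows "complete_sym A (insert j S) (Suc c) =
    complete_sym A S (Suc c) + mon (blk j A) * (complete_sym A (insert j S) c :: ('k::field) diag_poly)"
proof -
  have "(\<Sum>\<mu>\<in>add_mset j ` msets (insert j S) c. mon (ray_mon A \<mu>)) =
      (\<Sum>\<mu>\<in>msets (insert j S) c. mon (blk j A) * (mon (ray_mon A \<mu>) :: 'k diag_poly))"
    by (subst sum.reindex) (auto simp: inj_on_def ray_mon_def mult_single)
  then show ?thesis
    unfolding complete_sym_def msets_insert(1)[OF assms(2)]
    using assms by (subst sum.union_disjoint) (auto simp: msets_insert finite_msets sum_distrib_left)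
qed

lemma ray_mon_in_mons: "set_mset \<mu> \<subseteq> {1..n} \<Longrightarrow> ray_mon A \<mu> \<in> mons"
  unfolding ray_mon_def by (induction \<mu>) auto

lemma mdeg_ray_mon:
  "set_mset \<mu> \<subseteq> {1..n} \<Longrightarrow> A \<in> vecs \<Longrightarrow> mdeg (ray_mon A \<mu>) = (\<lambda>j. size \<mu> * A j)"
  unfolding ray_mon_def by (induction \<mu>) (auto simp: mdeg_add mdeg_blk fun_eq_iff)

lemma complete_sym_hom:
  assumes "S \<subseteq> {1..n}" "A \<in> vecs"
  shows "complete_sym A S c \<in> hom (\<lambda>j. c * A j)"
  unfolding complete_sym_def
  by (rule mpv.subspace_sum[OF hom_subspace])
     (use assms ray_mon_in_mons mdeg_ray_mon in \<open>auto simp: hom_def mono_of_def msets_def\<close>)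

lemma diag_act_ray_mon:
  assumes w: "w \<in> weyl_group W n" and A: "A \<in> inv_exps" and "set_mset \<mu> \<subseteq> {1..n}"
  shows "diag_act w (mon (ray_mon A \<mu>)) = (mon (ray_mon A (image_mset (perm_of w) \<mu>)) :: ('k::field) diag_poly)"
  using assms(3)
proof (induction \<mu>)
  case empty
  then show ?case by (simp add: ray_mon_def)
next
  case (add i \<mu>)
  have "mon (ray_mon A (add_mset i \<mu>)) = mon (blk i A) * (mon (ray_mon A \<mu>) :: 'k diag_poly)"
    by (simp add: ray_mon_def mult_single)
  then show ?case
    using add diag_act_blk[OF w, of i A, where 'k = 'k] A
    by (simp add: diag_act_mult inv_exps_def) (simp add: ray_mon_def mult_single)
qed

text \<open>For A in \<open>inv_exps\<close> a group element permutes the \<open>x_i^A\<close>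
  without signs, and \<open>h_c\<close> is symmetric in all n of them.\<close>

lemma complete_sym_invariant:
  assumes A: "A \<in> inv_exps" and "c \<ge> 1"
  shows "complete_sym A {1..n} c \<in> invariants_no_const W n r"
proof -
  let ?h = "complete_sym A {1..n} c :: 'a diag_poly"
  have h: "?h \<in> hom (\<lambda>j. c * A j)" using A by (intro complete_sym_hom) (auto simp: inv_exps_def)
  have "diag_act w ?h = ?h" if w: "w \<in> weyl_group W n" for w
  proof -
    note p = perm_of_permutes[OF weyl_group_signed[OF w]]
    have "diag_act w ?h = (\<Sum>\<mu>\<in>msets {1..n} c. mon (ray_mon A (image_mset (perm_of w) \<mu>)))"
      unfolding complete_sym_def diag_act_sum
      by (intro sum.cong refl diag_act_ray_mon w A) (auto simp: msets_def)
    also have "\<dots> = ?h"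
      unfolding complete_sym_def
    proof (rule sum.reindex_bij_witness[of _ "image_mset (inv_into UNIV (perm_of w))" "image_mset (perm_of w)"])
      fix \<mu> :: "nat multiset"
      show "image_mset (inv_into UNIV (perm_of w)) (image_mset (perm_of w) \<mu>) = \<mu>"
        by (simp add: multiset.map_comp o_def permutes_inverses[OF p])
      show "image_mset (perm_of w) (image_mset (inv_into UNIV (perm_of w)) \<mu>) = \<mu>"
        by (simp add: multiset.map_comp o_def permutes_inverses[OF p])
      show "image_mset (perm_of w) \<mu> \<in> msets {1..n} c" if "\<mu> \<in> msets {1..n} c"
        using that permutes_in_image[OF p] by (fastforce simp: msets_def)
      show "image_mset (inv_into UNIV (perm_of w)) \<mu> \<in> msets {1..n} c" if "\<mu> \<in> msets {1..n} c"
        using that permutes_in_image[OF permutes_inv[OF p]] by (fastforce simp: msets_def)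
    qed simp
    finally show ?thesis .
  qed
  moreover have "(\<lambda>j. c * A j) \<noteq> 0" using A assms(2) by (auto simp: inv_exps_def fun_eq_iff)
  ultimately show ?thesis
    using hom_lookup_0[OF h] subsetD[OF hom_subset_diag_polys h] by (auto simp: invariants_no_const_def)
qed

text \<open>Dropping a variable costs one degree, because
  \<open>h\<^sub>c(S) = h\<^sub>c(S \<union> {y}) - y h\<^bsub>c - 1\<^esub>(S \<union> {y})\<close>.\<close>
lemma complete_sym_in_coinv:
  assumes A: "A \<in> inv_exps" and "finite T" "T \<subseteq> {1..n}" "card T < c"
  shows "complete_sym A ({1..n} - T) c \<in> coinv"
  using assms(2-)
proof (induction T arbitrary: c rule: finite_induct)
  case empty
  then show ?case
    by (simp add: invariant_in_coinv complete_sym_invariant[OF A] del: One_nat_def)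
next
  case (insert t T)
  then obtain c' where c: "c = Suc c'" "card T < c'" by (cases c) auto
  have eq: "insert t ({1..n} - insert t T) = {1..n} - T" using insert by auto
  have "complete_sym A ({1..n} - insert t T) c =
      complete_sym A ({1..n} - T) c - mon (blk t A) * (complete_sym A ({1..n} - T) c' :: 'a diag_poly)"
    using complete_sym_insert[of "{1..n} - insert t T" t A c', where 'k = 'a] eq c by simp
  also have "\<dots> \<in> coinv"
    using insert c by (intro mpv.subspace_diff[OF coinv_subspace] coinv_mult insert.IH) auto
  finally show ?case .
qed

end

section \<open>A basis over the ring generated by the power sums\<close>

text \<open>For the leading monomial of \<open>h_c\<close>: if one variable is strictly the
  heaviest, its c-th power is heavier than every other monomial of degree c.\<close>

lemma sum_mset_strict_less:
  fixes f :: "'b \<Rightarrow> real"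
  assumes "\<And>i. i \<in># \<mu> \<Longrightarrow> i \<noteq> a \<Longrightarrow> f i < f a" "\<mu> \<noteq> replicate_mset (size \<mu>) a"
  shows "(\<Sum>i\<in>#\<mu>. f i) < real (size \<mu>) * f a"
  using assms
proof (induction \<mu>)
  case (add x \<mu>)
  have le: "(\<Sum>i\<in>#\<nu>. f i) \<le> real (size \<nu>) * f a" if "\<And>i. i \<in># \<nu> \<Longrightarrow> f i \<le> f a" for \<nu>
    using that by (induction \<nu>) (force simp: algebra_simps)+
  show ?case
  proof (cases "x = a")
    case True
    then have "\<mu> \<noteq> replicate_mset (size \<mu>) a" using add.prems(2) by auto
    then show ?thesis using add True by (simp add: algebra_simps)
  next
    case False
    have "(\<Sum>i\<in>#\<mu>. f i) \<le> real (size \<mu>) * f a"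
    proof (rule le)
      fix i assume "i \<in># \<mu>"
      then show "f i \<le> f a" using add.prems(1)[of i] by (cases "i = a") auto
    qed
    moreover have "f x < f a" using add.prems(1)[of x] False by simp
    ultimately show ?thesis by (simp add: algebra_simps)
  qed
qed simp

lemma mon_inject [simp]: "mon m = (mon m' :: ('v, 'k::field) mpol) \<longleftrightarrow> m = m'"
  by (metis keys_single singleton_inject zero_neq_one)

lemma mon_independent: "mpv.independent (mon ` M :: ('v, 'k::field) mpol set)"
  unfolding mpv.independent_explicit_module
proof (intro allI impI)
  fix t :: "('v, 'k) mpol set" and u v
  assume t: "finite t" "t \<subseteq> mon ` M" and eq: "(\<Sum>v\<in>t. mpol_const (u v) * v) = 0" and v: "v \<in> t"
  obtain m where m: "v = mon m" using v t by blast
  have "0 = lookup (\<Sum>v\<in>t. mpol_const (u v) * v) m" by (simp add: eq)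
  also have "\<dots> = (\<Sum>x\<in>t. if x = v then u v else 0)"
    unfolding lookup_sum
  proof (rule sum.cong[OF refl])
    fix x assume "x \<in> t"
    then obtain m' where "x = mon m'" using t by blast
    then show "lookup (mpol_const (u x) * x) m = (if x = v then u v else 0)"
      by (auto simp: m lookup_single when_def)
  qed
  also have "\<dots> = u v" using t v by simp
  finally show "u v = 0" by simp
qed

lemma card_mon_image: "card (mon ` M :: ('v, 'k::field) mpol set) = card M"
  by (rule card_image) (auto simp: inj_on_def dest: arg_cong[where f = keys])

context diag
begin

lemma mon_in_hom: "m \<in> mono_of J \<Longrightarrow> mon m \<in> hom J"
  by (simp add: hom_def)

lemma mons_split_block:
  assumes "m \<in> mons" "i \<in> {1..n}" "A \<le> row m i"
  obtains m0 where "m = m0 + blk i A"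
proof
  show "m = (m - blk i A) + blk i A"
  proof (rule poly_mapping_eqI)
    fix v
    show "lookup m v = lookup (m - blk i A + blk i A) v"
      using assms(3) by (cases v) (auto simp: lookup_add lookup_minus lookup_blk le_fun_def row_def split: if_splits)
  qed
qed

end

text \<open>J0 bounds the multidegrees under consideration. A map s exists as soon as n is at least
  the number of admissible exponents below J0, and the bound on \<open>tot J0\<close> makes the
  low-degree description of the ideal available for every J \<le> J0.\<close>

locale diag_slots = diag_weyl +
  fixes J0 :: "nat \<Rightarrow> nat" and s :: "(nat \<Rightarrow> nat) \<Rightarrow> nat"
  assumes s_inj: "inj_on s {A \<in> inv_exps. A \<le> J0}"
    and s_range: "s ` {A \<in> inv_exps. A \<le> J0} \<subseteq> {1..n}"
    and J0_small: "tot J0 < n"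
begin

definition exps :: "(nat \<Rightarrow> nat) set" where
  "exps = {A \<in> inv_exps. A \<le> J0}"

definition standard :: "(nat \<times> nat \<Rightarrow>\<^sub>0 nat) \<Rightarrow> bool" where
  "standard m \<longleftrightarrow> (\<forall>A\<in>exps. \<not> A \<le> row m (s A))"

lemma exps_inv: "A \<in> exps \<Longrightarrow> A \<in> inv_exps"
  and s_exps_range: "A \<in> exps \<Longrightarrow> s A \<in> {1..n}"
  and s_exps_inj: "A \<in> exps \<Longrightarrow> B \<in> exps \<Longrightarrow> s A = s B \<Longrightarrow> A = B"
  using s_inj s_range by (auto simp: exps_def dest: inj_onD)

lemma finite_exps: "finite exps"
  by (rule inj_on_finite[of s _ "{1..n}"]) (use s_inj s_range in \<open>auto simp: exps_def\<close>)

text \<open>An index that is not a slot weighs nothing. This loses against the slot of A because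
  \<open>slot_weight \<epsilon> A A\<close> is positive.\<close>

definition slot_val :: "real \<Rightarrow> nat \<Rightarrow> (nat \<Rightarrow> nat) \<Rightarrow> real" where
  "slot_val \<epsilon> i B = (if i \<in> s ` exps then slot_weight \<epsilon> (inv_into exps s i) B else 0)"

definition mon_weight :: "real \<Rightarrow> (nat \<times> nat \<Rightarrow>\<^sub>0 nat) \<Rightarrow> real" where
  "mon_weight \<epsilon> m = (\<Sum>i = 1..n. slot_val \<epsilon> i (row m i))"

lemma slot_val_add: "slot_val \<epsilon> i (A + B) = slot_val \<epsilon> i A + slot_val \<epsilon> i B"
  by (simp add: slot_val_def slot_weight_add)

lemma slot_val_smult: "slot_val \<epsilon> i (\<lambda>j. c * A j) = real c * slot_val \<epsilon> i A"
  by (simp add: slot_val_def slot_weight_smult)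

lemma slot_val_slot: "A \<in> exps \<Longrightarrow> slot_val \<epsilon> (s A) B = slot_weight \<epsilon> A B"
proof -
  assume A: "A \<in> exps"
  have "inj_on s exps" using s_inj by (simp add: exps_def)
  then show ?thesis using A by (simp add: slot_val_def)
qed

lemma mon_weight_add: "mon_weight \<epsilon> (m + m') = mon_weight \<epsilon> m + mon_weight \<epsilon> m'"
  by (simp add: mon_weight_def row_add slot_val_add sum.distrib)

lemma slot_val_0: "slot_val \<epsilon> i 0 = 0"
  using slot_val_add[of \<epsilon> i 0 0] by simp

lemma mon_weight_blk: "i \<in> {1..n} \<Longrightarrow> A \<in> vecs \<Longrightarrow> mon_weight \<epsilon> (blk i A) = slot_val \<epsilon> i A"
proof -
  assume *: "i \<in> {1..n}" "A \<in> vecs"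
  have "mon_weight \<epsilon> (blk i A) = (\<Sum>l = 1..n. if l = i then slot_val \<epsilon> i A else 0)"
    unfolding mon_weight_def using * by (intro sum.cong refl) (auto simp: row_blk slot_val_0)
  then show ?thesis using * by simp
qed

lemma mon_weight_ray_mon:
  "set_mset \<mu> \<subseteq> {1..n} \<Longrightarrow> A \<in> vecs \<Longrightarrow> mon_weight \<epsilon> (ray_mon A \<mu>) = (\<Sum>i\<in>#\<mu>. slot_val \<epsilon> i A)"
proof (induction \<mu>)
  case empty
  then show ?case using mon_weight_add[of \<epsilon> 0 0] by (simp add: ray_mon_def)
qed (simp add: ray_mon_def mon_weight_add mon_weight_blk)

lemma ray_mon_replicate: "ray_mon A (replicate_mset c i) = blk i (\<lambda>j. c * A j)"
proof (induction c)
  case 0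
  then show ?case by (simp add: ray_mon_def blk_def)
next
  case (Suc c)
  have "(\<lambda>j. Suc c * A j) = A + (\<lambda>j. c * A j)" by (simp add: fun_eq_iff)
  then show ?case using Suc by (simp add: ray_mon_def blk_add)
qed

text \<open>The complete symmetric polynomial of degree \<open>c\<close> in the \<open>x\<^sub>i\<^bsup>A'\<^esup>\<close>, with the slots of the smaller
  exponents on the ray of \<open>A = c A'\<close> left out, has leading monomial \<open>x\<^bsub>s A\<^esub>\<^bsup>A\<^esup>\<close>.\<close>
lemma reducer_exists:
  assumes A: "A \<in> exps"
    and pos: "\<forall>A\<in>exps. slot_weight \<epsilon> A A > 0"
    and less: "\<forall>A\<in>exps. \<forall>B\<in>exps. \<not> (parallel A B \<and> tot B \<le> tot A) \<longrightarrow>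
       slot_weight \<epsilon> B A < slot_weight \<epsilon> A A"
  shows "\<exists>(N :: nat multiset set) f. finite N \<and>
    (\<forall>\<mu>\<in>N. f \<mu> \<in> mono_of A \<and> mon_weight \<epsilon> (f \<mu>) < mon_weight \<epsilon> (blk (s A) A)) \<and>
    mon (blk (s A) A) + (\<Sum>\<mu>\<in>N. mon (f \<mu>)) \<in> (coinv :: ('k::field) diag_poly set)"
proof -
  obtain A' c where A': "A' \<in> inv_exps" "c \<ge> 1" and Ac: "A = (\<lambda>j. c * A' j)"
    and ray: "\<And>B. B \<in> inv_exps \<Longrightarrow> parallel A B \<Longrightarrow> \<exists>k\<ge>1. B = (\<lambda>j. k * A' j)"
    using ray_generator[OF exps_inv[OF A]] by blast
  let ?a = "\<lambda>k j. k * A' j"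
  define T where "T = (\<lambda>k. s (?a k)) ` {1..<c}"
  define S where "S = {1..n} - T"
  have A'v: "A' \<in> vecs" "A' \<noteq> 0" using A' by (auto simp: inv_exps_def)
  have tA': "tot A' > 0" using tot_pos A'v by blast
  have inj: "k = k'" if "?a k = ?a k'" for k k'
    using arg_cong[OF that, of tot] tA' by (simp add: tot_smult)
  have a_exps: "?a k \<in> exps" if "k \<in> {1..c}" for k
  proof -
    have "?a k \<le> A" using that by (auto simp: Ac le_fun_def)
    then have "?a k \<le> J0" using A by (auto simp: exps_def)
    moreover have "tot (?a k) > 0" using that tA' by (simp add: tot_smult)
    then have "?a k \<noteq> 0" by (metis tot_0 less_irrefl)
    moreover have "block_parity W dvd tot (?a k)" using A' by (simp add: tot_smult inv_exps_def)
    ultimately show ?thesis using A'v by (simp add: exps_def inv_exps_def vecs_def)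
  qed
  have T: "finite T" "T \<subseteq> {1..n}" using a_exps s_exps_range by (auto simp: T_def)
  \<comment> \<open>At most c - 1 variables are removed, the largest number that
    \<open>complete_sym_in_coinv\<close> permits.\<close>
  have "card T \<le> card {1..<c}" unfolding T_def by (intro card_image_le) simp
  then have cT: "card T < c" using A'(2) by simp
  have sA: "s A \<in> S"
  proof -
    have "s A \<notin> T"
    proof
      assume "s A \<in> T"
      then obtain k where k: "k \<in> {1..<c}" "s A = s (?a k)" by (auto simp: T_def)
      then have "A = ?a k" using s_exps_inj[OF A a_exps[of k]] by auto
      then show False using inj[of c k] k Ac by auto
    qed
    then show ?thesis using s_exps_range[OF A] by (simp add: S_def)
  qed
  have S: "S \<subseteq> {1..n}" "finite S" by (auto simp: S_def)
  have val: "slot_val \<epsilon> i A' < slot_val \<epsilon> (s A) A'" if i: "i \<in> S" "i \<noteq> s A" for i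
  proof -
    \<comment> \<open>The weights are compared at A = cA', whereas the variables of
      \<open>h_c\<close> carry the exponent A'; linearity of the weight allows scaling by c.\<close>
    have "real c * slot_val \<epsilon> i A' < real c * slot_val \<epsilon> (s A) A'"
    proof (cases "i \<in> s ` exps")
      case True
      then obtain B where B: "B \<in> exps" "i = s B" by blast
      have "\<not> (parallel A B \<and> tot B \<le> tot A)"
      proof
        assume *: "parallel A B \<and> tot B \<le> tot A"
        then obtain k where k: "k \<ge> 1" "B = ?a k" using ray exps_inv B by blast
        then have "k \<le> c" using * tA' by (simp add: tot_smult Ac)
        moreover have "k \<noteq> c" using k i B Ac by auto
        ultimately have "i \<in> T" using k B by (auto simp: T_def)
        then show False using i by (simp add: S_def)
      qed
      then have "slot_weight \<epsilon> B A < slot_weight \<epsilon> A A" using less A B(1) by blast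
      then show ?thesis
        using slot_val_slot[OF A, of \<epsilon> A] slot_val_slot[OF B(1), of \<epsilon> A] B(2)
        by (simp add: Ac slot_val_smult)
    next
      case False
      then have "slot_val \<epsilon> i A' = 0" by (simp add: slot_val_def)
      moreover have "real c * slot_val \<epsilon> (s A) A' > 0"
        using pos A slot_val_slot[OF A, of \<epsilon> A] by (simp add: Ac slot_val_smult)
      ultimately show ?thesis by simp
    qed
    then show ?thesis using A'(2) by simp
  qed
  let ?\<mu>0 = "replicate_mset c (s A)"
  define N where "N = msets S c - {?\<mu>0}"
  have \<mu>0: "?\<mu>0 \<in> msets S c" using sA A'(2) by (auto simp: msets_def)
  have lead: "ray_mon A' ?\<mu>0 = blk (s A) A" by (simp add: ray_mon_replicate Ac)
  show ?thesis
  proof (intro exI[of _ N] exI[of _ "ray_mon A'"] conjI ballI)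
    show "finite N" using finite_msets S by (simp add: N_def)
    fix \<mu> assume "\<mu> \<in> N"
    then have \<mu>: "set_mset \<mu> \<subseteq> S" "size \<mu> = c" "\<mu> \<noteq> ?\<mu>0" by (auto simp: N_def msets_def)
    then show "ray_mon A' \<mu> \<in> mono_of A"
      using S ray_mon_in_mons[of \<mu> A'] mdeg_ray_mon[of \<mu> A'] A'v by (auto simp: mono_of_def Ac)
    show "mon_weight \<epsilon> (ray_mon A' \<mu>) < mon_weight \<epsilon> (blk (s A) A)"
    proof -
      have "mon_weight \<epsilon> (ray_mon A' \<mu>) = (\<Sum>i\<in>#\<mu>. slot_val \<epsilon> i A')"
        using \<mu> S A'v by (intro mon_weight_ray_mon) auto
      also have "\<dots> < real (size \<mu>) * slot_val \<epsilon> (s A) A'"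
        using val \<mu> by (intro sum_mset_strict_less) auto
      also have "\<dots> = slot_val \<epsilon> (s A) A" by (simp add: \<mu> Ac slot_val_smult)
      also have "\<dots> = mon_weight \<epsilon> (blk (s A) A)"
        using A exps_inv s_exps_range by (subst mon_weight_blk) (auto simp: inv_exps_def)
      finally show ?thesis .
    qed
  next
    have "(complete_sym A' S c :: 'k diag_poly) \<in> coinv"
      unfolding S_def by (rule complete_sym_in_coinv[OF A'(1) T cT])
    also have "complete_sym A' S c = mon (blk (s A) A) + (\<Sum>\<mu>\<in>N. mon (ray_mon A' \<mu>) :: 'k diag_poly)"
      unfolding complete_sym_def N_def lead[symmetric]
      by (rule sum.remove[OF finite_msets[OF S(2)] \<mu>0])
    finally show "mon (blk (s A) A) + (\<Sum>\<mu>\<in>N. mon (ray_mon A' \<mu>)) \<in> (coinv :: 'k diag_poly set)" .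
  qed
qed

text \<open>Division by the reducers: a multiple of a reducer replaces a nonstandard monomial by
  lighter ones of the same multidegree. Real weights are not well-founded, so the induction is on
  the number of lighter monomials in that multidegree.\<close>

lemma mon_in_standard_span:
  assumes "m \<in> mono_of J"
  shows "mon m \<in> mpv.span (mon ` {b \<in> mono_of J. standard b} \<union> (coinv \<inter> hom J) :: ('k::field) diag_poly set)"
    (is "_ \<in> mpv.span ?G")
proof -
  have "exps \<subseteq> vecs - {0}" by (auto simp: exps_def inv_exps_def)
  from slot_weights_exist[OF finite_exps this] obtain \<epsilon> where
    pos: "\<forall>A\<in>exps. slot_weight \<epsilon> A A > 0"
    and wless: "\<forall>A\<in>exps. \<forall>B\<in>exps. \<not> (parallel A B \<and> tot B \<le> tot A) \<longrightarrow>
       slot_weight \<epsilon> B A < slot_weight \<epsilon> A A"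
    by metis
  define below where "below m = {m' \<in> mono_of J. mon_weight \<epsilon> m' < mon_weight \<epsilon> m}" for m
  show ?thesis
    using assms
  proof (induction "card (below m)" arbitrary: m rule: less_induct)
    case (less m)
    show ?case
    proof (cases "standard m")
      case True
      then show ?thesis using less.prems by (intro mpv.span_base) auto
    next
      case False
      then obtain A where A: "A \<in> exps" "A \<le> row m (s A)" by (auto simp: standard_def)
      have Av: "A \<in> vecs" using exps_inv[OF A(1)] by (simp add: inv_exps_def)
      have mm: "m \<in> mons" using less.prems by (simp add: mono_of_def)
      obtain m0 where m0: "m = m0 + blk (s A) A"
        using mons_split_block[OF mm s_exps_range[OF A(1)] A(2)] by blast
      obtain N :: "nat multiset set" and f where N: "finite N"
        and f: "\<And>\<mu>. \<mu> \<in> N \<Longrightarrow> f \<mu> \<in> mono_of A \<and> mon_weight \<epsilon> (f \<mu>) < mon_weight \<epsilon> (blk (s A) A)"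
        and red: "mon (blk (s A) A) + (\<Sum>\<mu>\<in>N. mon (f \<mu>)) \<in> (coinv :: 'k diag_poly set)"
        using reducer_exists[OF A(1) pos wless, where 'k = 'k] by blast
      have m0m: "m0 \<in> mons" using mm m0 by simp
      have "mdeg m0 + A = J"
        using less.prems s_exps_range[OF A(1)] Av by (simp add: m0 mono_of_def mdeg_add mdeg_blk)
      then have f': "m0 + f \<mu> \<in> mono_of J" if "\<mu> \<in> N" for \<mu>
        using f[OF that] m0m by (auto simp: mono_of_def mdeg_add)
      let ?g = "mon m + (\<Sum>\<mu>\<in>N. mon (m0 + f \<mu>)) :: 'k diag_poly"
      have "mon m0 * (mon (blk (s A) A) + (\<Sum>\<mu>\<in>N. mon (f \<mu>))) \<in> (coinv :: 'k diag_poly set)"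
        by (rule coinv_mult[OF _ red]) (simp add: m0m)
      also have "mon m0 * (mon (blk (s A) A) + (\<Sum>\<mu>\<in>N. mon (f \<mu>))) = ?g"
        by (simp add: distrib_left sum_distrib_left mult_single m0)
      finally have "?g \<in> coinv" .
      moreover have "?g \<in> hom J"
        by (intro mpv.subspace_add[OF hom_subspace] mpv.subspace_sum[OF hom_subspace] mon_in_hom less.prems f')
      ultimately have g: "?g \<in> mpv.span ?G" by (intro mpv.span_base) auto
      have "(\<Sum>\<mu>\<in>N. mon (m0 + f \<mu>)) \<in> mpv.span ?G"
      proof (rule mpv.span_sum)
        fix \<mu> assume \<mu>: "\<mu> \<in> N"
        have lt: "mon_weight \<epsilon> (m0 + f \<mu>) < mon_weight \<epsilon> m"
          using f[OF \<mu>] by (simp add: m0 mon_weight_add)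
        then have "below (m0 + f \<mu>) \<subset> below m"
          using f'[OF \<mu>] by (auto simp: below_def)
        then have "card (below (m0 + f \<mu>)) < card (below m)"
          by (intro psubset_card_mono) (simp_all add: below_def)
        then show "mon (m0 + f \<mu>) \<in> mpv.span ?G" by (rule less.hyps) (rule f'[OF \<mu>])
      qed
      with g have "?g - (\<Sum>\<mu>\<in>N. mon (m0 + f \<mu>)) \<in> mpv.span ?G" by (rule mpv.span_diff)
      then show ?thesis by simp
    qed
  qed
qed

lemma hom_subset_standard_span:
  "(hom J :: ('k::field) diag_poly set) \<subseteq>
    mpv.span (mon ` {b \<in> mono_of J. standard b} \<union> (coinv \<inter> hom J))"
    (is "_ \<subseteq> ?S")
proof -
  have "mpv.span (mon ` mono_of J) \<subseteq> ?S"
    by (rule mpv.span_minimal) (use mon_in_standard_span in auto)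
  then show ?thesis unfolding hom_eq_span[symmetric] .
qed

section \<open>Products of power sums with standard monomials\<close>

definition psums :: "(nat \<Rightarrow> nat) multiset \<Rightarrow> ('k::field) diag_poly" where
  "psums \<kappa> = (\<Prod>A\<in>#\<kappa>. psum A)"

text \<open>The pair \<open>(\<kappa>, b)\<close> stands for the basis element \<open>(\<Prod>A\<in>#\<kappa>. psum A) x\<^bsup>b\<^esup>\<close> of the polynomial ring;
  \<open>idx_mon\<close> is the monomial that it is matched with when counting dimensions.\<close>
definition idx :: "(nat \<Rightarrow> nat) \<Rightarrow> ((nat \<Rightarrow> nat) multiset \<times> (nat \<times> nat \<Rightarrow>\<^sub>0 nat)) set" where
  "idx J = {(\<kappa>, b). set_mset \<kappa> \<subseteq> inv_exps \<and> b \<in> mons \<and> standard b \<and> sum_mset \<kappa> + mdeg b = J}"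

definition fam :: "(nat \<Rightarrow> nat) multiset \<times> (nat \<times> nat \<Rightarrow>\<^sub>0 nat) \<Rightarrow> ('k::field) diag_poly" where
  "fam = (\<lambda>(\<kappa>, b). psums \<kappa> * mon b)"

definition idx_mon :: "(nat \<Rightarrow> nat) multiset \<times> (nat \<times> nat \<Rightarrow>\<^sub>0 nat) \<Rightarrow> (nat \<times> nat \<Rightarrow>\<^sub>0 nat)" where
  "idx_mon = (\<lambda>(\<kappa>, b). b + (\<Sum>A\<in>#\<kappa>. blk (s A) A))"

lemma psums_hom:
  "set_mset \<kappa> \<subseteq> inv_exps \<Longrightarrow> (psums \<kappa> :: ('k::field) diag_poly) \<in> hom (sum_mset \<kappa>)"
proof (induction \<kappa>)
  case empty
  have "(1 :: 'k diag_poly) = mon 0" by simp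
  then show ?case by (simp add: psums_def hom_def mono_of_def zero_fun_def)
next
  case (add A \<kappa>)
  then have "(psum A * psums \<kappa> :: 'k diag_poly) \<in> hom (A + sum_mset \<kappa>)"
    by (intro hom_mult psum_in_hom inv_exps_vecs) auto
  then show "(psums (add_mset A \<kappa>) :: 'k diag_poly) \<in> hom (sum_mset (add_mset A \<kappa>))"
    by (simp add: psums_def)
qed

lemma fam_hom: "x \<in> idx J \<Longrightarrow> fam x \<in> hom J"
  by (auto simp: idx_def fam_def intro!: hom_mult psums_hom mon_in_hom) (auto simp: mono_of_def)

lemma tot_less:
  assumes "A \<in> inv_exps" shows "tot B < tot (B + A)"
  using assms tot_pos[of A] by (auto simp: tot_add inv_exps_def)

text \<open>Modulo the ideal the standard monomials suffice. In degree below n the ideal is spanned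
  by the \<open>mon m * psum A\<close>; here \<open>mon m\<close> has smaller degree, and
  multiplying its expansion by \<open>psum A\<close> adds A to each \<kappa>.\<close>

lemma hom_subset_fam_span:
  assumes "J \<le> J0"
  shows "(hom J :: ('k::field_char_0) diag_poly set) \<subseteq> mpv.span (fam ` idx J)"
  using assms
proof (induction "tot J" arbitrary: J rule: less_induct)
  case less
  have totJ: "tot J < n"
  proof -
    have "tot J \<le> tot J0" using less.prems by (auto simp: tot_def le_fun_def intro: sum_mono)
    then show ?thesis using J0_small by simp
  qed
  have "mon ` {b \<in> mono_of J. standard b} \<subseteq> mpv.span (fam ` idx J :: 'k diag_poly set)"
  proof
    fix x :: "'k diag_poly" assume "x \<in> mon ` {b \<in> mono_of J. standard b}"
    then obtain b where "x = mon b" "b \<in> mono_of J" "standard b" by blast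
    then have "x = fam ({#}, b)" "({#}, b) \<in> idx J"
      by (auto simp: fam_def psums_def idx_def mono_of_def)
    then show "x \<in> mpv.span (fam ` idx J)" by (intro mpv.span_base) auto
  qed
  moreover have "coinv \<inter> hom J \<subseteq> mpv.span (fam ` idx J :: 'k diag_poly set)"
    unfolding coinv_hom_eq[OF totJ] psum_hom_def
  proof (rule mpv.span_minimal)
    show "{mon m * psum A |m A. m \<in> mons \<and> A \<in> inv_exps \<and> mdeg m + A = J} \<subseteq> mpv.span (fam ` idx J :: 'k diag_poly set)"
    proof clarify
      fix m A assume m: "m \<in> mons" "A \<in> inv_exps" "J = mdeg m + A"
      let ?S = "{p. p * psum A \<in> mpv.span (fam ` idx (mdeg m + A) :: 'k diag_poly set)}"
      have "mpv.subspace ?S"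
        by (rule mpv.subspaceI)
           (auto simp: distrib_right mult.assoc mpv.span_zero intro: mpv.span_add mpv.span_scale)
      moreover have "fam ` idx (mdeg m) \<subseteq> ?S"
      proof clarify
        fix \<kappa> b assume "(\<kappa>, b) \<in> idx (mdeg m)"
        then have "(add_mset A \<kappa>, b) \<in> idx (mdeg m + A)"
          using m by (auto simp: idx_def add_ac)
        moreover have "fam (\<kappa>, b) * psum A = (fam (add_mset A \<kappa>, b) :: 'k diag_poly)"
          by (simp add: fam_def psums_def mult_ac)
        ultimately show "fam (\<kappa>, b) * psum A \<in> mpv.span (fam ` idx (mdeg m + A) :: 'k diag_poly set)"
          by (simp add: mpv.span_base)
      qed
      ultimately have "mpv.span (fam ` idx (mdeg m)) \<subseteq> ?S" by (intro mpv.span_minimal)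
      moreover have "mon m \<in> mpv.span (fam ` idx (mdeg m) :: 'k diag_poly set)"
      proof -
        have "mdeg m \<le> J0" using less.prems m by (auto simp: le_fun_def intro: order_trans[OF le_add1])
        then have "(hom (mdeg m) :: 'k diag_poly set) \<subseteq> mpv.span (fam ` idx (mdeg m))"
          using less.hyps[of "mdeg m"] tot_less[OF m(2)] m(3) by simp
        then show ?thesis using m(1) by (auto simp: hom_def mono_of_def)
      qed
      ultimately show "mon m * psum A \<in> mpv.span (fam ` idx (mdeg m + A) :: 'k diag_poly set)" by blast
    qed
  qed simp
  ultimately have "mpv.span (mon ` {b \<in> mono_of J. standard b} \<union> (coinv \<inter> hom J)) \<subseteq> mpv.span (fam ` idx J :: 'k diag_poly set)"
    by (intro mpv.span_minimal) auto
  then show ?case using hom_subset_standard_span by blast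
qed

lemma idx_exps:
  assumes "J \<le> J0" "(\<kappa>, b) \<in> idx J" "A \<in># \<kappa>"
  shows "A \<in> exps"
proof -
  have "sum_mset \<kappa> + mdeg b = J" "A \<in> inv_exps" using assms by (auto simp: idx_def)
  moreover obtain \<kappa>' where "\<kappa> = add_mset A \<kappa>'" using assms(3) by (metis insert_DiffM)
  ultimately have "A + (sum_mset \<kappa>' + mdeg b) = J" by (simp add: add.assoc)
  then have "A \<le> J" by (auto simp: le_fun_def)
  then show ?thesis using assms(1) \<open>A \<in> inv_exps\<close> by (auto simp: exps_def)
qed

lemma row_slots:
  assumes "set_mset \<kappa> \<subseteq> exps" "A \<in> exps"
  shows "row (\<Sum>B\<in>#\<kappa>. blk (s B) B) (s A) = (\<lambda>j. count \<kappa> A * A j)"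
  using assms(1)
proof (induction \<kappa>)
  case (add B \<kappa>)
  have "B \<in> vecs" using add.prems exps_inv by (auto simp: inv_exps_def)
  moreover have "s A = s B \<longleftrightarrow> A = B" using add.prems assms(2) s_exps_inj by auto
  ultimately show ?case using add by (cases "A = B") (auto simp: row_add row_blk)
qed (auto simp: fun_eq_iff row_0[THEN fun_cong])

lemma slots_in_mono_of:
  "set_mset \<kappa> \<subseteq> exps \<Longrightarrow> (\<Sum>B\<in>#\<kappa>. blk (s B) B) \<in> mono_of (sum_mset \<kappa>)"
proof (induction \<kappa>)
  case (add A \<kappa>)
  then have "blk (s A) A \<in> mono_of A"
    using s_exps_range[of A] exps_inv[of A] by (auto simp: mono_of_def mdeg_blk inv_exps_def)
  then have "blk (s A) A + (\<Sum>B\<in>#\<kappa>. blk (s B) B) \<in> mono_of (A + sum_mset \<kappa>)"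
    using add by (intro mono_of_add) auto
  then show "(\<Sum>B\<in>#add_mset A \<kappa>. blk (s B) B) \<in> mono_of (sum_mset (add_mset A \<kappa>))" by simp
qed (simp add: mono_of_def)

lemma idx_mon_mono_of: "J \<le> J0 \<Longrightarrow> x \<in> idx J \<Longrightarrow> idx_mon x \<in> mono_of J"
proof -
  assume J: "J \<le> J0" and x: "x \<in> idx J"
  obtain \<kappa> b where xx: "x = (\<kappa>, b)" by (cases x)
  have "set_mset \<kappa> \<subseteq> exps" using idx_exps[OF J] x xx by blast
  from slots_in_mono_of[OF this] have "b + (\<Sum>A\<in>#\<kappa>. blk (s A) A) \<in> mono_of (mdeg b + sum_mset \<kappa>)"
    using x by (intro mono_of_add) (auto simp: xx idx_def mono_of_def)
  then show ?thesis using x by (auto simp: xx idx_mon_def idx_def add.commute)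
qed

text \<open>The row of the image at s(A) is \<open>row b (s A)\<close> plus
  \<open>count \<kappa> A\<close> times A. As A is not below \<open>row b (s A)\<close>, the
  multiplicity is the largest k for which kA is below this row. So \<kappa> can be read off, and
  then b.\<close>

lemma idx_mon_inj:
  assumes J: "J \<le> J0"
  shows "inj_on idx_mon (idx J)"
proof (rule inj_onI, clarify)
  fix \<kappa> b \<kappa>' b'
  assume x: "(\<kappa>, b) \<in> idx J" and y: "(\<kappa>', b') \<in> idx J" and eq: "idx_mon (\<kappa>, b) = idx_mon (\<kappa>', b')"
  have \<kappa>: "set_mset \<kappa> \<subseteq> exps" "set_mset \<kappa>' \<subseteq> exps" using idx_exps[OF J] x y by blast+
  have st: "standard b" "standard b'" using x y by (auto simp: idx_def)
  have rows: "row b (s A) j + count \<kappa> A * A j = row b' (s A) j + count \<kappa>' A * A j" if "A \<in> exps" for A j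
  proof -
    have "row (idx_mon (\<kappa>, b)) (s A) j = row (idx_mon (\<kappa>', b')) (s A) j" by (simp add: eq)
    then show ?thesis using that \<kappa> by (simp add: idx_mon_def row_add row_slots)
  qed
  have "count \<kappa> A = count \<kappa>' A" for A
  proof (cases "A \<in> exps")
    case True
    have aux: "\<not> k < k'" if "\<And>j. row b (s A) j + k * A j = row b' (s A) j + k' * A j" "standard b" for b b' k k'
    proof
      assume "k < k'"
      have "A j \<le> row b (s A) j" for j
      proof -
        have "(k + 1) * A j \<le> k' * A j" using \<open>k < k'\<close> by (intro mult_right_mono) auto
        then show ?thesis using that(1)[of j] by simp
      qed
      then show False using that(2) True by (auto simp: standard_def le_fun_def)
    qed
    have "\<not> count \<kappa> A < count \<kappa>' A" by (rule aux[of b _ b']) (use rows[OF True] st in auto)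
    moreover have "\<not> count \<kappa>' A < count \<kappa> A" by (rule aux[of b' _ b]) (use rows[OF True] st in auto)
    ultimately show ?thesis by simp
  next
    case False
    then have "A \<notin># \<kappa>" "A \<notin># \<kappa>'" using \<kappa> by auto
    then show ?thesis by (simp add: not_in_iff)
  qed
  then have "\<kappa> = \<kappa>'" by (rule multiset_eqI)
  then show "\<kappa> = \<kappa>' \<and> b = b'" using eq by (simp add: idx_mon_def)
qed

lemma finite_idx: "J \<le> J0 \<Longrightarrow> finite (idx J)"
  by (rule inj_on_finite[OF idx_mon_inj _ finite_mono_of[of J]]) (use idx_mon_mono_of in auto)

lemma card_idx_le: "J \<le> J0 \<Longrightarrow> card (idx J) \<le> card (mono_of J)"
  by (rule card_inj_on_le[OF idx_mon_inj]) (use idx_mon_mono_of in auto)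

text \<open>A maximal independent subset still spans, so it has at least as many elements as there
  are monomials. By \<open>card_idx_le\<close> the whole family has at most that many members, so no
  two members coincide and the subset is the whole family.\<close>

lemma fam_basis:
  assumes J: "J \<le> J0"
  shows "inj_on (fam :: _ \<Rightarrow> ('k::field_char_0) diag_poly) (idx J)"
    and "mpv.independent (fam ` idx J :: 'k diag_poly set)"
proof -
  let ?B = "fam ` idx J :: 'k diag_poly set"
  have fin: "finite ?B" using finite_idx[OF J] by simp
  obtain B' where B': "B' \<subseteq> ?B" "mpv.independent B'" "?B \<subseteq> mpv.span B'"
    using mpv.maximal_independent_subset[of ?B] by blast
  have "mon ` mono_of J \<subseteq> hom J" using mon_in_hom by blast
  also have "hom J \<subseteq> mpv.span ?B" by (rule hom_subset_fam_span[OF J])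
  also have "mpv.span ?B \<subseteq> mpv.span B'" by (intro mpv.span_minimal B') simp
  finally have "card (mon ` mono_of J :: 'k diag_poly set) \<le> card B'"
    using mpv.independent_span_bound[OF finite_subset[OF B'(1) fin] mon_independent] by blast
  then have 1: "card (mono_of J) \<le> card B'" by (simp only: card_mon_image)
  have 2: "card B' \<le> card ?B" by (rule card_mono[OF fin B'(1)])
  have 3: "card ?B \<le> card (idx J)" by (rule card_image_le[OF finite_idx[OF J]])
  have "card ?B = card (idx J)" using 1 2 3 card_idx_le[OF J] by linarith
  then show "inj_on (fam :: _ \<Rightarrow> 'k diag_poly) (idx J)"
    by (rule eq_card_imp_inj_on[OF finite_idx[OF J]])
  have "card B' = card ?B" using 1 2 3 card_idx_le[OF J] by linarith
  then have "B' = ?B" using card_subset_eq[OF fin B'(1)] by blast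
  then show "mpv.independent ?B" using B'(2) by simp
qed

end

section \<open>Traces\<close>

context diag
begin

lemma finite_vecs_le: "finite {A \<in> vecs. A \<le> J}"
proof (rule finite_subset)
  show "{A \<in> vecs. A \<le> J} \<subseteq> (\<lambda>f j. if j \<in> {1..r} then f j else 0) ` ({1..r} \<rightarrow>\<^sub>E {..Max (insert 0 (J ` {1..r}))})"
  proof
    fix A assume A: "A \<in> {A \<in> vecs. A \<le> J}"
    have "A j \<le> Max (insert 0 (J ` {1..r}))" if "j \<in> {1..r}" for j
    proof -
      have "A j \<le> J j" using A by (simp add: le_fun_def)
      also have "J j \<le> Max (insert 0 (J ` {1..r}))" using that by (intro Max_ge) auto
      finally show ?thesis .
    qed
    then have "restrict A {1..r} \<in> {1..r} \<rightarrow>\<^sub>E {..Max (insert 0 (J ` {1..r}))}" by auto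
    moreover have "A = (\<lambda>j. if j \<in> {1..r} then restrict A {1..r} j else 0)"
      using A by (auto simp: vecs_def)
    ultimately show "A \<in> (\<lambda>f j. if j \<in> {1..r} then f j else 0) ` ({1..r} \<rightarrow>\<^sub>E {..Max (insert 0 (J ` {1..r}))})"
      by blast
  qed
  show "finite ((\<lambda>f j. if j \<in> {1..r} then f j else 0) ` ({1..r} \<rightarrow>\<^sub>E {..Max (insert 0 (J ` {1..r}))}))"
    by (intro finite_imageI finite_PiE) auto
qed

end

context diag_weyl
begin

definition exp_multisets :: "(nat \<Rightarrow> nat) \<Rightarrow> (nat \<Rightarrow> nat) multiset set" where
  "exp_multisets J = {\<kappa>. set_mset \<kappa> \<subseteq> inv_exps \<and> sum_mset \<kappa> \<le> J}"

lemma finite_inv_exps_le: "finite {A \<in> inv_exps. A \<le> J}"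
  by (rule finite_subset[OF _ finite_vecs_le[of J]]) (auto simp: inv_exps_def)

lemma finite_exp_multisets: "finite (exp_multisets J)"
proof (induction "tot J" arbitrary: J rule: less_induct)
  case less
  let ?H = "{A \<in> inv_exps. A \<le> J}"
  have "exp_multisets J \<subseteq> insert {#} (\<Union>A\<in>?H. add_mset A ` exp_multisets (J - A))"
  proof
    fix \<kappa> assume \<kappa>: "\<kappa> \<in> exp_multisets J"
    show "\<kappa> \<in> insert {#} (\<Union>A\<in>?H. add_mset A ` exp_multisets (J - A))"
    proof (cases \<kappa>)
      case (add A \<kappa>')
      have le: "A j + sum_mset \<kappa>' j \<le> J j" for j
        using \<kappa> add by (auto simp: exp_multisets_def le_fun_def)
      have "A \<in> ?H" using \<kappa> add le by (auto simp: exp_multisets_def le_fun_def intro: add_leD1)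
      moreover have "\<kappa>' \<in> exp_multisets (J - A)"
        using \<kappa> add le by (auto simp: exp_multisets_def le_fun_def fun_diff_def add_le_imp_le_diff add.commute)
      ultimately show ?thesis using add by blast
    qed simp
  qed
  moreover have "finite (exp_multisets (J - A))" if "A \<in> ?H" for A
  proof (rule less.hyps)
    have "J = (J - A) + A" using that by (auto simp: le_fun_def fun_eq_iff fun_diff_def)
    then have "tot J = tot (J - A) + tot A" by (metis tot_add)
    moreover have "tot A > 0" using that tot_pos by (auto simp: inv_exps_def)
    ultimately show "tot (J - A) < tot J" by simp
  qed
  ultimately show ?case using finite_inv_exps_le by (auto intro: finite_subset)
qed

end

section \<open>Coefficients in the basis and the trace on the polynomial ring\<close>

context diag_slots
begin

definition cf :: "(nat \<Rightarrow> nat) \<Rightarrow> ('k::field_char_0) diag_poly \<Rightarrow>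
    (nat \<Rightarrow> nat) multiset \<times> (nat \<times> nat \<Rightarrow>\<^sub>0 nat) \<Rightarrow> 'k" where
  "cf J p x = mpv.representation (fam ` idx J) p (fam x)"

text \<open>The trace of w on the quotient in the basis of the classes of standard monomials: only
  the coefficients with empty \<kappa> survive, as \<open>psums \<kappa>\<close> lies in the ideal
  otherwise.\<close>

definition chi :: "(nat \<Rightarrow> nat) \<Rightarrow> (int \<Rightarrow> int) \<Rightarrow> 'k::field_char_0" where
  "chi J w = (\<Sum>b | b \<in> mono_of J \<and> standard b. cf J (diag_act w (mon b)) ({#}, b))"

context
  fixes J assumes J: "J \<le> J0"
begin

lemma cf_add: "p \<in> hom J \<Longrightarrow> q \<in> hom J \<Longrightarrow> cf J (p + q) x = cf J p x + cf J q x"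
  using hom_subset_fam_span[OF J] fam_basis(2)[OF J] unfolding cf_def
  by (subst mpv.representation_add) auto

lemma cf_scale: "p \<in> hom J \<Longrightarrow> cf J (mpol_const c * p) x = c * cf J p x"
  using hom_subset_fam_span[OF J] fam_basis(2)[OF J] unfolding cf_def
  by (subst mpv.representation_scale) auto

lemma cf_0 [simp]: "cf J 0 x = 0"
  unfolding cf_def by (simp add: mpv.representation_zero)

lemma cf_sum: "(\<And>i. i \<in> S \<Longrightarrow> g i \<in> hom J) \<Longrightarrow> cf J (\<Sum>i\<in>S. g i) x = (\<Sum>i\<in>S. cf J (g i) x)"
proof (induction S rule: infinite_finite_induct)
  case (insert i S)
  then show ?case by (simp add: cf_add mpv.subspace_sum[OF hom_subspace])
qed simp_all

lemma cf_fam: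
  assumes "x \<in> idx J" "y \<in> idx J"
  shows "(cf J (fam y) x :: 'k::field_char_0) = (if x = y then 1 else 0)"
  using assms fam_basis[OF J, where 'k = 'k] unfolding cf_def
  by (subst mpv.representation_basis) (auto dest: inj_onD)

lemma cf_expand:
  assumes "p \<in> hom J"
  shows "p = (\<Sum>x\<in>idx J. mpol_const (cf J p x) * (fam x :: ('k::field_char_0) diag_poly))"
proof -
  have "p = (\<Sum>u\<in>fam ` idx J. mpol_const (mpv.representation (fam ` idx J) p u) * u)"
    using assms hom_subset_fam_span[OF J] fam_basis(2)[OF J] finite_idx[OF J]
    by (subst mpv.sum_representation_eq) auto
  then show ?thesis
    using fam_basis(1)[OF J, where 'k = 'k] by (simp add: sum.reindex cf_def o_def)
qed

text \<open>The ideal is spanned by the \<open>mon m * psum A\<close>. Expanding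
  \<open>mon m\<close> in the basis of its own degree and multiplying by \<open>psum A\<close> puts
  A into every \<kappa>, so no basis element with empty \<kappa> appears. Hence these coefficients
  are well defined on cosets.\<close>

lemma cf_coinv:
  assumes p: "p \<in> coinv \<inter> hom J" and b: "({#}, b) \<in> idx J"
  shows "(cf J p ({#}, b) :: 'k::field_char_0) = 0"
proof -
  have totJ: "tot J < n"
  proof -
    have "tot J \<le> tot J0" using J by (auto simp: tot_def le_fun_def intro: sum_mono)
    then show ?thesis using J0_small by simp
  qed
  let ?S = "{p \<in> hom J. cf J p ({#}, b) = (0 :: 'k)}"
  have sub: "mpv.subspace ?S"
    by (rule mpv.subspaceI)
       (auto simp: cf_add cf_scale mpv.subspace_0[OF hom_subspace] intro: mpv.subspace_add[OF hom_subspace]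
          mpv.subspace_scale[OF hom_subspace])
  have "mon m * psum A \<in> ?S" if m: "m \<in> mons" "A \<in> inv_exps" "mdeg m + A = J" for m A
  proof -
    let ?S' = "{p \<in> hom (mdeg m). p * psum A \<in> ?S}"
    have "mdeg m \<le> J0"
    proof (rule le_funI)
      fix j
      have "(mdeg m + A) j \<le> J0 j" unfolding m(3) using J by (rule le_funD)
      then show "mdeg m j \<le> J0 j" by simp
    qed
    then have span: "(hom (mdeg m) :: 'k diag_poly set) \<subseteq> mpv.span (fam ` idx (mdeg m))"
      by (rule hom_subset_fam_span)
    have "mpv.subspace ?S'"
      by (rule mpv.subspaceI)
         (use sub in \<open>auto simp: distrib_right mult.assoc mpv.subspace_0[OF hom_subspace] cf_add cf_scale
           intro: mpv.subspace_add[OF hom_subspace] mpv.subspace_scale[OF hom_subspace]\<close>)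
    moreover have "fam ` idx (mdeg m) \<subseteq> ?S'"
    proof clarify
      fix \<kappa> b' assume x: "(\<kappa>, b') \<in> idx (mdeg m)"
      then have y: "(add_mset A \<kappa>, b') \<in> idx J"
        using m by (auto simp: idx_def add_ac)
      have "fam (\<kappa>, b') * psum A = (fam (add_mset A \<kappa>, b') :: 'k diag_poly)"
        by (simp add: fam_def psums_def mult_ac)
      then show "fam (\<kappa>, b') \<in> hom (mdeg m) \<and> fam (\<kappa>, b') * psum A \<in> ?S"
        using fam_hom[OF x] fam_hom[OF y] cf_fam[OF b y, where 'k = 'k] by simp
    qed
    ultimately have "mpv.span (fam ` idx (mdeg m)) \<subseteq> ?S'" by (intro mpv.span_minimal)
    moreover have "mon m \<in> (hom (mdeg m) :: 'k diag_poly set)"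
      using m(1) by (simp add: hom_def mono_of_def)
    ultimately show ?thesis using span by blast
  qed
  then have "psum_hom J \<subseteq> ?S" unfolding psum_hom_def by (intro mpv.span_minimal sub) blast
  then show ?thesis using p coinv_hom_eq[OF totJ, where 'k = 'k] by blast
qed

text \<open>The identity tr(PQ) = tr(QP), where P is the matrix of the basis elements in terms of
  monomials and Q holds the coefficients of the images of the monomials in the basis.\<close>

lemma trace_change_basis:
  assumes w: "w \<in> signed_perms n"
  shows "(\<Sum>m\<in>mono_of J. lookup (diag_act w (mon m)) m) =
    (\<Sum>x\<in>idx J. cf J (diag_act w (fam x)) x :: 'k::field_char_0)"
proof -
  let ?T = "diag_act w :: 'k diag_poly \<Rightarrow> _"
  have hm: "?T (mon m) \<in> hom J" if "m \<in> mono_of J" for m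
    by (rule diag_act_hom[OF w mon_in_hom[OF that]])
  have "cf J (?T (fam x)) x = (\<Sum>m\<in>mono_of J. lookup (fam x) m * cf J (?T (mon m)) x)"
    if x: "x \<in> idx J" for x
  proof -
    have "?T (fam x) = (\<Sum>m\<in>mono_of J. mpol_const (lookup (fam x) m) * ?T (mon m))"
      by (subst hom_as_comb[OF fam_hom[OF x]])
         (simp add: diag_act_sum diag_act_scale del: mpol_const_mult_single)
    then show ?thesis
      by (simp add: cf_sum cf_scale hm mpv.subspace_scale[OF hom_subspace])
  qed
  then have "(\<Sum>x\<in>idx J. cf J (?T (fam x)) x) =
      (\<Sum>m\<in>mono_of J. \<Sum>x\<in>idx J. lookup (fam x) m * cf J (?T (mon m)) x)"
    by (subst sum.swap) simp
  also have "\<dots> = (\<Sum>m\<in>mono_of J. lookup (?T (mon m)) m)"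
  proof (rule sum.cong[OF refl])
    fix m assume m: "m \<in> mono_of J"
    show "(\<Sum>x\<in>idx J. lookup (fam x) m * cf J (?T (mon m)) x) = lookup (?T (mon m)) m"
      by (subst (2) cf_expand[OF hm[OF m]]) (simp add: lookup_sum, simp add: mult.commute)
  qed
  finally show ?thesis by simp
qed

end

lemma diag_act_psums:
  assumes "w \<in> weyl_group W n" "set_mset \<kappa> \<subseteq> inv_exps"
  shows "diag_act w (psums \<kappa>) = (psums \<kappa> :: ('k::field) diag_poly)"
  using assms(2)
proof (induction \<kappa>)
  case (add A \<kappa>)
  then show ?case using diag_act_psum[OF assms(1), of A, where 'k = 'k]
    by (simp add: psums_def diag_act_mult)
qed (simp add: psums_def)

lemma idx_eq_Sigma:
  "idx J = Sigma (exp_multisets J) (\<lambda>\<kappa>. {b \<in> mono_of (J - sum_mset \<kappa>). standard b})"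
proof (intro equalityI subsetI)
  fix x assume x: "x \<in> idx J"
  obtain \<kappa> b where xx: "x = (\<kappa>, b)" by (cases x)
  have *: "set_mset \<kappa> \<subseteq> inv_exps" "b \<in> mons" "standard b" "sum_mset \<kappa> + mdeg b = J"
    using x by (auto simp: xx idx_def)
  have eq: "J j = sum_mset \<kappa> j + mdeg b j" for j using *(4) by auto
  have "sum_mset \<kappa> \<le> J" by (auto simp: le_fun_def eq)
  moreover have "mdeg b = J - sum_mset \<kappa>" by (rule ext) (simp add: fun_diff_def eq)
  ultimately show "x \<in> Sigma (exp_multisets J) (\<lambda>\<kappa>. {b \<in> mono_of (J - sum_mset \<kappa>). standard b})"
    using * by (simp add: xx exp_multisets_def mono_of_def)
next
  fix x assume x: "x \<in> Sigma (exp_multisets J) (\<lambda>\<kappa>. {b \<in> mono_of (J - sum_mset \<kappa>). standard b})"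
  obtain \<kappa> b where xx: "x = (\<kappa>, b)" by (cases x)
  have *: "\<kappa> \<in> exp_multisets J" "b \<in> mono_of (J - sum_mset \<kappa>)" "standard b"
    using x by (auto simp: xx)
  then have "sum_mset \<kappa> + mdeg b = J"
    by (auto simp: exp_multisets_def mono_of_def le_fun_def fun_eq_iff fun_diff_def)
  then show "x \<in> idx J" using * by (simp add: xx idx_def exp_multisets_def mono_of_def)
qed

text \<open>As \<open>psums \<kappa>\<close> is invariant, w acts on
  \<open>psums \<kappa> * mon b\<close> through \<open>mon b\<close>. Its expansion in the terms
  (\<mu>, b') is shifted to (\<kappa> + \<mu>, b'), which returns to (\<kappa>, b) only for empty
  \<mu> and b' = b. So the diagonal coefficients are those of \<open>chi\<close>.\<close>

lemma trace_decomposition: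
  assumes J: "J \<le> J0" and w: "w \<in> weyl_group W n"
  shows "(\<Sum>m\<in>mono_of J. lookup (diag_act w (mon m)) m) =
    (\<Sum>\<kappa>\<in>exp_multisets J. chi (J - sum_mset \<kappa>) w :: 'k::field_char_0)"
proof -
  let ?T = "diag_act w :: 'k diag_poly \<Rightarrow> _"
  have ws: "w \<in> signed_perms n" by (rule weyl_group_signed[OF w])
  have diag: "cf J (?T (fam (\<kappa>, b))) (\<kappa>, b) = cf (J - sum_mset \<kappa>) (?T (mon b)) ({#}, b)"
    if \<kappa>: "\<kappa> \<in> exp_multisets J" and b: "b \<in> {b \<in> mono_of (J - sum_mset \<kappa>). standard b}" for \<kappa> b
  proof -
    let ?K = "J - sum_mset \<kappa>"
    have K: "?K \<le> J0" using J by (auto simp: le_fun_def fun_diff_def intro: order_trans[OF diff_le_self])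
    have sumK: "sum_mset \<kappa> + ?K = J" using \<kappa> by (auto simp: exp_multisets_def le_fun_def fun_eq_iff fun_diff_def)
    have Tb: "?T (mon b) \<in> hom ?K" using b by (intro diag_act_hom[OF ws] mon_in_hom) simp
    have \<kappa>': "set_mset \<kappa> \<subseteq> inv_exps" using \<kappa> by (simp add: exp_multisets_def)
    have x: "(\<kappa>, b) \<in> idx J" using \<kappa> b by (simp add: idx_eq_Sigma)
    have bK: "({#}, b) \<in> idx ?K" using b by (simp add: idx_def mono_of_def)
    have y: "(\<kappa> + \<mu>, b') \<in> idx J" if "(\<mu>, b') \<in> idx ?K" for \<mu> b'
      using that \<kappa>' sumK by (auto simp: idx_def add.assoc)
    have hy: "fam (\<kappa> + fst y, snd y) \<in> (hom J :: 'k diag_poly set)" if "y \<in> idx ?K" for y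
      using fam_hom[OF y[of "fst y" "snd y"]] that by simp
    have "?T (fam (\<kappa>, b)) = psums \<kappa> * ?T (mon b)"
      by (simp add: fam_def diag_act_mult diag_act_psums[OF w \<kappa>'])
    also have "\<dots> = (\<Sum>y\<in>idx ?K. mpol_const (cf ?K (?T (mon b)) y) * fam (\<kappa> + fst y, snd y))"
      by (subst cf_expand[OF K Tb])
         (simp add: sum_distrib_left fam_def psums_def case_prod_unfold mult_ac)
    finally have "cf J (?T (fam (\<kappa>, b))) (\<kappa>, b) =
        (\<Sum>y\<in>idx ?K. cf ?K (?T (mon b)) y * cf J (fam (\<kappa> + fst y, snd y)) (\<kappa>, b))"
      using hy by (simp add: cf_sum[OF J] cf_scale[OF J] mpv.subspace_scale[OF hom_subspace])
    also have "\<dots> = (\<Sum>y\<in>idx ?K. if y = ({#}, b) then cf ?K (?T (mon b)) y else 0)"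
    proof (rule sum.cong[OF refl])
      fix y assume "y \<in> idx ?K"
      then have "(cf J (fam (\<kappa> + fst y, snd y)) (\<kappa>, b) :: 'k) = (if (\<kappa>, b) = (\<kappa> + fst y, snd y) then 1 else 0)"
        using cf_fam[OF J x y[of "fst y" "snd y"], where 'k = 'k] by simp
      then show "cf ?K (?T (mon b)) y * cf J (fam (\<kappa> + fst y, snd y)) (\<kappa>, b) =
          (if y = ({#}, b) then cf ?K (?T (mon b)) y else 0)"
        by (cases y) auto
    qed
    also have "\<dots> = cf ?K (?T (mon b)) ({#}, b)" using bK finite_idx[OF K] by simp
    finally show ?thesis .
  qed
  have "(\<Sum>m\<in>mono_of J. lookup (?T (mon m)) m) = (\<Sum>x\<in>idx J. cf J (?T (fam x)) x)"
    by (rule trace_change_basis[OF J ws])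
  also have "\<dots> = (\<Sum>\<kappa>\<in>exp_multisets J. \<Sum>b\<in>{b \<in> mono_of (J - sum_mset \<kappa>). standard b}. cf J (?T (fam (\<kappa>, b))) (\<kappa>, b))"
    unfolding idx_eq_Sigma by (subst sum.Sigma) (auto simp: finite_exp_multisets)
  also have "\<dots> = (\<Sum>\<kappa>\<in>exp_multisets J. chi (J - sum_mset \<kappa>) w)"
    unfolding chi_def by (intro sum.cong refl) (use diag in auto)
  finally show ?thesis .
qed

end

section \<open>Traces in abstract vector spaces\<close>

lemma functional_lincomb:
  fixes V :: "('k::field, 'v) module" and f :: "'v \<Rightarrow> 'k"
  assumes "vectorspace class_ring V" "finite A" "A \<subseteq> carrier V"
    and add: "\<And>x y. x \<in> carrier V \<Longrightarrow> y \<in> carrier V \<Longrightarrow> f (x \<oplus>\<^bsub>V\<^esub> y) = f x + f y"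
    and smult: "\<And>c x. x \<in> carrier V \<Longrightarrow> f (c \<odot>\<^bsub>V\<^esub> x) = c * f x"
  shows "f (LinearCombinations.module.lincomb V a A) = (\<Sum>b\<in>A. a b * f b)"
proof -
  interpret vectorspace class_ring V by fact
  have "f \<zero>\<^bsub>V\<^esub> = f \<zero>\<^bsub>V\<^esub> + f \<zero>\<^bsub>V\<^esub>" using add[of "\<zero>\<^bsub>V\<^esub>" "\<zero>\<^bsub>V\<^esub>"] by simp
  then have f0: "f \<zero>\<^bsub>V\<^esub> = 0" by (metis add_cancel_right_left)
  show ?thesis
    using assms(2,3)
  proof (induction A rule: finite_induct)
    case empty
    then show ?case by (simp add: lincomb_def f0)
  next
    case (insert b A)
    have "finsum V (\<lambda>v. a v \<odot>\<^bsub>V\<^esub> v) (insert b A) = a b \<odot>\<^bsub>V\<^esub> b \<oplus>\<^bsub>V\<^esub> finsum V (\<lambda>v. a v \<odot>\<^bsub>V\<^esub> v) A"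
      using insert by (intro finsum_insert) auto
    moreover have "finsum V (\<lambda>v. a v \<odot>\<^bsub>V\<^esub> v) A \<in> carrier V"
      using insert by (intro finsum_closed) auto
    ultimately show ?case
      using insert by (simp add: lincomb_def add smult)
  qed
qed

text \<open>Vectors with dual functionals that separate points form a basis. In this form the trace
  on a quotient can be computed from functionals, with no need to know the basis that
  \<open>lin_trace\<close> selects.\<close>

lemma dual_system_trace:
  fixes V :: "('k::field, 'v) module" and v :: "'i \<Rightarrow> 'v" and \<phi> :: "'i \<Rightarrow> 'v \<Rightarrow> 'k"
  assumes V: "vectorspace class_ring V" and S: "finite S"
    and v: "\<And>s. s \<in> S \<Longrightarrow> v s \<in> carrier V"
    and \<phi>_add: "\<And>s x y. s \<in> S \<Longrightarrow> x \<in> carrier V \<Longrightarrow> y \<in> carrier V \<Longrightarrow> \<phi> s (x \<oplus>\<^bsub>V\<^esub> y) = \<phi> s x + \<phi> s y"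
    and \<phi>_smult: "\<And>s c x. s \<in> S \<Longrightarrow> x \<in> carrier V \<Longrightarrow> \<phi> s (c \<odot>\<^bsub>V\<^esub> x) = c * \<phi> s x"
    and dual: "\<And>s t. s \<in> S \<Longrightarrow> t \<in> S \<Longrightarrow> \<phi> s (v t) = (if s = t then 1 else 0)"
    and sep: "\<And>x y. x \<in> carrier V \<Longrightarrow> y \<in> carrier V \<Longrightarrow> (\<And>s. s \<in> S \<Longrightarrow> \<phi> s x = \<phi> s y) \<Longrightarrow> x = y"
    and T: "\<And>x. x \<in> carrier V \<Longrightarrow> T x \<in> carrier V"
    and T_add: "\<And>x y. x \<in> carrier V \<Longrightarrow> y \<in> carrier V \<Longrightarrow> T (x \<oplus>\<^bsub>V\<^esub> y) = T x \<oplus>\<^bsub>V\<^esub> T y"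
    and T_smult: "\<And>c x. x \<in> carrier V \<Longrightarrow> T (c \<odot>\<^bsub>V\<^esub> x) = c \<odot>\<^bsub>V\<^esub> T x"
  shows "lin_trace V T = (\<Sum>s\<in>S. \<phi> s (T (v s))) \<and> vectorspace.dim class_ring V = card S"
proof -
  interpret vectorspace class_ring V by (rule V)
  have inj: "inj_on v S"
  proof (rule inj_onI)
    fix s t assume st: "s \<in> S" "t \<in> S" "v s = v t"
    then have "\<phi> s (v t) = 1" using dual[of s s] by simp
    then show "s = t" using dual[of s t] st by (auto split: if_splits)
  qed
  let ?B0 = "v ` S"
  have B0: "finite ?B0" "?B0 \<subseteq> carrier V" using S v by auto
  define rep where "rep x = restrict (\<lambda>b. \<phi> (inv_into S v b) x) ?B0" for x
  have rep_v: "rep x (v s) = \<phi> s x" if "s \<in> S" for x s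
    using that inj by (simp add: rep_def)
  have \<phi>_lincomb: "\<phi> s (lincomb a ?B0) = a (v s)" if s: "s \<in> S" for s a
  proof -
    have "\<phi> s (lincomb a ?B0) = (\<Sum>b\<in>?B0. a b * \<phi> s b)"
      by (rule functional_lincomb[OF V B0]) (use s \<phi>_add \<phi>_smult in auto)
    also have "\<dots> = (\<Sum>t\<in>S. a (v t) * \<phi> s (v t))" by (simp add: sum.reindex[OF inj])
    also have "\<dots> = (\<Sum>t\<in>S. if t = s then a (v s) else 0)"
      by (intro sum.cong refl) (use s dual in auto)
    also have "\<dots> = a (v s)" using s S by simp
    finally show ?thesis .
  qed
  have lin_rep: "lincomb (rep x) ?B0 = x" if "x \<in> carrier V" for x
    using that B0 by (intro sep lincomb_closed) (auto simp: \<phi>_lincomb rep_v)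
  have "basis ?B0"
    unfolding basis_criterion[OF B0]
  proof (intro allI impI ex1I conjI)
    fix x assume x: "x \<in> carrier V"
    show "rep x \<in> ?B0 \<rightarrow>\<^sub>E carrier class_ring" by (simp add: rep_def)
    show "lincomb (rep x) ?B0 = x" by (rule lin_rep[OF x])
    fix a assume a: "a \<in> ?B0 \<rightarrow>\<^sub>E carrier class_ring \<and> lincomb a ?B0 = x"
    show "a = rep x"
    proof (rule PiE_ext[of _ ?B0 "\<lambda>_. UNIV"])
      fix b assume "b \<in> ?B0"
      then obtain s where "s \<in> S" "b = v s" by blast
      then show "a b = rep x b" using a \<phi>_lincomb[of s a] rep_v[of s x] by auto
    qed (use a in \<open>auto simp: rep_def\<close>)
  qed
  then have dim: "dim = card S" using dim_basis[OF B0(1)] card_image[OF inj] by simp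
  define B where "B = (SOME B. finite B \<and> basis B)"
  have "finite B \<and> basis B"
    unfolding B_def by (rule someI[of _ ?B0]) (use B0 \<open>basis ?B0\<close> in simp)
  then have B: "finite B" "basis B" "B \<subseteq> carrier V" by (auto simp: basis_def)
  let ?c = "coord V B"
  have uniq: "\<exists>!a. a \<in> B \<rightarrow>\<^sub>E UNIV \<and> lincomb a B = x" if "x \<in> carrier V" for x
    using B(2) that unfolding basis_criterion[OF B(1,3)] by simp
  have c: "?c x \<in> B \<rightarrow>\<^sub>E UNIV" "lincomb (?c x) B = x" if "x \<in> carrier V" for x
    using theI'[OF uniq[OF that]] by (auto simp: coord_def)
  have c_eq: "?c x = a" if "x \<in> carrier V" "a \<in> B \<rightarrow>\<^sub>E UNIV" "lincomb a B = x" for x a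
    unfolding coord_def by (rule the1_equality[OF uniq[OF that(1)]]) (use that in simp)
  have c_add: "?c (x \<oplus>\<^bsub>V\<^esub> y) b = ?c x b + ?c y b" if "x \<in> carrier V" "y \<in> carrier V" "b \<in> B" for x y b
  proof -
    have "?c (x \<oplus>\<^bsub>V\<^esub> y) = restrict (\<lambda>b. ?c x b + ?c y b) B"
    proof (rule c_eq)
      have "lincomb (restrict (\<lambda>b. ?c x b + ?c y b) B) B = lincomb (\<lambda>b. ?c x b + ?c y b) B"
        using B by (intro lincomb_cong) auto
      also have "\<dots> = lincomb (?c x) B \<oplus>\<^bsub>V\<^esub> lincomb (?c y) B"
        using lincomb_sum[OF B(1,3), of "?c x" "?c y"] by simp
      finally show "lincomb (restrict (\<lambda>b. ?c x b + ?c y b) B) B = x \<oplus>\<^bsub>V\<^esub> y" using c that by simp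
    qed (use that in auto)
    then show ?thesis using that by simp
  qed
  have c_smult: "?c (k \<odot>\<^bsub>V\<^esub> x) b = k * ?c x b" if "x \<in> carrier V" "b \<in> B" for k x b
  proof -
    have "?c (k \<odot>\<^bsub>V\<^esub> x) = restrict (\<lambda>b. k * ?c x b) B"
    proof (rule c_eq)
      have "lincomb (restrict (\<lambda>b. k * ?c x b) B) B = lincomb (\<lambda>b. k * ?c x b) B"
        using B by (intro lincomb_cong) auto
      also have "\<dots> = k \<odot>\<^bsub>V\<^esub> lincomb (?c x) B"
        using lincomb_smult[OF B(3), of "?c x" k] by simp
      finally show "lincomb (restrict (\<lambda>b. k * ?c x b) B) B = k \<odot>\<^bsub>V\<^esub> x" using c that by simp
    qed (use that in auto)
    then show ?thesis using that by simp
  qed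
  \<comment> \<open>Both bases enter: b is expanded in the v s. Exchanging the two sums and
    collecting \<open>T (v s)\<close> over B then gives the trace in terms of \<phi>.\<close>
  have Tb: "?c (T b) b = (\<Sum>s\<in>S. \<phi> s b * ?c (T (v s)) b)" if b: "b \<in> B" for b
  proof -
    have bV: "b \<in> carrier V" using b B by blast
    have "?c (T b) b = ?c (T (lincomb (rep b) ?B0)) b" by (simp add: lin_rep[OF bV])
    also have "\<dots> = (\<Sum>x\<in>?B0. rep b x * ?c (T x) b)"
      by (rule functional_lincomb[OF V B0]) (use T T_add T_smult c_add c_smult b in auto)
    also have "\<dots> = (\<Sum>s\<in>S. \<phi> s b * ?c (T (v s)) b)"
      by (simp add: sum.reindex[OF inj] rep_v)
    finally show ?thesis .
  qed
  have "lin_trace V T = (\<Sum>b\<in>B. ?c (T b) b)" by (simp add: lin_trace_def B_def Let_def)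
  also have "\<dots> = (\<Sum>s\<in>S. \<Sum>b\<in>B. ?c (T (v s)) b * \<phi> s b)"
    by (subst sum.swap) (simp add: Tb mult.commute)
  also have "\<dots> = (\<Sum>s\<in>S. \<phi> s (T (v s)))"
  proof (rule sum.cong[OF refl])
    fix s assume s: "s \<in> S"
    have "\<phi> s (lincomb (?c (T (v s))) B) = (\<Sum>b\<in>B. ?c (T (v s)) b * \<phi> s b)"
      by (rule functional_lincomb[OF V B(1,3)]) (use s \<phi>_add \<phi>_smult in auto)
    then show "(\<Sum>b\<in>B. ?c (T (v s)) b * \<phi> s b) = \<phi> s (T (v s))" using c(2) T v s by simp
  qed
  finally show ?thesis using dim by blast
qed

section \<open>Characters of the coinvariant algebra\<close>

lemma signed_perms_inverse:
  assumes "w \<in> signed_perms n"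
  shows "inv_into UNIV w \<in> signed_perms n"
proof -
  note p = signed_perms_permutes[OF assms]
  have "inv_into UNIV w (- a) = - inv_into UNIV w a" for a
  proof -
    have "w (- inv_into UNIV w a) = - a"
      by (simp add: signed_perms_uminus[OF assms] permutes_inverses(1)[OF p])
    then show ?thesis using permutes_inverses(2)[OF p] by metis
  qed
  then show ?thesis using permutes_inv[OF p] by (simp add: signed_perms_def)
qed

context diag
begin

text \<open>By multiplicativity the \<open>x_i^A\<close> suffice. There the sign of w' at i is
  picked up twice, once from each of w and w', and cancels.\<close>

lemma diag_act_inverse:
  fixes p :: "('k::field) diag_poly"
  assumes w: "w \<in> signed_perms n" and w': "w' \<in> signed_perms n" and inv: "\<And>a. w (w' a) = a"
    and p: "p \<in> diag_polys n r"
  shows "diag_act w (diag_act w' p) = p"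
proof -
  have blk: "diag_act w (diag_act w' (mon (blk i A))) = (mon (blk i A) :: 'k diag_poly)" if i: "i \<in> {1..n}" for i A
  proof -
    define b where "b = int (perm_of w' i)"
    have sg: "sgn (w' (int i)) \<in> {1, -1}" by (rule perm_of_neq_0(2)[OF w' i])
    have w'i: "w' (int i) = sgn (w' (int i)) * b" unfolding b_def by (rule signed_perm_decomp)
    have wb: "w b = sgn (w' (int i)) * int i"
    proof (cases "sgn (w' (int i)) = 1")
      case True then show ?thesis using inv[of "int i"] w'i by simp
    next
      case False
      then have "sgn (w' (int i)) = -1" using sg by blast
      then show ?thesis using inv[of "int i"] w'i signed_perms_uminus[OF w, of b] by simp
    qed
    have "perm_of w (perm_of w' i) = i" using wb sg by (auto simp: perm_of_def[of w] b_def)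
    moreover have "sgn (w b) = sgn (w' (int i))" using wb sg i by (auto simp: sgn_mult)
    moreover have "(of_int (sgn (w' (int i))) :: 'k) ^ a * of_int (sgn (w' (int i))) ^ a = 1" for a
      using sg by (auto simp: power_mult_distrib[symmetric])
    ultimately show ?thesis
      by (simp add: diag_act_single act_mon_blk act_sgn_blk b_def)
  qed
  have blks: "diag_act w (diag_act w' (mon (\<Sum>i\<in>S. blk i (f i)))) = (mon (\<Sum>i\<in>S. blk i (f i)) :: 'k diag_poly)"
    if "finite S" "S \<subseteq> {1..n}" for S f
    using that
  proof (induction S rule: finite_induct)
    case (insert i S)
    have "mon (\<Sum>i\<in>insert i S. blk i (f i)) = mon (blk i (f i)) * (mon (\<Sum>i\<in>S. blk i (f i)) :: 'k diag_poly)"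
      using insert by (simp add: mult_single)
    then show ?case using insert blk[of i "f i"] by (simp add: diag_act_mult)
  qed simp
  have mon: "diag_act w (diag_act w' (mon m)) = (mon m :: 'k diag_poly)" if "m \<in> mons" for m
    using blks[of "{1..n}" "row m"] mons_as_blks[OF that] by simp
  show ?thesis
  proof (rule diag_polys_as_comb[OF p])
    assume k: "keys p \<subseteq> mons"
      and pp: "p = (\<Sum>m\<in>keys p. mpol_const (lookup p m) * mon m)"
    have "diag_act w (diag_act w' p) =
        (\<Sum>m\<in>keys p. mpol_const (lookup p m) * diag_act w (diag_act w' (mon m)))"
      by (subst pp) (simp only: diag_act_sum diag_act_scale)
    also have "\<dots> = (\<Sum>m\<in>keys p. mpol_const (lookup p m) * mon m)"
      using k by (intro sum.cong refl) (simp add: mon subset_iff)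
    also have "\<dots> = p" by (rule pp[symmetric])
    finally show ?thesis .
  qed
qed

lemma diag_act_diag_polys:
  assumes w: "w \<in> signed_perms n" and p: "p \<in> diag_polys n r"
  shows "diag_act w p \<in> (diag_polys n r :: ('k::field) diag_poly set)"
proof (rule diag_polys_as_comb[OF p])
  assume k: "keys p \<subseteq> mons"
    and pp: "p = (\<Sum>m\<in>keys p. mpol_const (lookup p m) * mon m)"
  show ?thesis
    by (subst pp, unfold diag_act_sum diag_act_scale,
        rule mpv.subspace_sum[OF diag_polys_subspace], rule mpv.subspace_scale[OF diag_polys_subspace])
       (use k act_mon_in_mons[OF w] in \<open>auto simp: diag_act_single\<close>)
qed

lemma diag_act_id:
  assumes "m \<in> mons"
  shows "diag_act id (mon m) = (mon m :: ('k::field) diag_poly)"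
proof -
  have "id \<in> signed_perms n" using id_weyl_group weyl_group_signed by blast
  then have "act_mon id m = m"
    using act_mon_mons[of id m] mons_as_blks[OF assms] assms by (simp add: perm_of_def)
  moreover have "act_sgn id m = (1 :: 'k)" unfolding act_sgn_mons[OF assms] by (intro prod.neutral) auto
  ultimately show ?thesis by (simp add: diag_act_single)
qed

end

context diag_weyl
begin

text \<open>The preimage of the ideal under w is an ideal containing the invariants. The hypothesis
  speaks of fixing invariants, not of membership in the group, so that it also covers the inverse of
  a group element.\<close>

lemma diag_act_coinv_subset:
  assumes w: "w \<in> signed_perms n"
    and fixed: "\<And>p :: ('k::field) diag_poly. p \<in> invariants_no_const W n r \<Longrightarrow> diag_act w p = p"
    and p: "p \<in> (coinv :: 'k diag_poly set)"
  shows "diag_act w p \<in> coinv"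
proof -
  interpret cring "diag_ring n r :: 'k diag_poly ring" by (rule diag_ring_cring)
  let ?S = "{p \<in> diag_polys n r. diag_act w p \<in> (coinv :: 'k diag_poly set)}"
  have "mpv.subspace ?S"
    by (rule mpv.subspaceI)
       (auto simp: diag_act_add diag_act_scale mpv.subspace_0[OF coinv_subspace]
          intro: diag_polys_add diag_polys_mult mpv.subspace_add[OF coinv_subspace] mpv.subspace_scale[OF coinv_subspace])
  then have "ideal ?S (diag_ring n r)"
    unfolding ideal_iff using diag_act_diag_polys[OF w]
    by (auto simp: diag_act_mult intro: diag_polys_mult coinv_mult)
  moreover have "invariants_no_const W n r \<subseteq> ?S"
  proof
    fix p :: "'k diag_poly" assume "p \<in> invariants_no_const W n r"
    then show "p \<in> ?S" using fixed[of p] invariant_in_coinv[of p] by (auto simp: invariants_no_const_def)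
  qed
  ultimately have "coinv \<subseteq> ?S" unfolding coinv_ideal_def by (rule genideal_minimal)
  then show ?thesis using p by blast
qed

text \<open>Inclusion would not do: the action on a coset is by taking the image, and this is a
  coset again only if w maps the ideal onto itself.\<close>

lemma diag_act_coinv_image:
  assumes w: "w \<in> weyl_group W n"
  shows "diag_act w ` coinv = (coinv :: ('k::field) diag_poly set)"
proof
  note ws = weyl_group_signed[OF w]
  let ?w = "inv_into UNIV w"
  note ws' = signed_perms_inverse[OF ws]
  have inv: "w (?w a) = a" "?w (w a) = a" for a
    using permutes_inverses[OF signed_perms_permutes[OF ws]] by auto
  have fixed: "diag_act w p = p" if "p \<in> invariants_no_const W n r" for p :: "'k diag_poly"
    using that w by (simp add: invariants_no_const_def)
  have fixed': "diag_act ?w p = p" if p: "p \<in> invariants_no_const W n r" for p :: "'k diag_poly"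
  proof -
    have "p \<in> diag_polys n r" using p by (simp add: invariants_no_const_def)
    then show ?thesis using diag_act_inverse[OF ws' ws, of p] inv fixed[OF p] by simp
  qed
  show "diag_act w ` coinv \<subseteq> (coinv :: 'k diag_poly set)"
    using diag_act_coinv_subset[OF ws fixed] by blast
  show "(coinv :: 'k diag_poly set) \<subseteq> diag_act w ` coinv"
  proof
    fix p :: "'k diag_poly" assume p: "p \<in> coinv"
    then have "p = diag_act w (diag_act ?w p)"
      using diag_act_inverse[OF ws ws', of p] inv coinv_subset by auto
    then show "p \<in> diag_act w ` coinv" using diag_act_coinv_subset[OF ws' fixed' p] by blast
  qed
qed

section \<open>Cosets of the ideal and the vector space structure of a component\<close>

abbreviation cls :: "('k::field) diag_poly \<Rightarrow> 'k diag_poly set" where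
  "cls \<equiv> coinv_class W n r"

lemma cls_eq: "cls p = (\<lambda>i. i + p) ` coinv"
  by (auto simp: coinv_class_def a_r_coset_def r_coset_def diag_ring_def)

lemma cls_eq_iff: "cls p = cls q \<longleftrightarrow> p - q \<in> (coinv :: ('k::field) diag_poly set)"
proof
  assume eq: "cls p = cls q"
  have "p \<in> cls p" using mpv.subspace_0[OF coinv_subspace] by (force simp: cls_eq)
  then have "p \<in> cls q" by (simp only: eq)
  then have "p \<in> (\<lambda>i. i + q) ` coinv" by (simp only: cls_eq)
  then show "p - q \<in> coinv" by (rule imageE) simp
next
  assume pq: "p - q \<in> coinv"
  have "i + p \<in> (\<lambda>i. i + q) ` coinv" if "i \<in> coinv" for i
    using mpv.subspace_add[OF coinv_subspace that pq] by (intro image_eqI[of _ _ "i + (p - q)"]) auto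
  moreover have "i + q \<in> (\<lambda>i. i + p) ` coinv" if "i \<in> coinv" for i
    using mpv.subspace_diff[OF coinv_subspace that pq] by (intro image_eqI[of _ _ "i - (p - q)"]) auto
  ultimately show "cls p = cls q" unfolding cls_eq by blast
qed

lemma diag_act_cls:
  assumes w: "w \<in> weyl_group W n"
  shows "diag_act w ` cls p = cls (diag_act w p)"
proof -
  have "diag_act w ` cls p = (\<lambda>i. i + diag_act w p) ` (diag_act w ` coinv)"
    unfolding cls_eq image_image diag_act_add ..
  then show ?thesis using diag_act_coinv_image[OF w, where 'k = 'a] by (simp add: cls_eq)
qed

lemma component_simps:
  fixes p q :: "('k::field) diag_poly"
  defines "V J \<equiv> coinv_component W n r J :: ('k, 'k diag_poly set) module"
  shows "carrier (V J) = cls ` multihomogeneous n r J"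
    and "p \<in> diag_polys n r \<Longrightarrow> q \<in> diag_polys n r \<Longrightarrow> cls p \<oplus>\<^bsub>V J\<^esub> cls q = cls (p + q)"
    and "p \<in> diag_polys n r \<Longrightarrow> c \<odot>\<^bsub>V J\<^esub> cls p = cls (mpol_const c * p)"
    and "\<zero>\<^bsub>V J\<^esub> = cls 0"
proof -
  interpret ideal "coinv :: 'k diag_poly set" "diag_ring n r" by (rule coinv_is_ideal)
  note defs = V_def coinv_component_def coinv_algebra_def Let_def ring.defs module.defs FactRing_def
  show "carrier (V J) = cls ` multihomogeneous n r J"
    by (simp add: defs)
  show "cls p \<oplus>\<^bsub>V J\<^esub> cls q = cls (p + q)" if "p \<in> diag_polys n r" "q \<in> diag_polys n r"
    using a_rcos_sum[of p q] that by (simp add: defs coinv_class_def)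
  show "c \<odot>\<^bsub>V J\<^esub> cls p = cls (mpol_const c * p)" if "p \<in> diag_polys n r"
    using rcoset_mult_add[of "mpol_const c" p] that by (simp add: defs coinv_class_def)
  show "\<zero>\<^bsub>V J\<^esub> = cls 0" by (simp add: defs cls_eq)
qed

lemma component_vectorspace:
  "vectorspace class_ring (coinv_component W n r J :: ('k::field, 'k diag_poly set) module)"
proof -
  let ?V = "coinv_component W n r J :: ('k, 'k diag_poly set) module"
  let ?H = "multihomogeneous n r J :: 'k diag_poly set"
  have H: "?H \<subseteq> diag_polys n r" "mpv.subspace ?H"
    unfolding multihomogeneous_eq by (rule hom_subset_diag_polys hom_subspace)+
  have add: "cls p \<oplus>\<^bsub>?V\<^esub> cls q = cls (p + q)" if "p \<in> ?H" "q \<in> ?H" for p q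
    using component_simps(2)[where p = p and q = q and J = J] H that by blast
  have smult: "c \<odot>\<^bsub>?V\<^esub> cls p = cls (mpol_const c * p)" if "p \<in> ?H" for c p
    using component_simps(3)[where p = p and c = c and J = J] H that by blast
  note [simp] = component_simps(1,4)
  note cl = mpv.subspace_add[OF H(2)] mpv.subspace_scale[OF H(2)] mpv.subspace_0[OF H(2)]
  have "abelian_group ?V"
  proof (rule abelian_groupI)
    fix x assume "x \<in> carrier ?V"
    then obtain p where p: "x = cls p" "p \<in> ?H" by auto
    have "- p \<in> ?H" by (rule mpv.subspace_neg[OF H(2) p(2)])
    then show "\<exists>y\<in>carrier ?V. y \<oplus>\<^bsub>?V\<^esub> x = \<zero>\<^bsub>?V\<^esub>"
      using p by (intro bexI[of _ "cls (- p)"]) (auto simp: add)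
  qed (auto simp: add cl algebra_simps)
  then have "Module.module class_ring ?V"
  proof (intro moduleI)
    show "cring (class_ring :: 'k ring)" by (rule class_cring.cring_axioms)
    fix a b :: 'k and x y assume "x \<in> carrier ?V" "y \<in> carrier ?V"
    then obtain p q where [simp]: "x = cls p" "p \<in> ?H" "y = cls q" "q \<in> ?H" by auto
    show "a \<odot>\<^bsub>?V\<^esub> x \<in> carrier ?V" by (simp add: smult cl)
    show "(a \<oplus>\<^bsub>class_ring\<^esub> b) \<odot>\<^bsub>?V\<^esub> x = a \<odot>\<^bsub>?V\<^esub> x \<oplus>\<^bsub>?V\<^esub> b \<odot>\<^bsub>?V\<^esub> x"
      by (simp add: smult add cl mpol_const_simps distrib_right)
    show "a \<odot>\<^bsub>?V\<^esub> (x \<oplus>\<^bsub>?V\<^esub> y) = a \<odot>\<^bsub>?V\<^esub> x \<oplus>\<^bsub>?V\<^esub> a \<odot>\<^bsub>?V\<^esub> y"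
      by (simp add: smult add cl distrib_left)
    show "(a \<otimes>\<^bsub>class_ring\<^esub> b) \<odot>\<^bsub>?V\<^esub> x = a \<odot>\<^bsub>?V\<^esub> (b \<odot>\<^bsub>?V\<^esub> x)"
    proof -
      have "mpol_const (a * b) * p = mpol_const a * (mpol_const b * p)"
        by (simp only: mpol_const_simps mult.assoc)
      then show ?thesis by (simp add: smult cl)
    qed
    show "\<one>\<^bsub>class_ring\<^esub> \<odot>\<^bsub>?V\<^esub> x = x" by (simp add: smult mpol_const_simps)
  qed assumption
  then show ?thesis by (simp add: vectorspace_def class_field)
qed

end

context diag_slots
begin

lemma psums_in_coinv:
  assumes "set_mset \<kappa> \<subseteq> inv_exps" "\<kappa> \<noteq> {#}"
  shows "(psums \<kappa> :: ('k::field) diag_poly) \<in> coinv"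
proof -
  obtain A \<kappa>' where \<kappa>: "\<kappa> = add_mset A \<kappa>'" using assms(2) by (cases \<kappa>) auto
  have "psums \<kappa>' * psum A \<in> (coinv :: 'k diag_poly set)"
    using assms psums_hom[of \<kappa>'] hom_subset_diag_polys
    by (intro coinv_mult psum_in_coinv) (auto simp: \<kappa>)
  then show ?thesis by (simp add: \<kappa> psums_def mult.commute)
qed

text \<open>The converse of \<open>cf_coinv\<close>: the terms with nonempty \<kappa> lie in the
  ideal. Together the two say that the coefficients with empty \<kappa> are coordinates on the
  quotient.\<close>

lemma coinv_cf_zero:
  assumes J: "J \<le> J0" and p: "p \<in> hom J"
    and zero: "\<And>b. ({#}, b) \<in> idx J \<Longrightarrow> cf J p ({#}, b) = 0"
  shows "p \<in> (coinv :: ('k::field_char_0) diag_poly set)"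
proof -
  have "(\<Sum>x\<in>idx J. mpol_const (cf J p x) * (fam x :: 'k diag_poly)) \<in> coinv"
  proof (rule mpv.subspace_sum[OF coinv_subspace])
    fix x assume x: "x \<in> idx J"
    obtain \<kappa> b where xx: "x = (\<kappa>, b)" by (cases x)
    show "mpol_const (cf J p x) * (fam x :: 'k diag_poly) \<in> coinv"
    proof (cases "\<kappa> = {#}")
      case True
      then show ?thesis using x zero[of b] mpv.subspace_0[OF coinv_subspace] by (simp add: xx mpol_const_simps)
    next
      case False
      have "mon b * psums \<kappa> \<in> (coinv :: 'k diag_poly set)"
        using x False by (intro coinv_mult psums_in_coinv) (auto simp: xx idx_def)
      then show ?thesis
        by (intro mpv.subspace_scale[OF coinv_subspace]) (simp add: xx fam_def mult.commute)
    qed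
  qed
  then show ?thesis using cf_expand[OF J p] by simp
qed

text \<open>The classes of standard monomials and the coefficients with empty \<kappa> form a dual
  system: \<open>cf_coinv\<close> makes the functionals well defined, \<open>cf_fam\<close> gives
  duality, and \<open>coinv_cf_zero\<close> shows that they separate cosets.\<close>

lemma character_and_dim:
  fixes J :: "nat \<Rightarrow> nat"
  defines "K \<equiv> (\<lambda>j. if j \<in> {1..r} then J j else 0)"
  assumes K: "K \<le> J0" and w: "w \<in> weyl_group W n"
  shows "coinv_character W n r J w = (chi K w :: 'k::field_char_0)"
    and "coinv_dim TYPE('k) W n r J = card {b \<in> mono_of K. standard b}"
proof -
  let ?V = "coinv_component W n r J :: ('k, 'k diag_poly set) module"
  let ?S = "{b \<in> mono_of K. standard b}"
  have H: "multihomogeneous n r J = hom K" unfolding K_def by (rule multihomogeneous_eq)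
  note simps = component_simps[where J = J, unfolded H]
  have hd: "p \<in> diag_polys n r" if "p \<in> hom K" for p :: "'k diag_poly"
    using hom_subset_diag_polys that by blast
  note cl = mpv.subspace_add[OF hom_subspace] mpv.subspace_scale[OF hom_subspace] diag_act_hom[OF weyl_group_signed[OF w]]
  \<comment> \<open>The coefficient of an arbitrarily chosen homogeneous representative of the
    coset.\<close>
  define \<phi> where "\<phi> b X = cf K (SOME p. p \<in> hom K \<and> X = cls p) ({#}, b)" for b and X :: "'k diag_poly set"
  have idx: "({#}, b) \<in> idx K \<longleftrightarrow> b \<in> ?S" for b by (auto simp: idx_def mono_of_def)
  have \<phi>: "\<phi> b (cls p) = cf K p ({#}, b)" if p: "p \<in> hom K" and b: "b \<in> ?S" for p b
  proof -
    define q where "q = (SOME q. q \<in> hom K \<and> cls p = cls q)"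
    have q: "q \<in> hom K \<and> cls p = cls q" unfolding q_def by (rule someI[of _ p]) (use p in simp)
    then have "p - q \<in> coinv \<inter> hom K" using mpv.subspace_diff[OF hom_subspace p] by (simp add: cls_eq_iff)
    then have "cf K (p - q) ({#}, b) = 0" by (rule cf_coinv[OF K]) (use b idx in blast)
    moreover have "cf K p ({#}, b) = cf K (p - q) ({#}, b) + cf K q ({#}, b)"
      using cf_add[OF K, of "p - q" q] q mpv.subspace_diff[OF hom_subspace p] by simp
    ultimately show ?thesis by (simp add: \<phi>_def q_def)
  qed
  have mh: "mon b \<in> (hom K :: 'k diag_poly set)" if "b \<in> ?S" for b using that by (intro mon_in_hom) simp
  have carr: "\<exists>p\<in>hom K. x = cls p" if "x \<in> carrier ?V" for x using that unfolding simps(1) by auto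
  let ?T = "\<lambda>A. diag_act w ` A :: 'k diag_poly set"
  have main: "lin_trace ?V ?T = (\<Sum>b\<in>?S. \<phi> b (?T (cls (mon b)))) \<and> vectorspace.dim class_ring ?V = card ?S"
  proof (rule dual_system_trace[OF component_vectorspace, where v = "\<lambda>b. cls (mon b)" and \<phi> = \<phi>])
    show "finite ?S" by simp
    show "cls (mon b) \<in> carrier ?V" if "b \<in> ?S" for b using mh[OF that] unfolding simps(1) by blast
    show "\<phi> s (cls (mon t)) = (if s = t then 1 else 0)" if s: "s \<in> ?S" and t: "t \<in> ?S" for s t
    proof -
      have "\<phi> s (cls (mon t)) = cf K (fam ({#}, t)) ({#}, s)"
        using \<phi>[OF mh[OF t] s] by (simp add: fam_def psums_def)
      also have "\<dots> = (if s = t then 1 else 0)" using cf_fam[OF K, of "({#}, s)" "({#}, t)"] idx s t by simp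
      finally show ?thesis .
    qed
    fix x y assume x: "x \<in> carrier ?V"
    obtain p where p: "p \<in> hom K" "x = cls p" using carr[OF x] by blast
    show "?T x \<in> carrier ?V" using p cl(3)[OF p(1)] unfolding simps(1) by (auto simp: diag_act_cls[OF w])
    show "\<phi> b (c \<odot>\<^bsub>?V\<^esub> x) = c * \<phi> b x" if "b \<in> ?S" for c b
      using that p cl(2)[OF p(1)] hd[OF p(1)] by (simp add: simps(3) \<phi> cf_scale[OF K])
    show "?T (c \<odot>\<^bsub>?V\<^esub> x) = c \<odot>\<^bsub>?V\<^esub> ?T x" for c
      using p hd[OF p(1)] hd[OF cl(3)[OF p(1)]] by (simp add: simps(3) diag_act_cls[OF w] diag_act_scale)
    assume y: "y \<in> carrier ?V"
    obtain q where q: "q \<in> hom K" "y = cls q" using carr[OF y] by blast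
    show "\<phi> b (x \<oplus>\<^bsub>?V\<^esub> y) = \<phi> b x + \<phi> b y" if "b \<in> ?S" for b
      using that p q hd cl(1)[OF p(1) q(1)] by (simp add: simps(2) \<phi> cf_add[OF K])
    show "?T (x \<oplus>\<^bsub>?V\<^esub> y) = ?T x \<oplus>\<^bsub>?V\<^esub> ?T y"
      using p q hd cl(3)[OF p(1)] cl(3)[OF q(1)] by (simp add: simps(2) diag_act_cls[OF w] diag_act_add)
    assume eq: "\<And>s. s \<in> ?S \<Longrightarrow> \<phi> s x = \<phi> s y"
    have d: "p - q \<in> hom K" by (rule mpv.subspace_diff[OF hom_subspace p(1) q(1)])
    have "p - q \<in> coinv"
    proof (rule coinv_cf_zero[OF K d])
      fix b assume "({#}, b) \<in> idx K"
      then have b: "b \<in> ?S" using idx by blast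
      have "cf K p ({#}, b) = cf K (p - q) ({#}, b) + cf K q ({#}, b)" using cf_add[OF K d q(1)] by simp
      then show "cf K (p - q) ({#}, b) = 0" using eq[OF b] p q b by (simp add: \<phi>)
    qed
    then show "x = y" using p q by (simp add: cls_eq_iff)
  qed
  have "(\<Sum>b\<in>?S. \<phi> b (?T (cls (mon b)))) = chi K w"
    unfolding chi_def by (intro sum.cong refl) (simp add: diag_act_cls[OF w] \<phi> cl(3)[OF mh])
  then show "coinv_character W n r J w = (chi K w :: 'k)" using main by (simp add: coinv_character_def)
  show "coinv_dim TYPE('k) W n r J = card ?S" using main by (simp add: coinv_dim_def)
qed

lemma chi_id:
  assumes K: "K \<le> J0"
  shows "chi K id = (of_nat (card {b \<in> mono_of K. standard b}) :: 'k::field_char_0)"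
proof -
  have "chi K id = (\<Sum>b | b \<in> mono_of K \<and> standard b. 1 :: 'k)"
    unfolding chi_def
  proof (rule sum.cong[OF refl])
    fix b assume b: "b \<in> {b. b \<in> mono_of K \<and> standard b}"
    then have "({#}, b) \<in> idx K" by (auto simp: idx_def mono_of_def)
    then show "cf K (diag_act id (mon b)) ({#}, b) = (1 :: 'k)"
      using b diag_act_id[of b, where 'k = 'k] cf_fam[OF K, of "({#}, b)" "({#}, b)", where 'k = 'k]
      by (simp add: mono_of_def fam_def psums_def)
  qed
  then show ?thesis by simp
qed

end

section \<open>Cycles of signed permutations\<close>

lemma card_uniform_fibers:
  assumes "finite A" "\<And>a. a \<in> A \<Longrightarrow> card {b \<in> A. f b = f a} = l"
  shows "card A = l * card (f ` A)"
proof -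
  have "card A = (\<Sum>c\<in>f ` A. \<Sum>b\<in>{b \<in> A. f b = c}. 1)"
    using sum.image_gen[OF assms(1), of "\<lambda>_. 1 :: nat" f] by simp
  also have "\<dots> = (\<Sum>c\<in>f ` A. l)"
    by (intro sum.cong refl) (use assms(2) in auto)
  finally show ?thesis by simp
qed

text \<open>The product of the signs along a cycle of the underlying permutation: 1 for a positive
  cycle, -1 for a negative one.\<close>

definition orbit_sign :: "(int \<Rightarrow> int) \<Rightarrow> nat \<Rightarrow> int" where
  "orbit_sign v i = (\<Prod>a\<in>orbit (perm_of v) i. sgn (v (int a)))"

context
  fixes n :: nat and w :: "int \<Rightarrow> int"
  assumes w: "w \<in> signed_perms n"
begin

lemma permutation_signed: "permutation w"
  using signed_perms_permutes[OF w] permutation_permutes by blast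

lemma permutation_perm_of: "permutation (perm_of w)"
  using perm_of_permutes[OF w] permutation_permutes by blast

lemma orbit_perm_of_subset: "i \<in> {1..n} \<Longrightarrow> orbit (perm_of w) i \<subseteq> {1..n}"
  by (rule permutes_orbit_subset[OF perm_of_permutes[OF w]])

lemma orbit_eq: "permutation f \<Longrightarrow> y \<in> orbit f x \<Longrightarrow> orbit f y = orbit f x"
  using cyclic_on_orbit'[of f x] orbit_cyclic_eq3 by metis

lemma nat_abs_funpow: "nat \<bar>(w ^^ k) a\<bar> = (perm_of w ^^ k) (nat \<bar>a\<bar>)"
proof (induction k)
  case (Suc k)
  have "nat \<bar>w x\<bar> = perm_of w (nat \<bar>x\<bar>)" for x
    by (simp add: perm_of_def signed_perms_abs[OF w])
  then show ?case using Suc by simp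
qed simp

lemma nat_abs_orbit: "(\<lambda>x. nat \<bar>x\<bar>) ` orbit w a = orbit (perm_of w) (nat \<bar>a\<bar>)"
  unfolding orbit_altdef_permutation[OF permutation_signed] orbit_altdef_permutation[OF permutation_perm_of]
  by (simp add: full_SetCompr_eq image_image nat_abs_funpow)

lemma orbit_uminus: "orbit w (- a) = uminus ` orbit w a"
proof -
  have "(w ^^ k) (- a) = - (w ^^ k) a" for k
    by (induction k) (simp_all add: signed_perms_uminus[OF w])
  then show ?thesis unfolding orbit_altdef_permutation[OF permutation_signed] by auto
qed

lemma finite_orbits: "finite (orbit w a)" "finite (orbit (perm_of w) i)"
  by (rule finite_orbit[OF permutation_self_in_orbit[OF permutation_signed]] finite_orbit[OF permutation_self_in_orbit[OF permutation_perm_of]])+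

text \<open>After one turn around the cycle of the underlying permutation, w is back at i up to the
  signs collected on the way.\<close>

lemma orbit_funpow_card: "(w ^^ card (orbit (perm_of w) i)) (int i) = orbit_sign w i * int i" if i: "i \<in> {1..n}"
proof -
  have sg: "sgn (w (int ((perm_of w ^^ m) i))) \<in> {1, -1}" for m
  proof -
    have "(perm_of w ^^ m) i \<in> {1..n}"
      using orbit_perm_of_subset[OF i] orbit_altdef_permutation[OF permutation_perm_of, of i] by auto
    then show ?thesis using perm_of_neq_0(2)[OF w] by blast
  qed
  have step: "(w ^^ k) (int i) = (\<Prod>m<k. sgn (w (int ((perm_of w ^^ m) i)))) * int ((perm_of w ^^ k) i) \<and>
      (\<Prod>m<k. sgn (w (int ((perm_of w ^^ m) i)))) \<in> {1, -1}" for k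
  proof (induction k)
    case (Suc k)
    let ?E = "\<Prod>m<k. sgn (w (int ((perm_of w ^^ m) i)))" and ?b = "int ((perm_of w ^^ k) i)"
    have "w (?E * ?b) = ?E * w ?b" using Suc signed_perms_uminus[OF w, of ?b] by auto
    also have "\<dots> = ?E * (sgn (w ?b) * int (perm_of w ((perm_of w ^^ k) i)))" by (subst (1) signed_perm_decomp) simp
    finally have "w ((w ^^ k) (int i)) = ?E * sgn (w ?b) * int (perm_of w ((perm_of w ^^ k) i))"
      using Suc by (simp only: mult.assoc)
    moreover have "?E * sgn (w ?b) \<in> {1, -1}" using Suc sg[of k] by auto
    ultimately show ?case by simp
  qed simp
  \<comment> \<open>The number of steps of the first return to i, which is the length of the
    cycle.\<close>
  let ?D = "funpow_dist1 (perm_of w) i i"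
  have self: "i \<in> orbit (perm_of w) i" by (rule permutation_self_in_orbit[OF permutation_perm_of])
  note orb = orbit_conv_funpow_dist1[OF self] and inj = inj_on_funpow_dist1[OF self]
  have card: "card (orbit (perm_of w) i) = ?D" by (subst orb) (simp add: card_image[OF inj])
  have "(\<Prod>m<?D. sgn (w (int ((perm_of w ^^ m) i)))) = orbit_sign w i"
    by (simp only: orbit_sign_def orb atLeast0LessThan[symmetric] prod.reindex[OF inj] o_def)
  moreover have "(perm_of w ^^ ?D) i = i" by (rule funpow_dist1_prop[OF self])
  ultimately show ?thesis using step[of ?D] card by simp
qed

lemma orbit_sign_cases:
  assumes "i \<in> {1..n}"
  shows "orbit_sign w i \<in> {1, -1}"
proof -
  have "finite S \<Longrightarrow> S \<subseteq> {1..n} \<Longrightarrow> (\<Prod>a\<in>S. sgn (w (int a))) \<in> {1, -1}" for S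
  proof (induction S rule: finite_induct)
    case (insert a S)
    then show ?case using perm_of_neq_0(2)[OF w, of a] by auto
  qed simp
  then show ?thesis unfolding orbit_sign_def using orbit_perm_of_subset[OF assms] finite_orbits(2) by blast
qed

lemma card_orbit_pos: "card (orbit (perm_of w) i) > 0"
  using finite_orbits(2) orbit_nonempty[of "perm_of w" i] by (simp add: card_gt_0_iff)

lemma self_in_w_orbit: "a \<in> orbit w a"
  by (rule permutation_self_in_orbit[OF permutation_signed])

text \<open>One turn leads back to i, so the orbit is no longer than the cycle of the underlying
  permutation. The absolute value maps it onto that cycle, hence bijectively.\<close>

lemma positive_orbit:
  assumes i: "i \<in> {1..n}" and "orbit_sign w i = 1"
  shows "inj_on abs (orbit w (int i))" "card (orbit w (int i)) = card (orbit (perm_of w) i)"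
proof -
  let ?L = "card (orbit (perm_of w) i)" and ?O = "orbit w (int i)"
  have "?O = {(w ^^ m) (int i) | m. m < ?L}"
    using orbit_funpow_card[OF i] assms(2) card_orbit_pos by (intro orbit_altdef_bounded) auto
  also have "\<dots> = (\<lambda>m. (w ^^ m) (int i)) ` {..<?L}" by auto
  finally have "card ?O \<le> ?L" using card_image_le[of "{..<?L}" "\<lambda>m. (w ^^ m) (int i)"] by simp
  moreover have im: "card ((\<lambda>x. nat \<bar>x\<bar>) ` ?O) = ?L" by (simp add: nat_abs_orbit)
  moreover have "card ((\<lambda>x. nat \<bar>x\<bar>) ` ?O) \<le> card ?O" by (rule card_image_le[OF finite_orbits(1)])
  ultimately show eq: "card ?O = ?L" by simp
  have "inj_on (\<lambda>x. nat \<bar>x\<bar>) ?O"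
    by (rule eq_card_imp_inj_on[OF finite_orbits(1)]) (simp only: im eq)
  then show "inj_on abs ?O" by (auto simp: inj_on_def)
qed

lemma orbit_nonzero:
  assumes "a \<in> {- int n..int n} - {0}" "x \<in> orbit w a"
  shows "x \<in> {- int n..int n} - {0}"
  using permutes_orbit_subset[OF signed_perms_permutes[OF w] assms(1)] assms(2) by blast

lemma card_symmetric_orbit:
  assumes "a \<in> {- int n..int n} - {0}" "uminus ` orbit w a = orbit w a"
  shows "card (orbit w a) = 2 * card {x \<in> orbit w a. x > 0}"
proof -
  let ?O = "orbit w a" and ?P = "{x \<in> orbit w a. x > 0}"
  have un: "?O = ?P \<union> uminus ` ?P"
  proof (intro equalityI subsetI)
    fix x assume x: "x \<in> ?O"
    then have "x \<noteq> 0" using orbit_nonzero[OF assms(1)] by blast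
    moreover have "- x \<in> ?O" using x assms(2) by blast
    ultimately show "x \<in> ?P \<union> uminus ` ?P" using x by (cases "x > 0") (auto intro: image_eqI[of _ _ "- x"])
  qed (use assms(2) in blast)+
  have "card ?O = card ?P + card (uminus ` ?P)"
    by (subst (1) un, rule card_Un_disjoint) (use finite_orbits(1)[of a] in auto)
  also have "card (uminus ` ?P) = card ?P" by (rule card_image) auto
  finally show ?thesis by simp
qed

text \<open>One turn leads to -i, so the orbit is symmetric, and its positive half is the cycle of
  the underlying permutation.\<close>

lemma negative_orbit:
  assumes i: "i \<in> {1..n}" and "orbit_sign w i = -1"
  shows "uminus ` orbit w (int i) = orbit w (int i)" "card (orbit w (int i)) = 2 * card (orbit (perm_of w) i)"
proof -
  let ?O = "orbit w (int i)"
  have "(w ^^ card (orbit (perm_of w) i)) (int i) = - int i" using orbit_funpow_card[OF i] assms(2) by simp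
  then have "- int i \<in> ?O" unfolding orbit_altdef_permutation[OF permutation_signed] by (metis (mono_tags, lifting) mem_Collect_eq)
  from orbit_eq[OF permutation_signed this] show sym: "uminus ` ?O = ?O" by (simp add: orbit_uminus)
  have ia: "int i \<in> {- int n..int n} - {0}" using i by auto
  have "(\<lambda>x. nat \<bar>x\<bar>) ` {x \<in> ?O. x > 0} = (\<lambda>x. nat \<bar>x\<bar>) ` ?O"
  proof (intro equalityI subsetI)
    fix y assume "y \<in> (\<lambda>x. nat \<bar>x\<bar>) ` ?O"
    then obtain x where x: "x \<in> ?O" "y = nat \<bar>x\<bar>" by blast
    then have "x \<noteq> 0" using orbit_nonzero[OF ia] by blast
    moreover have "- x \<in> ?O" using x sym by blast
    ultimately have "\<bar>x\<bar> \<in> {x \<in> ?O. x > 0}" using x by (auto simp: abs_if)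
    then show "y \<in> (\<lambda>x. nat \<bar>x\<bar>) ` {x \<in> ?O. x > 0}" using x by (intro image_eqI[of _ _ "\<bar>x\<bar>"]) auto
  qed blast
  moreover have "inj_on (\<lambda>x. nat \<bar>x\<bar>) {x \<in> ?O. x > 0}" by (auto simp: inj_on_def)
  moreover have "(\<lambda>x. nat \<bar>x\<bar>) ` ?O = orbit (perm_of w) i" using nat_abs_orbit[of "int i"] by simp
  ultimately have "card {x \<in> ?O. x > 0} = card (orbit (perm_of w) i)"
    using card_image[of "\<lambda>x. nat \<bar>x\<bar>" "{x \<in> ?O. x > 0}"] by simp
  then show "card ?O = 2 * card (orbit (perm_of w) i)" using card_symmetric_orbit[OF ia sym] by simp
qed

lemma not_positive_and_negative:
  assumes "i \<in> {1..n}" "uminus ` orbit w (int i) = orbit w (int i)"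
  shows "\<not> inj_on abs (orbit w (int i))"
proof
  assume inj: "inj_on abs (orbit w (int i))"
  have "int i \<in> orbit w (int i)" by (rule self_in_w_orbit)
  moreover have "- int i \<in> orbit w (int i)" using assms(2) self_in_w_orbit[of "int i"] by blast
  ultimately have "int i = - int i" using inj_onD[OF inj, of "int i" "- int i"] by simp
  then show False using assms(1) by simp
qed

text \<open>Traces are sums over indices, whereas character polynomials count cycles. A positive
  l-cycle is a pair of opposite orbits; the absolute values of either are the l indices that belong
  to it.\<close>

lemma card_positive_indices:
  "card {i \<in> {1..n}. card (orbit (perm_of w) i) = l \<and> orbit_sign w i = 1} = l * card (pos_cycles n w l)"
proof -
  let ?A = "{i \<in> {1..n}. card (orbit w (int i)) = l \<and> inj_on abs (orbit w (int i))}"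
  let ?f = "\<lambda>i. {orbit w (int i), uminus ` orbit w (int i)}"
  have uu: "uminus ` uminus ` X = X" for X :: "int set" by (simp add: image_image)
  have A: "{i \<in> {1..n}. card (orbit (perm_of w) i) = l \<and> orbit_sign w i = 1} = ?A"
    using positive_orbit negative_orbit(1) not_positive_and_negative orbit_sign_cases by fastforce
  have "?f ` ?A = pos_cycles n w l"
  proof (intro equalityI subsetI)
    fix c assume "c \<in> ?f ` ?A"
    then obtain i where "i \<in> ?A" "c = ?f i" by blast
    then show "c \<in> pos_cycles n w l" unfolding pos_cycles_def by (auto intro!: exI[of _ "int i"])
  next
    fix c assume "c \<in> pos_cycles n w l"
    then obtain a where a: "a \<in> {- int n..int n} - {0}" "card (orbit w a) = l" "inj_on abs (orbit w a)"
      and c: "c = {orbit w a, uminus ` orbit w a}" unfolding pos_cycles_def by blast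
    show "c \<in> ?f ` ?A"
    proof (cases "a > 0")
      case True
      then show ?thesis using a c by (intro image_eqI[of _ _ "nat a"]) auto
    next
      case False
      have "card (uminus ` orbit w a) = l" using a(2) by (subst card_image) auto
      moreover have "inj_on abs (uminus ` orbit w a)" using a(3) by (auto simp: inj_on_def)
      moreover have "int (nat (- a)) = - a" using False by simp
      ultimately show ?thesis using a c False
        by (intro image_eqI[of _ _ "nat (- a)"]) (auto simp: orbit_uminus image_image insert_commute)
    qed
  qed
  moreover have "card {i' \<in> ?A. ?f i' = ?f i} = l" if i: "i \<in> ?A" for i
  proof -
    let ?O = "orbit w (int i)"
    have ia: "int i \<in> {- int n..int n} - {0}" using i by auto
    have "{i' \<in> ?A. ?f i' = ?f i} = (\<lambda>x. nat \<bar>x\<bar>) ` ?O"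
    proof (intro equalityI subsetI)
      fix i' assume "i' \<in> {i' \<in> ?A. ?f i' = ?f i}"
      then have "orbit w (int i') = ?O \<or> orbit w (int i') = uminus ` ?O" by (auto simp: doubleton_eq_iff)
      then have "int i' \<in> ?O \<or> - int i' \<in> ?O" using self_in_w_orbit[of "int i'"] by (auto simp: image_iff)
      then show "i' \<in> (\<lambda>x. nat \<bar>x\<bar>) ` ?O" by (force simp: image_iff)
    next
      fix i' assume "i' \<in> (\<lambda>x. nat \<bar>x\<bar>) ` ?O"
      then obtain x where x: "x \<in> ?O" "i' = nat \<bar>x\<bar>" by blast
      have xa: "x \<in> {- int n..int n} - {0}" by (rule orbit_nonzero[OF ia x(1)])
      then have i': "i' \<in> {1..n}" using x by auto
      have ox: "orbit w x = ?O" by (rule orbit_eq[OF permutation_signed x(1)])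
      have "int i' = x \<or> int i' = - x" using x by auto
      then have "orbit w (int i') = ?O \<or> orbit w (int i') = uminus ` ?O" using ox orbit_uminus[of x] by auto
      moreover have "card (uminus ` ?O) = l" using i by (subst card_image) auto
      moreover have "inj_on abs (uminus ` ?O)" using i by (auto simp: inj_on_def)
      ultimately show "i' \<in> {i' \<in> ?A. ?f i' = ?f i}" using i i' uu by auto
    qed
    moreover have "inj_on (\<lambda>x. nat \<bar>x\<bar>) ?O" using i by (auto simp: inj_on_def)
    ultimately show ?thesis using i by (simp add: card_image)
  qed
  ultimately show ?thesis using card_uniform_fibers[of ?A ?f l] A by simp
qed

text \<open>A symmetric orbit with 2l elements has l positive ones, and these are the indices
  belonging to it.\<close>

lemma card_negative_indices:
  "card {i \<in> {1..n}. card (orbit (perm_of w) i) = l \<and> orbit_sign w i = -1} = l * card (neg_cycles n w l)"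
proof -
  let ?A = "{i \<in> {1..n}. card (orbit w (int i)) = 2 * l \<and> uminus ` orbit w (int i) = orbit w (int i)}"
  let ?f = "\<lambda>i. orbit w (int i)"
  have A: "{i \<in> {1..n}. card (orbit (perm_of w) i) = l \<and> orbit_sign w i = -1} = ?A"
    using positive_orbit(1) negative_orbit not_positive_and_negative orbit_sign_cases by fastforce
  have "?f ` ?A = neg_cycles n w l"
  proof (intro equalityI subsetI)
    fix c assume "c \<in> ?f ` ?A"
    then obtain i where "i \<in> ?A" "c = ?f i" by blast
    then show "c \<in> neg_cycles n w l" unfolding neg_cycles_def by (auto intro!: exI[of _ "int i"])
  next
    fix c assume "c \<in> neg_cycles n w l"
    then obtain a where a: "a \<in> {- int n..int n} - {0}" "card (orbit w a) = 2 * l" "uminus ` orbit w a = orbit w a"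
      and c: "c = orbit w a" unfolding neg_cycles_def by blast
    have "orbit w \<bar>a\<bar> = orbit w a" using a(3) orbit_uminus[of a] by (cases "a > 0") auto
    then show "c \<in> ?f ` ?A" using a c by (intro image_eqI[of _ _ "nat \<bar>a\<bar>"]) auto
  qed
  moreover have "card {i' \<in> ?A. ?f i' = ?f i} = l" if i: "i \<in> ?A" for i
  proof -
    let ?O = "orbit w (int i)"
    have ia: "int i \<in> {- int n..int n} - {0}" using i by auto
    have "{i' \<in> ?A. ?f i' = ?f i} = nat ` {x \<in> ?O. x > 0}"
    proof (intro equalityI subsetI)
      fix i' assume "i' \<in> {i' \<in> ?A. ?f i' = ?f i}"
      then have "int i' \<in> {x \<in> ?O. x > 0}" using self_in_w_orbit[of "int i'"] by auto
      then show "i' \<in> nat ` {x \<in> ?O. x > 0}" by force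
    next
      fix i' assume "i' \<in> nat ` {x \<in> ?O. x > 0}"
      then have x: "int i' \<in> ?O" "i' > 0" by auto
      have "i' \<in> {1..n}" using orbit_nonzero[OF ia x(1)] x(2) by auto
      then show "i' \<in> {i' \<in> ?A. ?f i' = ?f i}" using orbit_eq[OF permutation_signed x(1)] i by simp
    qed
    moreover have "inj_on nat {x \<in> ?O. x > 0}" by (auto simp: inj_on_def)
    ultimately show ?thesis using card_symmetric_orbit[OF ia] i by (simp add: card_image)
  qed
  ultimately show ?thesis using card_uniform_fibers[of ?A ?f l] A by simp
qed

text \<open>Here w preserves the positive integers, so the orbit of an index consists of indices and
  is itself a cycle.\<close>

lemma card_indices_TypeS:
  assumes wS: "w \<in> weyl_group TypeS n"
  shows "card {i \<in> {1..n}. card (orbit (perm_of w) i) = l} = l * card (perm_cycles n w l)"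
    and "i \<in> {1..n} \<Longrightarrow> orbit_sign w i = 1"
proof -
  show sg: "orbit_sign w i = 1" if "i \<in> {1..n}" for i
    unfolding orbit_sign_def
    by (rule prod.neutral) (use weyl_group_TypeS_sgn[OF wS] orbit_perm_of_subset[OF that] in auto)
  let ?A = "{i \<in> {1..n}. card (orbit w (int i)) = l}"
  let ?f = "\<lambda>i. orbit w (int i)"
  have A: "{i \<in> {1..n}. card (orbit (perm_of w) i) = l} = ?A" using positive_orbit(2)[OF _ sg] by auto
  have "?f ` ?A = perm_cycles n w l"
  proof (intro equalityI subsetI)
    fix c assume "c \<in> perm_cycles n w l"
    then obtain a where "a \<in> {1..int n}" "card (orbit w a) = l" "c = orbit w a" by (auto simp: perm_cycles_def)
    then show "c \<in> ?f ` ?A" by (intro image_eqI[of _ _ "nat a"]) auto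
  qed (auto simp: perm_cycles_def)
  moreover have "card {i' \<in> ?A. ?f i' = ?f i} = l" if i: "i \<in> ?A" for i
  proof -
    let ?O = "orbit w (int i)"
    have sub: "?O \<subseteq> {1..int n}"
    proof
      fix x assume "x \<in> ?O"
      then show "x \<in> {1..int n}" by induction (use i wS in auto)
    qed
    have "{i' \<in> ?A. ?f i' = ?f i} = nat ` ?O"
    proof (intro equalityI subsetI)
      fix i' assume "i' \<in> {i' \<in> ?A. ?f i' = ?f i}"
      then have "int i' \<in> ?O" using self_in_w_orbit[of "int i'"] by auto
      then show "i' \<in> nat ` ?O" by force
    next
      fix i' assume "i' \<in> nat ` ?O"
      then obtain x where x: "x \<in> ?O" "i' = nat x" by blast
      moreover have "x \<in> {1..int n}" using sub x by blast
      ultimately have "int i' \<in> ?O" "i' \<in> {1..n}" by auto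
      then show "i' \<in> {i' \<in> ?A. ?f i' = ?f i}" using orbit_eq[OF permutation_signed, of "int i'"] i by simp
    qed
    moreover have "inj_on nat ?O" using sub by (auto simp: inj_on_def subset_iff)
    ultimately show ?thesis using i by (simp add: card_image)
  qed
  ultimately show "card {i \<in> {1..n}. card (orbit (perm_of w) i) = l} = l * card (perm_cycles n w l)"
    using card_uniform_fibers[of ?A ?f l] A by simp
qed

end

lemma cycle_count_indices:
  assumes w: "w \<in> weyl_group W n"
  shows "card {i \<in> {1..n}. card (orbit (perm_of w) i) = l \<and> orbit_sign w i = 1} = l * cycle_count W n w (PosCyc l)"
    and "card {i \<in> {1..n}. card (orbit (perm_of w) i) = l \<and> orbit_sign w i = -1} = l * cycle_count W n w (NegCyc l)"
proof -
  note ws = weyl_group_signed[OF w]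
  show "card {i \<in> {1..n}. card (orbit (perm_of w) i) = l \<and> orbit_sign w i = 1} = l * cycle_count W n w (PosCyc l)"
  proof (cases "W = TypeS")
    case True
    have "{i \<in> {1..n}. card (orbit (perm_of w) i) = l \<and> orbit_sign w i = 1} =
        {i \<in> {1..n}. card (orbit (perm_of w) i) = l}"
      using card_indices_TypeS(2)[OF ws] w True by auto
    then show ?thesis using card_indices_TypeS(1)[OF ws] w True by simp
  next
    case False
    then show ?thesis using card_positive_indices[OF ws, of l] by (cases W) simp_all
  qed
  show "card {i \<in> {1..n}. card (orbit (perm_of w) i) = l \<and> orbit_sign w i = -1} = l * cycle_count W n w (NegCyc l)"
  proof (cases "W = TypeS")
    case True
    have "{i \<in> {1..n}. card (orbit (perm_of w) i) = l \<and> orbit_sign w i = -1} = {}"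
      using card_indices_TypeS(2)[OF ws] w True by fastforce
    then show ?thesis using True by (simp del: Collect_empty_eq)
  next
    case False
    then show ?thesis using card_negative_indices[OF ws, of l] by (cases W) simp_all
  qed
qed

lemma cycle_count_id: "cycle_count W n id v = (if v = PosCyc 1 then n else 0)"
proof -
  have orb: "orbit id a = {a}" for a :: int by (simp add: orbit_eq_singleton_iff)
  have 1: "perm_cycles n id i = (if i = 1 then (\<lambda>a. {a}) ` {1..int n} else {})" for i
    by (auto simp: perm_cycles_def orb)
  have 2: "pos_cycles n id i = (if i = 1 then (\<lambda>a. {{a}, {- a}}) ` {1..int n} else {})" for i
  proof (cases "i = 1")
    case True
    have "pos_cycles n id 1 = (\<lambda>a. {{a}, {- a}}) ` ({- int n..int n} - {0})"
      by (auto simp: pos_cycles_def orb)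
    also have "\<dots> = (\<lambda>a. {{a}, {- a}}) ` {1..int n}"
    proof (intro equalityI subsetI)
      fix c assume "c \<in> (\<lambda>a. {{a}, {- a}}) ` ({- int n..int n} - {0})"
      then obtain a where a: "a \<in> {- int n..int n} - {0}" "c = {{a}, {- a}}" by blast
      then show "c \<in> (\<lambda>a. {{a}, {- a}}) ` {1..int n}"
        by (cases "a > 0") (auto intro: image_eqI[of _ _ a] image_eqI[of _ _ "- a"])
    qed auto
    finally show ?thesis using True by simp
  qed (auto simp: pos_cycles_def orb)
  have 3: "neg_cycles n id i = {}" for i by (auto simp: neg_cycles_def orb)
  have "inj_on (\<lambda>a. {{a}, {- a}}) {1..int n}" by (auto simp: inj_on_def doubleton_eq_iff)
  then have "card ((\<lambda>a. {{a}, {- a}}) ` {1..int n}) = n" by (simp add: card_image)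
  moreover have "card ((\<lambda>a. {a}) ` {1..int n}) = n" by (simp add: card_image)
  ultimately show ?thesis by (cases W; cases v) (simp_all add: 1 2 3)
qed

section \<open>Character polynomials of the symmetric powers\<close>

definition unit_vec :: "nat \<Rightarrow> nat \<Rightarrow> nat \<Rightarrow> nat" where
  "unit_vec j t = (\<lambda>l. if l = j then t else 0)"

text \<open>The trace of the t-th power of w on \<open>V_n\<close>: an index contributes if its
  cycle length divides t, with the cycle sign to the number of turns made.\<close>

definition orbit_power_sum :: "nat \<Rightarrow> (int \<Rightarrow> int) \<Rightarrow> nat \<Rightarrow> 'k::field_char_0" where
  "orbit_power_sum n w t = (\<Sum>i | i \<in> {1..n} \<and> card (orbit (perm_of w) i) dvd t.
     of_int (orbit_sign w i) ^ (t div card (orbit (perm_of w) i)))"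

context diag
begin

definition sym_trace :: "(nat \<Rightarrow> nat) \<Rightarrow> (int \<Rightarrow> int) \<Rightarrow> 'k::field_char_0" where
  "sym_trace J w = (\<Sum>m\<in>mono_of J. lookup (diag_act w (mon m)) m)"

definition fixed_mons :: "(nat \<Rightarrow> nat) \<Rightarrow> (int \<Rightarrow> int) \<Rightarrow> (nat \<times> nat \<Rightarrow>\<^sub>0 nat) set" where
  "fixed_mons J w = {m \<in> mono_of J. act_mon w m = m}"

text \<open>The k-th power of the product of the variables (a, j) with a on the cycle of i; w fixes
  this monomial up to sign.\<close>

definition orbit_mon :: "(int \<Rightarrow> int) \<Rightarrow> nat \<Rightarrow> nat \<Rightarrow> nat \<Rightarrow> (nat \<times> nat \<Rightarrow>\<^sub>0 nat)" where
  "orbit_mon w i j k = (\<Sum>a\<in>orbit (perm_of w) i. blk a (unit_vec j k))"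

lemma finite_fixed_mons [simp]: "finite (fixed_mons J w)"
  by (simp add: fixed_mons_def)

lemma sym_trace_fixed: "sym_trace J w = (\<Sum>m\<in>fixed_mons J w. act_sgn w m :: 'k::field_char_0)"
proof -
  have "sym_trace J w = (\<Sum>m\<in>mono_of J. if act_mon w m = m then act_sgn w m else 0 :: 'k)"
    unfolding sym_trace_def by (intro sum.cong refl) (simp add: diag_act_single lookup_single when_def)
  also have "\<dots> = (\<Sum>m\<in>fixed_mons J w. act_sgn w m)"
    unfolding fixed_mons_def by (rule sum.inter_filter[symmetric]) simp
  finally show ?thesis .
qed

lemma unit_vec_vecs: "j \<in> {1..r} \<Longrightarrow> unit_vec j k \<in> vecs"
  by (auto simp: unit_vec_def vecs_def)

lemma tot_unit_vec: "j \<in> {1..r} \<Longrightarrow> tot (unit_vec j k) = k"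
  by (simp add: unit_vec_def tot_def)

context
  fixes w assumes w: "w \<in> signed_perms n"
begin

lemma act_mon_fixed_iff:
  assumes m: "m \<in> mons"
  shows "act_mon w m = m \<longleftrightarrow> (\<forall>i\<in>{1..n}. row m (perm_of w i) = row m i)"
proof
  assume "act_mon w m = m"
  then show "\<forall>i\<in>{1..n}. row m (perm_of w i) = row m i" using row_act_mon[OF w m] by auto
next
  note p = perm_of_permutes[OF w]
  assume *: "\<forall>i\<in>{1..n}. row m (perm_of w i) = row m i"
  show "act_mon w m = m"
  proof (rule mons_eqI[OF act_mon_in_mons[OF w m] m])
    fix i assume i: "i \<in> {1..n}"
    obtain l where l: "l \<in> {1..n}" "i = perm_of w l"
      using i permutes_image[OF p] by blast
    show "row (act_mon w m) i = row m i" using row_act_mon[OF w m l(1)] * l by simp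
  qed
qed

lemma row_orbit_mon:
  assumes "j \<in> {1..r}"
  shows "row (orbit_mon w i j k) a = (if a \<in> orbit (perm_of w) i then unit_vec j k else 0)"
proof -
  have "row (orbit_mon w i j k) a = (\<Sum>b\<in>orbit (perm_of w) i. if b = a then unit_vec j k else 0)"
    unfolding orbit_mon_def row_sum using unit_vec_vecs[OF assms] by (intro sum.cong refl) (auto simp: row_blk)
  then show ?thesis using finite_orbits(2)[OF w, of i] by simp
qed

lemma orbit_mon_mons: "i \<in> {1..n} \<Longrightarrow> orbit_mon w i j k \<in> mons"
  unfolding orbit_mon_def using orbit_perm_of_subset[OF w] by (intro mons_sum blk_in_mons) blast

lemma orbit_step_iff:
  "perm_of w a \<in> orbit (perm_of w) i \<longleftrightarrow> a \<in> orbit (perm_of w) i"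
  using cyclic_on_f_in[OF perm_of_permutes[OF w] cyclic_on_orbit'[OF permutation_perm_of[OF w]], of a i] orbit.step[of a "perm_of w" i]
  by blast

lemma mdeg_orbit_mon:
  assumes "i \<in> {1..n}" "j \<in> {1..r}"
  shows "mdeg (orbit_mon w i j k) = unit_vec j (k * card (orbit (perm_of w) i))"
proof -
  have "mdeg (orbit_mon w i j k) = (\<Sum>a\<in>orbit (perm_of w) i. unit_vec j k)"
    unfolding orbit_mon_def mdeg_sum
    using orbit_perm_of_subset[OF w assms(1)] unit_vec_vecs[OF assms(2)]
    by (intro sum.cong refl mdeg_blk) auto
  also have "\<dots> = unit_vec j (k * card (orbit (perm_of w) i))"
    using finite_orbits(2)[OF w, of i]
    by (induction rule: finite_induct) (auto simp: unit_vec_def fun_eq_iff)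
  finally show ?thesis .
qed

lemma act_mon_orbit_mon:
  assumes "i \<in> {1..n}" "j \<in> {1..r}"
  shows "act_mon w (orbit_mon w i j k) = orbit_mon w i j k"
  using act_mon_fixed_iff[OF orbit_mon_mons[OF assms(1)]] by (simp add: row_orbit_mon[OF assms(2)] orbit_step_iff)

lemma act_sgn_orbit_mon:
  assumes "j \<in> {1..r}"
  shows "act_sgn w (orbit_mon w i j k) = (of_int (orbit_sign w i) ^ k :: 'k::field_char_0)"
  by (simp add: orbit_mon_def act_sgn_sum act_sgn_blk tot_unit_vec[OF assms] orbit_sign_def prod_power_distrib)

text \<open>A monomial fixed by \<open>act_mon w\<close> has equal rows along a cycle. If its
  exponent at (i, j) is at least k, it is divisible by \<open>orbit_mon w i j k\<close>, and the
  quotient is again fixed, of degree lower by k times the cycle length.\<close>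

lemma fixed_mons_shift:
  assumes i: "i \<in> {1..n}" and j: "j \<in> {1..r}"
  shows "{m \<in> fixed_mons J w. k \<le> row m i j} =
    (if k * card (orbit (perm_of w) i) \<le> J j
     then (\<lambda>m. m + orbit_mon w i j k) ` fixed_mons (J - unit_vec j (k * card (orbit (perm_of w) i))) w else {})"
proof -
  let ?o = "orbit_mon w i j k" and ?c = "k * card (orbit (perm_of w) i)"
  note deg = mdeg_orbit_mon[OF i j] and om = orbit_mon_mons[OF i]
  have sub: "m \<in> (\<lambda>m. m + ?o) ` fixed_mons (J - unit_vec j ?c) w \<and> ?c \<le> J j"
    if m: "m \<in> fixed_mons J w" "k \<le> row m i j" for m
  proof -
    have mm: "m \<in> mons" "mdeg m = J" "act_mon w m = m" using m by (auto simp: fixed_mons_def mono_of_def)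
    have const: "k \<le> row m a j" if "a \<in> orbit (perm_of w) i" for a
      using that
    proof induction
      case base
      then show ?case using act_mon_fixed_iff[OF mm(1)] mm(3) i m(2) by simp
    next
      case (step a)
      then have "a \<in> {1..n}" using orbit_perm_of_subset[OF w i] by blast
      then show ?case using act_mon_fixed_iff[OF mm(1)] mm(3) step by simp
    qed
    have m': "m = (m - ?o) + ?o"
    proof (rule poly_mapping_eqI)
      fix v :: "nat \<times> nat"
      have "lookup ?o v \<le> lookup m v"
      proof (cases "v \<in> {1..n} \<times> {1..r}")
        case True
        then have "lookup ?o v = row ?o (fst v) (snd v)" "lookup m v = row m (fst v) (snd v)"
          by (auto simp: row_def)
        then show ?thesis using const[of "fst v"] by (auto simp: row_orbit_mon[OF j] unit_vec_def)
      next
        case False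
        then show ?thesis using mons_lookup[OF om] by simp
      qed
      then show "lookup m v = lookup (m - ?o + ?o) v"
        by (simp add: lookup_add lookup_minus)
    qed
    have J: "J = mdeg (m - ?o) + unit_vec j ?c" using arg_cong[OF m', of mdeg] mm(2) by (simp add: mdeg_add deg)
    have "act_mon w ((m - ?o) + ?o) = (m - ?o) + ?o"
      unfolding m'[symmetric] by (rule mm(3))
    then have "act_mon w (m - ?o) + ?o = (m - ?o) + ?o"
      by (simp only: act_mon_add act_mon_orbit_mon[OF i j])
    then have "act_mon w (m - ?o) = m - ?o" by simp
    moreover have "m - ?o \<in> mons" using mm(1) m' mons_add_iff by metis
    moreover have "mdeg (m - ?o) = J - unit_vec j ?c"
      by (rule ext) (simp add: J fun_diff_def)
    ultimately have "m - ?o \<in> fixed_mons (J - unit_vec j ?c) w" by (simp add: fixed_mons_def mono_of_def)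
    moreover have "?c \<le> J j" by (subst J) (simp add: unit_vec_def)
    ultimately show ?thesis using m' by blast
  qed
  have sup: "m + ?o \<in> {m \<in> fixed_mons J w. k \<le> row m i j}"
    if m: "m \<in> fixed_mons (J - unit_vec j ?c) w" and c: "?c \<le> J j" for m
  proof -
    have mm: "m \<in> mons" "mdeg m = J - unit_vec j ?c" "act_mon w m = m" using m by (auto simp: fixed_mons_def mono_of_def)
    have "mdeg (m + ?o) = J"
      using c by (auto simp: mdeg_add mm(2) deg fun_eq_iff unit_vec_def fun_diff_def)
    moreover have "row ?o i j = k"
      using permutation_self_in_orbit[OF permutation_perm_of[OF w], of i] by (simp add: row_orbit_mon[OF j] unit_vec_def)
    ultimately show ?thesis
      using mm om by (simp add: fixed_mons_def mono_of_def act_mon_add act_mon_orbit_mon[OF i j] row_add)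
  qed
  show ?thesis using sub sup by (auto split: if_splits)
qed

lemma fixed_mons_shift_sum:
  assumes i: "i \<in> {1..n}" and j: "j \<in> {1..r}"
  shows "(\<Sum>m | m \<in> fixed_mons J w \<and> k \<le> row m i j. act_sgn w m :: 'k::field_char_0) =
    (if k * card (orbit (perm_of w) i) \<le> J j
     then of_int (orbit_sign w i) ^ k * sym_trace (J - unit_vec j (k * card (orbit (perm_of w) i))) w else 0)"
proof -
  have "(\<Sum>m\<in>(\<lambda>m. m + orbit_mon w i j k) ` S. act_sgn w m :: 'k) = of_int (orbit_sign w i) ^ k * (\<Sum>m\<in>S. act_sgn w m)" for S
    by (subst sum.reindex)
       (auto simp: inj_on_def act_sgn_add act_sgn_orbit_mon[OF j] sum_distrib_right[symmetric] mult.commute)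
  then show ?thesis unfolding fixed_mons_shift[OF i j] by (simp add: sym_trace_fixed)
qed

text \<open>Newton's identity for the traces on the symmetric powers of the \<open>j\<close>-th copy of \<open>V\<^sub>n\<close>: count each
  fixed monomial with its exponents and strip powers of whole orbits.\<close>
lemma sym_trace_Newton:
  assumes j: "j \<in> {1..r}"
  shows "of_nat (J j) * sym_trace J w =
    (\<Sum>t = 1..J j. orbit_power_sum n w t * sym_trace (J - unit_vec j t) w :: 'k::field_char_0)"
proof -
  let ?L = "\<lambda>i. card (orbit (perm_of w) i)"
  let ?e = "\<lambda>i. of_int (orbit_sign w i) :: 'k"
  let ?Z = "\<lambda>t. sym_trace (J - unit_vec j t) w :: 'k"
  \<comment> \<open>The degree in copy j counts the pairs (i, k) with k between 1 and the exponent
    of the variable (i, j).\<close>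
  have row: "of_nat (J j) = (\<Sum>i = 1..n. \<Sum>k = 1..J j. if k \<le> row m i j then 1 else 0 :: 'k)"
    if m: "m \<in> fixed_mons J w" for m
  proof -
    have J: "mdeg m = J" using m by (auto simp: fixed_mons_def mono_of_def)
    have "(\<Sum>k = 1..J j. if k \<le> row m i j then 1 else 0 :: 'k) = of_nat (row m i j)" if i: "i \<in> {1..n}" for i
    proof -
      have "{k \<in> {1..J j}. k \<le> row m i j} = {1..row m i j}" using row_le_mdeg[OF i, of m j] J by auto
      then show ?thesis by (simp add: sum.inter_filter[symmetric])
    qed
    moreover have "J j = (\<Sum>i = 1..n. row m i j)" using j J by (auto simp: mdeg_def row_def)
    ultimately show ?thesis by simp
  qed
  have "of_nat (J j) * sym_trace J w = (\<Sum>m\<in>fixed_mons J w. \<Sum>i = 1..n. \<Sum>k = 1..J j.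
      if k \<le> row m i j then act_sgn w m else 0 :: 'k)"
    unfolding sym_trace_fixed sum_distrib_left
    by (intro sum.cong refl) (simp add: row sum_distrib_right if_distrib[of "\<lambda>x. x * _"] cong: if_cong)
  also have "\<dots> = (\<Sum>i = 1..n. \<Sum>k = 1..J j. \<Sum>m\<in>fixed_mons J w. if k \<le> row m i j then act_sgn w m else 0)"
    by (subst sum.swap, intro sum.cong refl) (rule sum.swap)
  also have "\<dots> = (\<Sum>i = 1..n. \<Sum>t | t \<in> {1..J j} \<and> ?L i dvd t. ?e i ^ (t div ?L i) * ?Z t)"
  proof (rule sum.cong[OF refl])
    fix i assume i: "i \<in> {1..n}"
    have L: "?L i > 0" by (rule card_orbit_pos[OF w])
    have "(\<Sum>k = 1..J j. \<Sum>m\<in>fixed_mons J w. if k \<le> row m i j then act_sgn w m else 0) =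
        (\<Sum>k = 1..J j. if k * ?L i \<le> J j then ?e i ^ k * ?Z (k * ?L i) else 0)"
      by (intro sum.cong refl) (simp add: sum.inter_filter[symmetric] fixed_mons_shift_sum[OF i j])
    also have "\<dots> = (\<Sum>k | k \<in> {1..J j} \<and> k * ?L i \<le> J j. ?e i ^ k * ?Z (k * ?L i))"
      by (simp add: sum.inter_filter[symmetric])
    \<comment> \<open>The substitution t = k * L, where L is the cycle length and t the degree
      stripped off.\<close>
    also have "\<dots> = (\<Sum>t | t \<in> {1..J j} \<and> ?L i dvd t. ?e i ^ (t div ?L i) * ?Z t)"
    proof (rule sum.reindex_bij_witness[of _ "\<lambda>t. t div ?L i" "\<lambda>k. k * ?L i"])
      fix t assume t: "t \<in> {t. t \<in> {1..J j} \<and> ?L i dvd t}"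
      then have eq: "t div ?L i * ?L i = t" by simp
      then show "t div ?L i * ?L i = t" .
      have "t div ?L i > 0" using t eq by (cases "t div ?L i") auto
      moreover have "t div ?L i \<le> J j"
        using t by (intro order_trans[OF div_le_dividend]) simp
      ultimately show "t div ?L i \<in> {k. k \<in> {1..J j} \<and> k * ?L i \<le> J j}" using t eq by auto
    qed (use L in auto)
    finally show "(\<Sum>k = 1..J j. \<Sum>m\<in>fixed_mons J w. if k \<le> row m i j then act_sgn w m else 0) =
        (\<Sum>t | t \<in> {1..J j} \<and> ?L i dvd t. ?e i ^ (t div ?L i) * ?Z t)" .
  qed
  also have "\<dots> = (\<Sum>i = 1..n. \<Sum>t = 1..J j. if ?L i dvd t then ?e i ^ (t div ?L i) * ?Z t else 0)"
    by (rule sum.cong[OF refl]) (simp add: sum.inter_filter[symmetric])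
  also have "\<dots> = (\<Sum>t = 1..J j. \<Sum>i = 1..n. if ?L i dvd t then ?e i ^ (t div ?L i) * ?Z t else 0)"
    by (rule sum.swap)
  also have "\<dots> = (\<Sum>t = 1..J j. orbit_power_sum n w t * ?Z t)"
    unfolding orbit_power_sum_def sum_distrib_right
    by (rule sum.cong[OF refl]) (simp add: sum.inter_filter[symmetric])
  finally show ?thesis .
qed

end

end

text \<open>The indices are grouped by cycle length and sign. A cycle of length l contains l of
  them, and w makes t / l turns around it.\<close>

lemma orbit_power_sum_cycles:
  assumes w: "w \<in> weyl_group W n" and t: "t \<ge> 1"
  shows "orbit_power_sum n w t = (\<Sum>l | l \<in> {1..t} \<and> l dvd t.
    of_nat (l * cycle_count W n w (PosCyc l)) + (- 1) ^ (t div l) * of_nat (l * cycle_count W n w (NegCyc l)) :: 'k::field_char_0)"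
proof -
  note ws = weyl_group_signed[OF w]
  let ?L = "\<lambda>i. card (orbit (perm_of w) i)"
  let ?h = "\<lambda>i. of_int (orbit_sign w i) ^ (t div ?L i) :: 'k"
  let ?S = "{i. i \<in> {1..n} \<and> ?L i dvd t}" and ?T = "{l. l \<in> {1..t} \<and> l dvd t}"
  have "?L ` ?S \<subseteq> ?T" using card_orbit_pos[OF ws] t by (auto simp: Suc_le_eq dvd_imp_le)
  then have "orbit_power_sum n w t = (\<Sum>l\<in>?T. \<Sum>i\<in>{i \<in> ?S. ?L i = l}. ?h i)"
    unfolding orbit_power_sum_def by (intro sum.group[symmetric]) auto
  also have "\<dots> = (\<Sum>l\<in>?T. of_nat (l * cycle_count W n w (PosCyc l)) + (- 1) ^ (t div l) * of_nat (l * cycle_count W n w (NegCyc l)))"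
  proof (rule sum.cong[OF refl])
    fix l assume l: "l \<in> ?T"
    let ?P = "{i \<in> {1..n}. ?L i = l \<and> orbit_sign w i = 1}" and ?N = "{i \<in> {1..n}. ?L i = l \<and> orbit_sign w i = -1}"
    have "{i \<in> ?S. ?L i = l} = ?P \<union> ?N"
      using l orbit_sign_cases[OF ws] by blast
    then have "(\<Sum>i\<in>{i \<in> ?S. ?L i = l}. ?h i) = (\<Sum>i\<in>?P. ?h i) + (\<Sum>i\<in>?N. ?h i)"
      by (simp only:) (rule sum.union_disjoint; auto)
    also have "(\<Sum>i\<in>?P. ?h i) = (\<Sum>i\<in>?P. 1)" by (intro sum.cong refl) auto
    also have "\<dots> = of_nat (l * cycle_count W n w (PosCyc l))" using cycle_count_indices(1)[OF w, of l] by simp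
    also have "(\<Sum>i\<in>?N. ?h i) = (\<Sum>i\<in>?N. (- 1) ^ (t div l))" by (intro sum.cong refl) auto
    also have "\<dots> = (- 1) ^ (t div l) * of_nat (l * cycle_count W n w (NegCyc l))"
      using cycle_count_indices(2)[OF w, of l] by simp
    finally show "(\<Sum>i\<in>{i \<in> ?S. ?L i = l}. ?h i) =
      of_nat (l * cycle_count W n w (PosCyc l)) + (- 1) ^ (t div l) * of_nat (l * cycle_count W n w (NegCyc l))" .
  qed
  finally show ?thesis .
qed

section \<open>Character polynomials of bounded degree\<close>

interpretation id_hom: mpol_hom "id :: 'k::comm_ring_1 \<Rightarrow> 'k"
  by unfold_locales auto

definition weighted_degree :: "(cycle_var \<Rightarrow>\<^sub>0 nat) \<Rightarrow> nat" where
  "weighted_degree m = (\<Sum>v\<in>keys m. var_degree v * lookup m v)"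

text \<open>A bound on every monomial passes directly to sums and products, unlike the maximum in
  \<open>char_poly_degree\<close>; \<open>char_polys_uptoD\<close> translates back.\<close>

definition char_polys_upto :: "weyl_type \<Rightarrow> nat \<Rightarrow> (cycle_var, 'k::field) mpol set" where
  "char_polys_upto W d = {F. \<forall>m\<in>keys F. keys m \<subseteq> cycle_vars W \<and> weighted_degree m \<le> d}"

lemma weighted_degree_add: "weighted_degree (m + m') = weighted_degree m + weighted_degree m'"
proof -
  let ?S = "keys m \<union> keys m'"
  have "weighted_degree x = (\<Sum>v\<in>?S. var_degree v * lookup x v)" if "keys x \<subseteq> ?S" for x
    unfolding weighted_degree_def by (rule sum.mono_neutral_left) (use that in \<open>auto simp: in_keys_iff\<close>)
  from this[of m] this[of m'] this[of "m + m'"] show ?thesis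
    using Poly_Mapping.keys_add[of m m'] by (simp add: lookup_add distrib_left sum.distrib)
qed

lemma char_polys_upto_add:
  "F \<in> char_polys_upto W d \<Longrightarrow> G \<in> char_polys_upto W d \<Longrightarrow> F + G \<in> char_polys_upto W d"
  using Poly_Mapping.keys_add[of F G] by (auto simp: char_polys_upto_def)

lemma char_polys_upto_mult:
  assumes "F \<in> char_polys_upto W d" "G \<in> char_polys_upto W e"
  shows "F * G \<in> char_polys_upto W (d + e)"
  unfolding char_polys_upto_def
proof (intro CollectI ballI)
  fix m assume "m \<in> keys (F * G)"
  then obtain a b where ab: "m = a + b" "a \<in> keys F" "b \<in> keys G"
    using Poly_Mapping.keys_mult[of F G] by blast
  then have "keys a \<subseteq> cycle_vars W" "keys b \<subseteq> cycle_vars W"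
    "weighted_degree a \<le> d" "weighted_degree b \<le> e"
    using assms by (auto simp: char_polys_upto_def)
  then show "keys m \<subseteq> cycle_vars W \<and> weighted_degree m \<le> d + e"
    using Poly_Mapping.keys_add[of a b] unfolding ab(1) weighted_degree_add by fastforce
qed

lemma char_polys_upto_const: "mpol_const c \<in> char_polys_upto W d"
  by (simp add: char_polys_upto_def mpol_const_def weighted_degree_def)

lemma char_polys_upto_mono: "F \<in> char_polys_upto W d \<Longrightarrow> d \<le> e \<Longrightarrow> F \<in> char_polys_upto W e"
  by (auto simp: char_polys_upto_def intro: order_trans)

lemma char_polys_upto_scale: "F \<in> char_polys_upto W d \<Longrightarrow> mpol_const c * F \<in> char_polys_upto W d"
  using char_polys_upto_mult[OF char_polys_upto_const[of c W 0]] by simp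

lemma char_polys_upto_sum:
  "(\<And>x. x \<in> S \<Longrightarrow> f x \<in> char_polys_upto W d) \<Longrightarrow> (\<Sum>x\<in>S. f x) \<in> char_polys_upto W d"
proof (induction S rule: infinite_finite_induct)
  case (insert x S)
  then show ?case by (simp add: char_polys_upto_add)
qed (simp_all add: char_polys_upto_def)

lemma char_polys_upto_var: "v \<in> cycle_vars W \<Longrightarrow> mon (single v 1) \<in> char_polys_upto W (var_degree v)"
  by (simp add: char_polys_upto_def weighted_degree_def)

lemma char_poly_value_simps:
  "char_poly_value \<xi> (F + G) = char_poly_value \<xi> F + char_poly_value \<xi> G"
  "char_poly_value \<xi> (F * G) = char_poly_value \<xi> F * char_poly_value \<xi> G"
  "char_poly_value \<xi> (\<Sum>x\<in>S. f x) = (\<Sum>x\<in>S. char_poly_value \<xi> (f x))"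
  "char_poly_value \<xi> (mpol_const c) = c"
  "char_poly_value \<xi> (mon (single v 1)) = of_nat (\<xi> v)"
  by (simp_all add: char_poly_value_def id_hom.eval_add id_hom.eval_mult id_hom.eval_sum id_hom.eval_single)

lemma char_polys_uptoD:
  assumes "F \<in> char_polys_upto W d"
  shows "F \<in> char_polys W" "char_poly_degree F \<le> d"
  using assms by (auto simp: char_polys_upto_def char_polys_def char_poly_degree_def weighted_degree_def)

text \<open>In type S the negative cycles have no variable; their count is 0 and is represented by
  the zero polynomial. This allows one formula for all three types.\<close>

lemma cycle_count_poly:
  assumes "l \<ge> 1" "v \<in> {PosCyc l, NegCyc l}"
  obtains G :: "(cycle_var, 'k::field_char_0) mpol" where "G \<in> char_polys_upto W l"
    "\<And>n w. char_poly_value (cycle_count W n w) G = of_nat (cycle_count W n w v)"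
proof (cases "v \<in> cycle_vars W")
  case True
  then have "mon (single v 1) \<in> (char_polys_upto W l :: (cycle_var, 'k) mpol set)"
    using char_polys_upto_var[OF True] assms(2) by auto
  then show ?thesis by (rule that) (rule char_poly_value_simps(5))
next
  case False
  then have "cycle_count W n w v = 0" for n w using assms by (cases W) auto
  then show ?thesis
    by (intro that[of "mpol_const 0"]) (simp_all add: char_polys_upto_const char_poly_value_simps)
qed

lemma orbit_power_sum_poly:
  assumes t: "t \<ge> 1"
  obtains G :: "(cycle_var, 'k::field_char_0) mpol" where "G \<in> char_polys_upto W t"
    "\<And>n w. w \<in> weyl_group W n \<Longrightarrow> char_poly_value (cycle_count W n w) G = orbit_power_sum n w t"
proof -
  have "\<exists>G :: (cycle_var, 'k) mpol. G \<in> char_polys_upto W l \<and>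
      (\<forall>n w. char_poly_value (cycle_count W n w) G = of_nat (cycle_count W n w v))"
    if "l \<ge> 1" "v \<in> {PosCyc l, NegCyc l}" for l v
    using cycle_count_poly[OF that] by metis
  then have "\<forall>l. \<exists>G :: (cycle_var, 'k) mpol. l \<ge> 1 \<longrightarrow> G \<in> char_polys_upto W l \<and>
      (\<forall>n w. char_poly_value (cycle_count W n w) G = of_nat (cycle_count W n w (PosCyc l)))"
    "\<forall>l. \<exists>G :: (cycle_var, 'k) mpol. l \<ge> 1 \<longrightarrow> G \<in> char_polys_upto W l \<and>
      (\<forall>n w. char_poly_value (cycle_count W n w) G = of_nat (cycle_count W n w (NegCyc l)))"
    by blast+
  then obtain P N :: "nat \<Rightarrow> (cycle_var, 'k) mpol" where
    P: "\<And>l. l \<ge> 1 \<Longrightarrow> P l \<in> char_polys_upto W l"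
      "\<And>l n w. l \<ge> 1 \<Longrightarrow> char_poly_value (cycle_count W n w) (P l) = of_nat (cycle_count W n w (PosCyc l))" and
    N: "\<And>l. l \<ge> 1 \<Longrightarrow> N l \<in> char_polys_upto W l"
      "\<And>l n w. l \<ge> 1 \<Longrightarrow> char_poly_value (cycle_count W n w) (N l) = of_nat (cycle_count W n w (NegCyc l))"
    by metis
  let ?T = "{l. l \<in> {1..t} \<and> l dvd t}"
  let ?G = "\<Sum>l\<in>?T. mpol_const (of_nat l) * P l + mpol_const ((- 1) ^ (t div l) * of_nat l) * N l"
  show ?thesis
  proof (rule that[of ?G])
    show "?G \<in> char_polys_upto W t"
    proof (rule char_polys_upto_sum)
      fix l assume "l \<in> ?T"
      then show "mpol_const (of_nat l) * P l + mpol_const ((- 1) ^ (t div l) * of_nat l) * N l \<in> char_polys_upto W t"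
        by (intro char_polys_upto_add char_polys_upto_scale char_polys_upto_mono[OF P(1)] char_polys_upto_mono[OF N(1)]) auto
    qed
    fix n w assume w: "w \<in> weyl_group W n"
    show "char_poly_value (cycle_count W n w) ?G = orbit_power_sum n w t"
      unfolding orbit_power_sum_cycles[OF w t] char_poly_value_simps(3)
      by (intro sum.cong refl) (simp add: char_poly_value_simps P(2) N(2) mult.assoc)
  qed
qed

text \<open>Newton's identity is solved for the trace in degree J, dividing by some J j > 0, which
  uses characteristic zero. A term is a polynomial of degree at most t times one of degree at most
  |J| - t, and the choice of j and of both factors is made before n and w.\<close>

lemma sym_trace_poly:
  assumes "\<forall>j. j \<notin> {1..r} \<longrightarrow> J j = 0"
  shows "\<exists>F :: (cycle_var, 'k::field_char_0) mpol. F \<in> char_polys_upto W (\<Sum>j = 1..r. J j) \<and>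
    (\<forall>n. \<forall>w\<in>weyl_group W n. diag.sym_trace n r J w = char_poly_value (cycle_count W n w) F)"
  using assms
proof (induction "\<Sum>j = 1..r. J j" arbitrary: J rule: less_induct)
  case less
  show ?case
  proof (cases "\<exists>j\<in>{1..r}. J j > 0")
    case False
    then have J: "J = 0" using less.prems by (auto simp: fun_eq_iff)
    have "diag.sym_trace n r J w = (1 :: 'k)" for n w
    proof -
      interpret diag n r .
      have "mono_of J = {0}"
      proof (intro equalityI subsetI)
        fix m assume m: "m \<in> mono_of J"
        have "row m i = row 0 i" if "i \<in> {1..n}" for i
          using row_le_mdeg[OF that, of m] m by (auto simp: mono_of_def J fun_eq_iff row_def)
        then show "m \<in> {0}" using m mons_eqI[of m 0] by (auto simp: mono_of_def)
      qed (auto simp: mono_of_def J)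
      then show ?thesis by (simp add: sym_trace_def diag_act_single)
    qed
    then show ?thesis
      by (intro exI[of _ "mpol_const 1"]) (simp add: char_polys_upto_const char_poly_value_simps)
  next
    case True
    then obtain j where j: "j \<in> {1..r}" "J j > 0" by blast
    let ?d = "\<lambda>J. \<Sum>j = 1..r. J j :: nat"
    let ?J = "\<lambda>t. J - unit_vec j t"
    have d: "?d (?J t) + t = ?d J" if "t \<in> {1..J j}" for t
    proof -
      have "J = ?J t + unit_vec j t" using that by (auto simp: fun_eq_iff unit_vec_def fun_diff_def)
      then have "?d J = ?d (?J t + unit_vec j t)" by simp
      also have "\<dots> = ?d (?J t) + ?d (unit_vec j t)" by (simp only: plus_fun_apply sum.distrib)
      also have "?d (unit_vec j t) = t" using j by (simp add: unit_vec_def)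
      finally show ?thesis by simp
    qed
    have "\<forall>t. \<exists>F :: (cycle_var, 'k) mpol. t \<in> {1..J j} \<longrightarrow> F \<in> char_polys_upto W (?d (?J t)) \<and>
        (\<forall>n. \<forall>w\<in>weyl_group W n. diag.sym_trace n r (?J t) w = char_poly_value (cycle_count W n w) F)"
    proof
      fix t
      show "\<exists>F :: (cycle_var, 'k) mpol. t \<in> {1..J j} \<longrightarrow> F \<in> char_polys_upto W (?d (?J t)) \<and>
        (\<forall>n. \<forall>w\<in>weyl_group W n. diag.sym_trace n r (?J t) w = char_poly_value (cycle_count W n w) F)"
      proof (cases "t \<in> {1..J j}")
        case True
        have "?d (?J t) < ?d J" using d[OF True] True by auto
        moreover have "\<forall>l. l \<notin> {1..r} \<longrightarrow> ?J t l = 0" using less.prems by (auto simp: fun_diff_def)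
        ultimately show ?thesis using less.hyps[of "?J t"] by blast
      qed blast
    qed
    then obtain F :: "nat \<Rightarrow> (cycle_var, 'k) mpol" where
      F: "\<And>t. t \<in> {1..J j} \<Longrightarrow> F t \<in> char_polys_upto W (?d (?J t))"
        "\<And>t n w. t \<in> {1..J j} \<Longrightarrow> w \<in> weyl_group W n \<Longrightarrow>
          diag.sym_trace n r (?J t) w = char_poly_value (cycle_count W n w) (F t)"
      by metis
    have "\<forall>t. \<exists>G :: (cycle_var, 'k) mpol. t \<ge> 1 \<longrightarrow> G \<in> char_polys_upto W t \<and>
        (\<forall>n w. w \<in> weyl_group W n \<longrightarrow> char_poly_value (cycle_count W n w) G = orbit_power_sum n w t)"
      using orbit_power_sum_poly by metis
    then obtain G :: "nat \<Rightarrow> (cycle_var, 'k) mpol" where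
      G: "\<And>t. t \<ge> 1 \<Longrightarrow> G t \<in> char_polys_upto W t"
        "\<And>t n w. t \<ge> 1 \<Longrightarrow> w \<in> weyl_group W n \<Longrightarrow>
          char_poly_value (cycle_count W n w) (G t) = orbit_power_sum n w t"
      by metis
    let ?F = "mpol_const (1 / of_nat (J j)) * (\<Sum>t = 1..J j. G t * F t)"
    show ?thesis
    proof (intro exI[of _ ?F] conjI allI ballI)
      show "?F \<in> char_polys_upto W (?d J)"
      proof (rule char_polys_upto_scale, rule char_polys_upto_sum)
        fix t assume t: "t \<in> {1..J j}"
        have "G t * F t \<in> char_polys_upto W (t + ?d (?J t))"
          using t by (intro char_polys_upto_mult G(1) F(1)) auto
        then show "G t * F t \<in> char_polys_upto W (?d J)" using d[OF t] by (simp only: add.commute)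
      qed
      fix n w assume w: "w \<in> weyl_group W n"
      have "of_nat (J j) * diag.sym_trace n r J w = (\<Sum>t = 1..J j. orbit_power_sum n w t * diag.sym_trace n r (?J t) w :: 'k)"
        by (rule diag.sym_trace_Newton[OF weyl_group_signed[OF w] j(1)])
      also have "\<dots> = (\<Sum>t = 1..J j. char_poly_value (cycle_count W n w) (G t * F t))"
        by (intro sum.cong refl) (simp add: char_poly_value_simps G(2)[OF _ w] F(2)[OF _ w])
      finally show "diag.sym_trace n r J w = char_poly_value (cycle_count W n w) ?F"
        using j(2) by (simp add: char_poly_value_simps field_simps)
    qed
  qed
qed

section \<open>The recursion for the characters\<close>

lemma multihomogeneous_restrict:
  "multihomogeneous n r (\<lambda>j. if j \<in> {1..r} then J j else 0) = multihomogeneous n r J"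
  by (simp add: multihomogeneous_def)

lemma coinv_character_restrict:
  "coinv_character W n r (\<lambda>j. if j \<in> {1..r} then J j else 0) w = coinv_character W n r J w"
  "coinv_dim T W n r (\<lambda>j. if j \<in> {1..r} then J j else 0) = coinv_dim T W n r J"
  by (simp_all only: coinv_character_def coinv_dim_def coinv_component_def multihomogeneous_restrict)

text \<open>The bounds on n provide the slots and the low-degree range. The slots occur only in the
  proof, so the identity has the same form for all n in this range.\<close>

lemma coinv_character_recursion:
  assumes J: "J \<in> diag.vecs r"
    and n: "n > card {A \<in> diag_weyl.inv_exps r W. A \<le> J}" "n > (\<Sum>j = 1..r. J j)"
    and w: "w \<in> weyl_group W n"
  shows "diag.sym_trace n r J w =
      (\<Sum>\<kappa>\<in>diag_weyl.exp_multisets r W J. coinv_character W n r (J - sum_mset \<kappa>) w :: 'k::field_char_0)"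
    and "of_nat (coinv_dim TYPE('k) W n r J) = (coinv_character W n r J id :: 'k)"
proof -
  interpret diag_weyl n r W .
  let ?H = "{A \<in> inv_exps. A \<le> J}"
  obtain s where s: "inj_on s ?H" "s ` ?H \<subseteq> {1..n}"
    using card_le_inj[OF finite_inv_exps_le, of "{1..n}" J] n(1) by auto
  \<comment> \<open>J itself serves as J0, since every multidegree J -
    \<open>sum_mset \<kappa>\<close> lies below it.\<close>
  interpret diag_slots n r W J s
    by unfold_locales (use s n(2) in \<open>auto simp: tot_def\<close>)
  have restrict: "(\<lambda>j. if j \<in> {1..r} then K j else 0) = K" if "K \<in> vecs" for K
    using that by (auto simp: vecs_def fun_eq_iff)
  have K: "J - sum_mset \<kappa> \<in> vecs" "J - sum_mset \<kappa> \<le> J" for \<kappa>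
    using J by (auto simp: vecs_def fun_diff_def le_fun_def)
  have "sym_trace J w = (\<Sum>\<kappa>\<in>exp_multisets J. chi (J - sum_mset \<kappa>) w :: 'k)"
    unfolding sym_trace_def by (rule trace_decomposition[OF order_refl w])
  also have "\<dots> = (\<Sum>\<kappa>\<in>exp_multisets J. coinv_character W n r (J - sum_mset \<kappa>) w)"
    using character_and_dim(1)[of "J - sum_mset _", OF _ w, where 'k = 'k] restrict[OF K(1)] K(2) by simp
  finally show "sym_trace J w = (\<Sum>\<kappa>\<in>exp_multisets J. coinv_character W n r (J - sum_mset \<kappa>) w :: 'k)" .
  show "of_nat (coinv_dim TYPE('k) W n r J) = (coinv_character W n r J id :: 'k)"
    using character_and_dim[of J id, where 'k = 'k] restrict[OF J] id_weyl_group chi_id[of J, where 'k = 'k] by simp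
qed

text \<open>Every nonempty \<kappa> lowers the degree, so the recursion expresses the character for
  J by the trace on the polynomial ring and characters already known to be polynomial, with the
  degree bound |J| throughout.\<close>

lemma coinv_character_poly:
  assumes "J \<in> diag.vecs r"
  shows "\<exists>(F :: (cycle_var, 'k::field_char_0) mpol) N. F \<in> char_polys_upto W (\<Sum>j = 1..r. J j) \<and>
    (\<forall>n\<ge>N. \<forall>w\<in>weyl_group W n. coinv_character W n r J w = char_poly_value (cycle_count W n w) F)"
  using assms
proof (induction "\<Sum>j = 1..r. J j" arbitrary: J rule: less_induct)
  case less
  let ?d = "\<lambda>J. \<Sum>j = 1..r. J j :: nat"
  let ?M = "diag_weyl.exp_multisets r W J"
  have fin: "finite ?M" by (rule diag_weyl.finite_exp_multisets)
  have "\<forall>\<kappa>. \<exists>F :: (cycle_var, 'k) mpol. \<exists>N. \<kappa> \<in> ?M - {{#}} \<longrightarrow> F \<in> char_polys_upto W (?d J) \<and>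
      (\<forall>n\<ge>N. \<forall>w\<in>weyl_group W n. coinv_character W n r (J - sum_mset \<kappa>) w = char_poly_value (cycle_count W n w) F)"
  proof
    fix \<kappa>
    show "\<exists>F :: (cycle_var, 'k) mpol. \<exists>N. \<kappa> \<in> ?M - {{#}} \<longrightarrow> F \<in> char_polys_upto W (?d J) \<and>
      (\<forall>n\<ge>N. \<forall>w\<in>weyl_group W n. coinv_character W n r (J - sum_mset \<kappa>) w = char_poly_value (cycle_count W n w) F)"
    proof (cases "\<kappa> \<in> ?M - {{#}}")
      case \<kappa>: True
      \<comment> \<open>The sets of exponents do not involve n, so any value of n serves to reason
        about them.\<close>
      interpret diag_weyl 0 r W .
      obtain A \<mu> where A: "\<kappa> = add_mset A \<mu>" "A \<in> inv_exps"
        using \<kappa> by (cases \<kappa>) (auto simp: exp_multisets_def)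
      have le: "sum_mset \<kappa> \<le> J" using \<kappa> by (simp add: exp_multisets_def)
      have "tot A > 0" using A(2) tot_pos by (auto simp: inv_exps_def)
      then have "tot (sum_mset \<kappa>) > 0" by (simp add: A(1) tot_add)
      moreover have "J = (J - sum_mset \<kappa>) + sum_mset \<kappa>" using le by (auto simp: fun_eq_iff le_fun_def fun_diff_def)
      then have "tot J = tot (J - sum_mset \<kappa>) + tot (sum_mset \<kappa>)" by (metis tot_add)
      ultimately have lt: "?d (J - sum_mset \<kappa>) < ?d J" by (simp add: tot_def)
      moreover have "J - sum_mset \<kappa> \<in> vecs" using less.prems by (auto simp: vecs_def fun_diff_def)
      ultimately obtain F :: "(cycle_var, 'k) mpol" and N where "F \<in> char_polys_upto W (?d (J - sum_mset \<kappa>))"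
        "\<forall>n\<ge>N. \<forall>w\<in>weyl_group W n. coinv_character W n r (J - sum_mset \<kappa>) w = char_poly_value (cycle_count W n w) F"
        using less.hyps by blast
      then show ?thesis using char_polys_upto_mono[OF _ less_imp_le[OF lt]] by blast
    qed blast
  qed
  then obtain F :: "(nat \<Rightarrow> nat) multiset \<Rightarrow> (cycle_var, 'k) mpol" and N where
    F: "\<And>\<kappa>. \<kappa> \<in> ?M - {{#}} \<Longrightarrow> F \<kappa> \<in> char_polys_upto W (?d J)"
      "\<And>\<kappa> n w. \<kappa> \<in> ?M - {{#}} \<Longrightarrow> n \<ge> N \<kappa> \<Longrightarrow> w \<in> weyl_group W n \<Longrightarrow>
        coinv_character W n r (J - sum_mset \<kappa>) w = char_poly_value (cycle_count W n w) (F \<kappa>)"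
    by metis
  obtain Z :: "(cycle_var, 'k) mpol" where Z: "Z \<in> char_polys_upto W (?d J)"
    "\<And>n w. w \<in> weyl_group W n \<Longrightarrow> diag.sym_trace n r J w = char_poly_value (cycle_count W n w) Z"
    using sym_trace_poly[of r J W, where 'k = 'k] less.prems by (auto simp: diag.vecs_def)
  let ?G = "Z + mpol_const (- 1) * (\<Sum>\<kappa>\<in>?M - {{#}}. F \<kappa>)"
  \<comment> \<open>The first two entries meet the hypotheses of the recursion in degree J; the
    others are the finitely many thresholds of the lower degrees.\<close>
  let ?N = "Max (insert (Suc (card {A \<in> diag_weyl.inv_exps r W. A \<le> J})) (insert (Suc (?d J)) (N ` (?M - {{#}}))))"
  show ?case
  proof (intro exI[of _ ?G] exI[of _ ?N] conjI allI impI ballI)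
    show "?G \<in> char_polys_upto W (?d J)"
      by (intro char_polys_upto_add char_polys_upto_scale char_polys_upto_sum Z(1) F(1))
    fix n w assume n: "?N \<le> n" and w: "w \<in> weyl_group W n"
    have n1: "n > card {A \<in> diag_weyl.inv_exps r W. A \<le> J}" "n > ?d J"
      and n2: "\<And>\<kappa>. \<kappa> \<in> ?M - {{#}} \<Longrightarrow> N \<kappa> \<le> n"
      using n fin by auto
    \<comment> \<open>The empty multiset contributes the character in degree J, the unknown for
      which the recursion is solved.\<close>
    have "{#} \<in> ?M" by (simp add: diag_weyl.exp_multisets_def le_fun_def)
    then have "diag.sym_trace n r J w = coinv_character W n r J w +
        (\<Sum>\<kappa>\<in>?M - {{#}}. coinv_character W n r (J - sum_mset \<kappa>) w :: 'k)"
      using coinv_character_recursion(1)[OF less.prems n1 w, where 'k = 'k]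
      by (simp add: sum.remove[OF fin])
    also have "(\<Sum>\<kappa>\<in>?M - {{#}}. coinv_character W n r (J - sum_mset \<kappa>) w :: 'k) =
        (\<Sum>\<kappa>\<in>?M - {{#}}. char_poly_value (cycle_count W n w) (F \<kappa>))"
      by (intro sum.cong refl F(2) n2 w)
    finally have eq: "diag.sym_trace n r J w = coinv_character W n r J w +
        (\<Sum>\<kappa>\<in>?M - {{#}}. char_poly_value (cycle_count W n w) (F \<kappa>))" .
    show "coinv_character W n r J w = char_poly_value (cycle_count W n w) ?G"
      unfolding char_poly_value_simps Z(2)[OF w, symmetric] eq by simp
  qed
qed

theorem corollary6p3:
  fixes W :: weyl_type and r :: nat and J :: "nat \<Rightarrow> nat"
  assumes "r > 0"
  shows "\<exists>(F :: (cycle_var, 'k::field_char_0) mpol) N.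
           F \<in> char_polys W \<and> char_poly_degree F \<le> (\<Sum>j = 1..r. J j) \<and>
           (\<forall>n\<ge>N.
              (\<forall>w\<in>weyl_group W n.
                 coinv_character W n r J w = char_poly_value (cycle_count W n w) F) \<and>
              of_nat (coinv_dim TYPE('k) W n r J) =
                char_poly_value (\<lambda>v. if v = PosCyc 1 then n else 0) F)"
proof -
  \<comment> \<open>The recursion is stated for multidegrees that vanish outside
    \<open>{1..r}\<close>, while J is an arbitrary function.\<close>
  define K where "K = (\<lambda>j. if j \<in> {1..r} then J j else 0)"
  have K: "K \<in> diag.vecs r" by (simp add: K_def diag.vecs_def)
  have chK: "coinv_character W n r K w = (coinv_character W n r J w :: 'k)"
    and dimK: "coinv_dim TYPE('k) W n r K = coinv_dim TYPE('k) W n r J" for n w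
    unfolding K_def by (rule coinv_character_restrict)+
  have d: "(\<Sum>j = 1..r. K j) = (\<Sum>j = 1..r. J j)" by (simp add: K_def)
  obtain F :: "(cycle_var, 'k) mpol" and N where F: "F \<in> char_polys_upto W (\<Sum>j = 1..r. J j)"
    and N: "\<And>n w. n \<ge> N \<Longrightarrow> w \<in> weyl_group W n \<Longrightarrow>
      coinv_character W n r K w = char_poly_value (cycle_count W n w) F"
    using coinv_character_poly[OF K, of W, where 'k = 'k] unfolding d by blast
  let ?N = "max N (Suc (max (card {A \<in> diag_weyl.inv_exps r W. A \<le> K}) (\<Sum>j = 1..r. K j)))"
  show ?thesis
  proof (intro exI[of _ F] exI[of _ ?N] conjI allI impI ballI)
    fix n w assume n: "?N \<le> n"
    then have n1: "n > card {A \<in> diag_weyl.inv_exps r W. A \<le> K}" "n > (\<Sum>j = 1..r. K j)" by auto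
    show "coinv_character W n r J w = char_poly_value (cycle_count W n w) F" if "w \<in> weyl_group W n"
      using N[of n w] that n by (simp add: chK)
    \<comment> \<open>The dimension is the character at the identity, whose cycles are n positive
      1-cycles.\<close>
    have "of_nat (coinv_dim TYPE('k) W n r J) = (coinv_character W n r K id :: 'k)"
      using coinv_character_recursion(2)[OF K n1 id_weyl_group, where 'k = 'k] by (simp add: dimK)
    also have "\<dots> = char_poly_value (\<lambda>v. if v = PosCyc 1 then n else 0) F"
      using N[of n id] n id_weyl_group by (simp add: cycle_count_id[abs_def])
    finally show "of_nat (coinv_dim TYPE('k) W n r J) = char_poly_value (\<lambda>v. if v = PosCyc 1 then n else 0) F" .
  qed (use char_polys_uptoD[OF F] in auto)
qed

end
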